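(* Let $m\ge n$ and let $f:\mathbb{R}^{m\times n}\to\mathbb{R}$ be proper, bounded below, semi-algebraic, coercive, and $L$-smooth, i.e. $\|\nabla f(X)-\nabla f(Y)\|_F\le L\|X-Y\|_F$ for all $X,Y$. Let $0<w_1\le w_2\le\cdots\le w_n$ and $g(X)=\sum_{i=1}^n w_i|\sigma_i(X)|$, where $\sigma_1(X)\ge\cdots\ge\sigma_n(X)\ge 0$ are the singular values of $X$, and let $F=f+g$. Fix a step size $0<\mu<1/L$, let $X_0=0$, and for $t\ge 0$ define $$X_{t+1}\in P_g^\mu\big(X_t-\mu\nabla f(X_t)\big),\qquad P_g^\mu(M)=\arg\min_{X\in\mathbb{R}^{m\times n}}\tfrac12\|X-M\|_F^2+\mu\, g(X).$$ Suppose the sequence $\{X_t\}_{t\in\mathbb{N}}$ is bounded. Then $$\sum_{t=0}^\infty\|X_{t+1}-X_t\|_F<\infty,$$ and $\{X_t\}$ converges to a critical point $X_*$ of $F$, i.e. a point with $0\in\partial F(X_* )$.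
   Context: $\partial F$ denotes the limiting subdifferential: for a proper lower semicontinuous $h$ on a Euclidean space, the regular subdifferential $\hat\partial h(x)$ is the set of $y$ with $\liminf_{z\to 0,z\neq 0}\frac{h(x+z)-h(x)-\langle y,z\rangle}{\|z\|}\ge 0$, and $\partial h(x)$ is the set of $y$ for which there exist $x^k\to x$ with $h(x^k)\to h(x)$ and $y^k\in\hat\partial h(x^k)$ with $y^k\to y$. A function is semi-algebraic if its graph is a finite union of finite intersections of sets of the form $\{\zeta(u)=0,\ \zeta'(u)<0\}$ with $\zeta,\zeta'$ polynomials. Coercive means $f(X)\to\infty$ as $\|X\|_F\to\infty$. *)

theory Defs
  imports "HOL-Analysis.Analysis" "HOL-Library.Multiset"
begin

text \<open>Matrices in R^(m x n) are modelled as real^'n^'m (rows indexed by 'm, columns by 'n).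
  The norm and inner product of this type are the Frobenius norm and inner product.\<close>

inductive poly_fun :: "('a::euclidean_space \<Rightarrow> real) \<Rightarrow> bool" where
  pf_const: "poly_fun (\<lambda>u. c)"
| pf_coord: "b \<in> Basis \<Longrightarrow> poly_fun (\<lambda>u. u \<bullet> b)"
| pf_add: "poly_fun p \<Longrightarrow> poly_fun q \<Longrightarrow> poly_fun (\<lambda>u. p u + q u)"
| pf_mult: "poly_fun p \<Longrightarrow> poly_fun q \<Longrightarrow> poly_fun (\<lambda>u. p u * q u)"

definition semialgebraic :: "'a::euclidean_space set \<Rightarrow> bool" where
  "semialgebraic S \<longleftrightarrow>
     (\<exists>A :: (('a \<Rightarrow> real) \<times> ('a \<Rightarrow> real)) set set.
        finite A \<and> (\<forall>B\<in>A. finite B \<and> (\<forall>(p,q)\<in>B. poly_fun p \<and> poly_fun q)) \<and>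
        S = (\<Union>B\<in>A. \<Inter>(p,q)\<in>B. {u. p u = 0 \<and> q u < 0}))"

definition semialgebraic_fun :: "('a::euclidean_space \<Rightarrow> real) \<Rightarrow> bool" where
  "semialgebraic_fun f \<longleftrightarrow> semialgebraic {(x, f x) | x. True}"

text \<open>Multiset of singular values, via the singular value decomposition
  X = U D V^T with U, V orthogonal and D rectangular diagonal with nonnegative entries
  (m >= n, e embeds column indices into row indices).\<close>
definition sing_vals_mset :: "real^'n^'m \<Rightarrow> real multiset" where
  "sing_vals_mset X = (THE M. \<exists>(s::'n \<Rightarrow> real) (e::'n \<Rightarrow> 'm) (U::real^'m^'m) (V::real^'n^'n).
       M = image_mset s (mset_set UNIV) \<and> (\<forall>j. 0 \<le> s j) \<and> inj e \<and>
       orthogonal_matrix U \<and> orthogonal_matrix V \<and>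
       X = U ** (\<chi> i j. if i = e j then s j else 0) ** transpose V)"

text \<open>sigma X k = the (k+1)-th largest singular value, k < CARD('n)
  (so sigma X 0 \<ge> sigma X 1 \<ge> ...).\<close>
definition sigma :: "real^'n^'m \<Rightarrow> nat \<Rightarrow> real" where
  "sigma X k = rev (sorted_list_of_multiset (sing_vals_mset X)) ! k"

definition wnn :: "(nat \<Rightarrow> real) \<Rightarrow> real^'n^'m \<Rightarrow> real" where
  "wnn w X = (\<Sum>k<CARD('n). w k * \<bar>sigma X k\<bar>)"

definition prox :: "('a::real_normed_vector \<Rightarrow> real) \<Rightarrow> real \<Rightarrow> 'a \<Rightarrow> 'a set" where
  "prox g \<mu> M = {X. \<forall>Y. (1/2) * (norm (X - M))^2 + \<mu> * g X \<le> (1/2) * (norm (Y - M))^2 + \<mu> * g Y}"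

definition reg_subdiff :: "('a::real_inner \<Rightarrow> real) \<Rightarrow> 'a \<Rightarrow> 'a set" where
  "reg_subdiff h x = {y. Liminf (at 0) (\<lambda>z. ereal ((h (x + z) - h x - y \<bullet> z) / norm z)) \<ge> 0}"

definition lim_subdiff :: "('a::real_inner \<Rightarrow> real) \<Rightarrow> 'a \<Rightarrow> 'a set" where
  "lim_subdiff h x = {y. \<exists>xk yk. xk \<longlonglongrightarrow> x \<and> (\<lambda>k. h (xk k)) \<longlonglongrightarrow> h x \<and>
       (\<forall>k. yk k \<in> reg_subdiff h (xk k)) \<and> yk \<longlonglongrightarrow> y}"

end

theory Submission
  imports Defs "HOL-Computational_Algebra.Polynomial"
begin

text \<open>
  The proximal step makes \<open>F = f + g\<close> decrease by a multiple of the squared step length and provides, at each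
  new iterate, a subgradient \<open>v\<close> of \<open>F\<close> up to a quadratic error whose norm is at most a multiple of the step
  length. The function \<open>F\<close> is semialgebraic, so by quantifier elimination there is a semialgebraic curve of points
  with smallest possible \<open>v\<close> on the levels of \<open>F\<close> just above the limit value. A bounded semialgebraic curve has
  monotone coordinates near its end, hence finite length; comparing consecutive levels along the curve
  with the decrease of \<open>F\<close> shows that the iterates have finite length as well. At the limit, continuity of \<open>g\<close>
  gives convergence of the values, and the subgradients tend to zero.

  Quantifier elimination follows Cohen and Hoermander: an increasing bijection of the line that matches the
  signs of finitely many polynomials can be corrected to match one more polynomial \<open>p\<close>, provided the
  derivative of \<open>p\<close> is among them and the signs of \<open>p\<close> at their roots agree; these signs are those of remainders.
\<close>

section \<open>Sign diagrams of univariate polynomials\<close>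

text \<open>The weights increase while the singular values decrease, so \<open>g\<close> need not be
  convex, and optimality of a proximal step yields a subgradient inequality only up to an error
  term. Admitting an error \<open>K * norm (y - x)^2\<close> with one fixed \<open>K\<close> serves
  two further ends: the condition is a first-order formula in a definable function, and it is closed
  under limits, so that a smallest subgradient on each level exists and can be selected definably.
  Limiting subgradients enter only at the end, through the vectors \<open>v t\<close> along the
  iterates. Comparing values at two points of one curve, rather than differentiating along it,
  reduces the regularity asked of definable functions to monotone coordinates. Monotonicity in turn
  rests on a dichotomy: immediately to the right of a point, a definable condition on a real number
  either holds throughout or fails throughout.\<close>

definition same_gap :: "real set \<Rightarrow> real \<Rightarrow> real \<Rightarrow> bool" where
  "same_gap R t u \<longleftrightarrow> (\<forall>z\<in>R. (z < t \<longleftrightarrow> z < u) \<and> (t < z \<longleftrightarrow> u < z))"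

lemma same_gap_refl: "same_gap R t t"
  by (simp add: same_gap_def)

lemma same_gap_sym: "same_gap R t u \<Longrightarrow> same_gap R u t"
  by (simp add: same_gap_def)

lemma same_gap_trans: "same_gap R t u \<Longrightarrow> same_gap R u v \<Longrightarrow> same_gap R t v"
  by (simp add: same_gap_def)

lemma same_gap_between:
  assumes "same_gap R t u" "min t u \<le> v" "v \<le> max t u"
  shows "same_gap R t v"
  unfolding same_gap_def
proof (intro ballI)
  fix z assume "z \<in> R"
  then have "(z < t \<longleftrightarrow> z < u) \<and> (t < z \<longleftrightarrow> u < z)"
    using assms(1) by (auto simp: same_gap_def)
  then show "(z < t \<longleftrightarrow> z < v) \<and> (t < z \<longleftrightarrow> v < z)"
    using assms(2,3) by linarith
qed

lemma same_gap_notin: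
  assumes "same_gap R t u" "t \<notin> R"
  shows "u \<notin> R"
proof
  assume u: "u \<in> R"
  then have "(u < t \<longleftrightarrow> u < u) \<and> (t < u \<longleftrightarrow> u < u)" using assms(1) unfolding same_gap_def by blast
  then have "u = t" by linarith
  with u assms(2) show False by simp
qed

lemma same_gap_image:
  assumes "strict_mono h"
  shows "same_gap (h ` R) (h t) (h u) \<longleftrightarrow> same_gap R t u"
  using assms by (simp add: same_gap_def strict_mono_less)

lemma sgn_poly_eqI:
  fixes q :: "real poly"
  assumes "\<And>v. min t u \<le> v \<Longrightarrow> v \<le> max t u \<Longrightarrow> poly q v \<noteq> 0"
  shows "sgn (poly q t) = sgn (poly q u)"
proof (rule ccontr)
  assume neq: "sgn (poly q t) \<noteq> sgn (poly q u)"
  have "poly q t \<noteq> 0" "poly q u \<noteq> 0" using assms by auto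
  with neq have "t \<noteq> u" "poly q t * poly q u < 0"
    by (auto simp: sgn_real_def mult_less_0_iff split: if_splits)
  then have "poly q (min t u) * poly q (max t u) < 0" "min t u < max t u"
    by (auto simp: min_def max_def mult.commute)
  from poly_IVT[OF this(2,1)] assms show False by (meson less_imp_le)
qed

lemma sgn_poly_same_gap:
  fixes q :: "real poly"
  assumes "{v. poly q v = 0} \<subseteq> R" "t \<notin> R" "same_gap R t u"
  shows "sgn (poly q t) = sgn (poly q u)"
proof (rule sgn_poly_eqI)
  fix v assume "min t u \<le> v" "v \<le> max t u"
  then have "v \<notin> R" using same_gap_notin[OF same_gap_between[OF assms(3)] assms(2)] by blast
  then show "poly q v \<noteq> 0" using assms(1) by auto
qed

lemma poly_root_between:
  fixes q :: "real poly"
  assumes "poly q u > 0" "poly q v < 0"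
  shows "\<exists>r. min u v < r \<and> r < max u v \<and> poly q r = 0"
proof -
  have "u \<noteq> v" using assms by auto
  then have "min u v < max u v" "poly q (min u v) * poly q (max u v) < 0"
    using assms by (auto simp: min_def max_def mult_less_0_iff)
  from poly_IVT[OF this] show ?thesis by auto
qed

text \<open>\<open>pderiv p\<close> has no root in the gap of \<open>t\<close>, hence one nonzero
  sign there, and the mean value theorem makes \<open>p\<close> strictly monotone on the
  gap.\<close>

lemma poly_diff_same_gap:
  fixes p :: "real poly"
  assumes "{v. poly (pderiv p) v = 0} \<subseteq> R" "t \<notin> R" "same_gap R t u"
  shows "sgn (poly p u - poly p t) = sgn (u - t) * sgn (poly (pderiv p) t)"
proof (cases "u = t")
  case False
  then have "min u t < max u t" by auto
  from poly_MVT[OF this, of p] obtain x where x: "min u t < x" "x < max u t"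
    and eq: "poly p (max u t) - poly p (min u t) = (max u t - min u t) * poly (pderiv p) x" by auto
  have "poly p u - poly p t = (u - t) * poly (pderiv p) x"
    using eq False by (cases u t rule: linorder_cases) (auto simp: min_def max_def algebra_simps)
  moreover have "same_gap R t x"
    using x by (intro same_gap_between[OF assms(3)]) linarith+
  then have "sgn (poly (pderiv p) t) = sgn (poly (pderiv p) x)"
    by (rule sgn_poly_same_gap[OF assms(1,2)])
  ultimately show ?thesis by (simp add: sgn_mult)
qed simp

lemma finite_avoid_gap:
  fixes R :: "real set"
  assumes "finite R" "r \<notin> R"
  shows "\<exists>e>0. \<forall>u. \<bar>u - r\<bar> < e \<longrightarrow> same_gap R r u"
proof -
  obtain e where e: "e > 0" "\<forall>z\<in>R. e \<le> dist r z"
    using finite_set_avoid[OF assms(1), of r] assms(2) by metis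
  show ?thesis
  proof (intro exI conjI allI impI)
    fix u assume "\<bar>u - r\<bar> < e"
    then show "same_gap R r u"
      unfolding same_gap_def using e(2) by (fastforce simp: dist_real_def)
  qed (rule e(1))
qed

text \<open>A root outside \<open>R\<close> is not a root of the derivative, so \<open>p\<close>
  crosses zero there with nonzero slope.\<close>

lemma poly_signs_near_simple_root:
  fixes p :: "real poly"
  assumes "finite R" "{v. poly (pderiv p) v = 0} \<subseteq> R" "r \<notin> R" "poly p r = 0"
  shows "\<exists>u. same_gap R r u \<and> poly p u > 0" "\<exists>u. same_gap R r u \<and> poly p u < 0"
proof -
  obtain e where e: "e > 0" "\<And>u. \<bar>u - r\<bar> < e \<Longrightarrow> same_gap R r u"
    using finite_avoid_gap[OF assms(1,3)] by auto
  have g: "same_gap R r (r + e/2)" "same_gap R r (r - e/2)" using e by auto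
  have "poly (pderiv p) r \<noteq> 0" using assms by auto
  moreover have "sgn (poly p (r + e/2)) = sgn (poly (pderiv p) r)"
    "sgn (poly p (r - e/2)) = - sgn (poly (pderiv p) r)"
    using poly_diff_same_gap[OF assms(2,3) g(1)] poly_diff_same_gap[OF assms(2,3) g(2)] assms(4) e(1)
    by simp_all
  ultimately show "\<exists>u. same_gap R r u \<and> poly p u > 0" "\<exists>u. same_gap R r u \<and> poly p u < 0"
    using g by (metis linorder_neqE_linordered_idom sgn_greater sgn_less neg_0_less_iff_less neg_less_0_iff_less)+
qed

text \<open>Special to polynomials, since an increasing function may stay negative: a negative
  leading coefficient would make the derivative negative far out, so it is positive and eventually
  bounds \<open>p\<close> from below.\<close>

lemma pderiv_pos_imp_eventually_pos:
  fixes p :: "real poly"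
  assumes "\<And>u. t \<le> u \<Longrightarrow> poly (pderiv p) u > 0"
  shows "\<exists>u>t. poly p u > 0"
proof -
  have nz: "pderiv p \<noteq> 0" using assms[of t] by auto
  then have deg: "degree p > 0" using pderiv_eq_0_iff by blast
  have "lead_coeff p > 0"
  proof (rule ccontr)
    assume "\<not> lead_coeff p > 0"
    moreover have "lead_coeff p \<noteq> 0" using deg by (metis degree_0 leading_coeff_0_iff less_irrefl)
    ultimately have "lead_coeff p < 0" by linarith
    moreover have "lead_coeff (pderiv p) = degree p * lead_coeff p"
      using deg by (simp add: degree_pderiv coeff_pderiv)
    ultimately have "lead_coeff (- pderiv p) > 0"
      using deg by (simp add: mult_less_0_iff mult_pos_neg)
    from poly_pinfty_gt_lc[OF this] obtain n where
      "\<forall>x\<ge>n. lead_coeff (- pderiv p) \<le> poly (- pderiv p) x" by blast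
    then have "lead_coeff (- pderiv p) \<le> poly (- pderiv p) (max n t)" by simp
    with \<open>lead_coeff (- pderiv p) > 0\<close> assms[of "max n t"] show False by simp
  qed
  from poly_pinfty_gt_lc[OF this] obtain n where "\<forall>x\<ge>n. lead_coeff p \<le> poly p x" by blast
  then have "poly p (max n (t + 1)) > 0" using \<open>lead_coeff p > 0\<close> by (meson max.cobounded1 less_le_trans)
  then show ?thesis by (intro exI[of _ "max n (t+1)"]) auto
qed

text \<open>Whether an increasing \<open>p\<close> becomes positive in the gap around \<open>t\<close> is decided at the right end of the
  gap; if there is no right end, it does so since \<open>p\<close> is then unbounded above.\<close>

lemma pos_in_gap_iff:
  fixes p :: "real poly"
  assumes fin: "finite R" and sub: "{v. poly (pderiv p) v = 0} \<subseteq> R"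
    and t: "t \<notin> R" and pos: "poly (pderiv p) t > 0"
  shows "(\<exists>u. same_gap R t u \<and> poly p u > 0) \<longleftrightarrow>
    (\<forall>z\<in>R. t < z \<and> (\<forall>y\<in>R. t < y \<longrightarrow> z \<le> y) \<longrightarrow> poly p z > 0)" (is "?l \<longleftrightarrow> ?r")
proof
  assume ?l
  then obtain u where u: "same_gap R t u" "poly p u > 0" by auto
  show ?r
  proof (intro ballI impI, elim conjE)
    fix z assume z: "z \<in> R" "t < z" "\<forall>y\<in>R. t < y \<longrightarrow> z \<le> y"
    have "u < z" using u z by (auto simp: same_gap_def)
    from poly_MVT[OF this, of p] obtain x where x: "u < x" "x < z"
      "poly p z - poly p u = (z - u) * poly (pderiv p) x" by auto
    have "same_gap R u x"
      unfolding same_gap_def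
    proof (intro ballI)
      fix y assume y: "y \<in> R"
      have "y < t \<or> z \<le> y" using y z(3) t by (metis linorder_neqE_linordered_idom)
      then show "(y < u \<longleftrightarrow> y < x) \<and> (u < y \<longleftrightarrow> x < y)"
      proof
        assume "y < t"
        then have "y < u" using u(1) y by (simp add: same_gap_def)
        then show ?thesis using x by linarith
      next
        assume "z \<le> y"
        then show ?thesis using x \<open>u < z\<close> by linarith
      qed
    qed
    then have "same_gap R t x" by (rule same_gap_trans[OF u(1)])
    then have "sgn (poly (pderiv p) t) = sgn (poly (pderiv p) x)" by (rule sgn_poly_same_gap[OF sub t])
    then have "poly (pderiv p) x > 0" using pos by (metis sgn_greater)
    then have "poly p z - poly p u > 0" using x(3) \<open>u < z\<close> by simp
    then show "poly p z > 0" using u(2) by simp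
  qed
next
  assume r: ?r
  show ?l
  proof (cases "\<exists>z\<in>R. t < z")
    case True
    define z where "z = Min {z\<in>R. t < z}"
    have fin': "finite {z\<in>R. t < z}" using fin by simp
    have "z \<in> {z\<in>R. t < z}" unfolding z_def using True by (intro Min_in fin') auto
    moreover have zmin: "\<forall>y\<in>R. t < y \<longrightarrow> z \<le> y" unfolding z_def using fin' by (auto intro: Min_le)
    ultimately have z: "z \<in> R" "t < z" "poly p z > 0" using r by auto
    have "(poly p \<longlongrightarrow> poly p z) (at_left z)"
      using poly_isCont[of z p] by (auto simp: isCont_def intro: tendsto_mono[OF at_le])
    then have "eventually (\<lambda>u. poly p u > 0) (at_left z)" using z(3) by (rule order_tendstoD)
    moreover have "eventually (\<lambda>u. u \<in> {t<..<z}) (at_left z)" using z(2) by (rule eventually_at_left_real)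
    ultimately have "eventually (\<lambda>u. poly p u > 0 \<and> u \<in> {t<..<z}) (at_left z)" by eventually_elim auto
    then obtain u where u: "poly p u > 0" "t < u" "u < z"
      using eventually_happens' trivial_limit_at_left_real by fastforce
    have "same_gap R t u"
      unfolding same_gap_def
    proof (intro ballI)
      fix y assume y: "y \<in> R"
      have "y < t \<or> z \<le> y" using y zmin t by (metis linorder_neqE_linordered_idom)
      then show "(y < t \<longleftrightarrow> y < u) \<and> (t < y \<longleftrightarrow> u < y)" using u by auto
    qed
    with u show ?thesis by auto
  next
    case False
    have gap: "same_gap R t u" if "t \<le> u" for u
      unfolding same_gap_def
    proof (intro ballI)
      fix y assume y: "y \<in> R"
      then have "y < t" using False t by (metis linorder_neqE_linordered_idom)
      then show "(y < t \<longleftrightarrow> y < u) \<and> (t < y \<longleftrightarrow> u < y)" using that by auto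
    qed
    have "poly (pderiv p) u > 0" if "t \<le> u" for u
      using sgn_poly_same_gap[OF sub t gap[OF that]] pos by (metis sgn_greater)
    then obtain u where "u > t" "poly p u > 0" using pderiv_pos_imp_eventually_pos by blast
    with gap[of u] show ?thesis by auto
  qed
qed

section \<open>Increasing bijections that match signs\<close>

lemma strict_mono_extend_finite:
  fixes f :: "real \<Rightarrow> real"
  assumes "finite A" "strict_mono_on A f"
  shows "\<exists>h. strict_mono h \<and> surj h \<and> (\<forall>a\<in>A. h a = f a)"
  using assms
proof (induction A rule: finite_linorder_max_induct)
  case empty
  show ?case by (intro exI[of _ "\<lambda>x. x"]) (auto simp: strict_mono_def)
next
  case (insert b A)
  have "strict_mono_on A f" using insert.prems by (auto simp: strict_mono_on_def)
  then obtain h where h: "strict_mono h" "surj h" "\<forall>a\<in>A. h a = f a" using insert.IH by auto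
  show ?case
  proof (cases "A = {}")
    case True
    show ?thesis
    proof (intro exI[of _ "\<lambda>x. x - b + f b"] conjI)
      show "surj (\<lambda>x. x - b + f b)" by (rule surjI[of _ "\<lambda>y. y + b - f b"]) auto
    qed (auto simp: strict_mono_def True)
  next
    case False
    define a where "a = Max A"
    have a: "a \<in> A" "\<forall>x\<in>A. x \<le> a" using False insert.hyps by (auto simp: a_def)
    have ab: "a < b" "f a < f b"
      using a insert.hyps insert.prems by (auto simp: strict_mono_on_def)
    define k where "k = (f b - f a) / (b - a)"
    have k: "k > 0" using ab by (simp add: k_def)
    \<comment> \<open>Points arrive in increasing order, so \<open>b\<close> lies beyond all of
      \<open>A\<close>: \<open>h\<close> is kept up to the last old point \<open>a\<close> and
      continued by the line through \<open>(a, f a)\<close> and \<open>(b, f b)\<close>.\<close>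
    define h' where "h' t = (if t \<le> a then h t else f a + (t - a) * k)" for t
    have ha: "h a = f a" using h a by auto
    have "strict_mono h'"
    proof (rule strict_monoI)
      fix x y :: real assume "x < y"
      consider "y \<le> a" | "a < x" | "x \<le> a" "a < y" using \<open>x < y\<close> by linarith
      then show "h' x < h' y"
      proof cases
        case 1 then show ?thesis using \<open>x < y\<close> h(1) by (auto simp: h'_def strict_mono_less)
      next
        case 2 then show ?thesis using \<open>x < y\<close> k by (auto simp: h'_def)
      next
        case 3
        then have "h x \<le> f a" using h(1) ha by (metis strict_mono_less_eq)
        also have "f a < f a + (y - a) * k" using 3 k by simp
        finally show ?thesis using 3 by (simp add: h'_def)
      qed
    qed
    moreover have "surj h'"
    proof (rule surjI[of _ "\<lambda>y. if y \<le> f a then inv h y else a + (y - f a) / k"])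
      fix y show "h' (if y \<le> f a then inv h y else a + (y - f a) / k) = y"
      proof (cases "y \<le> f a")
        case True
        have "h (inv h y) = y" using h(2) by (rule surj_f_inv_f)
        then have "inv h y \<le> a" using True ha h(1) by (metis strict_mono_less_eq)
        then show ?thesis using True \<open>h (inv h y) = y\<close> by (simp add: h'_def)
      next
        case False
        then have "\<not> (y - f a) / k \<le> 0" using k by (simp add: divide_le_0_iff)
        then show ?thesis using False k by (simp add: h'_def)
      qed
    qed
    moreover have "\<forall>x\<in>insert b A. h' x = f x"
    proof
      fix x assume "x \<in> insert b A"
      then show "h' x = f x" using a h(3) ab by (auto simp: h'_def k_def)
    qed
    ultimately show ?thesis by blast
  qed
qed

text \<open>The criterion of \<open>pos_in_gap_iff\<close> mentions only the order of
  \<open>R\<close> and the signs of \<open>p\<close> on \<open>R\<close>, both of which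
  \<open>h\<close> respects.\<close>

lemma pos_in_gap_transfer:
  fixes p p' :: "real poly"
  assumes fin: "finite R" and h: "strict_mono h"
    and sub: "{v. poly (pderiv p) v = 0} \<subseteq> R" and sub': "{v. poly (pderiv p') v = 0} \<subseteq> h ` R"
    and eqR: "\<And>z. z \<in> R \<Longrightarrow> sgn (poly p z) = sgn (poly p' (h z))"
    and t: "t \<notin> R" and pos: "poly (pderiv p) t > 0" "poly (pderiv p') (h t) > 0"
  shows "(\<exists>u. same_gap R t u \<and> poly p u > 0) \<longleftrightarrow> (\<exists>u. same_gap (h ` R) (h t) u \<and> poly p' u > 0)"
proof -
  have t': "h t \<notin> h ` R" using t h by (simp add: inj_image_mem_iff strict_mono_imp_inj_on)
  have "poly p z > 0 \<longleftrightarrow> poly p' (h z) > 0" if "z \<in> R" for z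
    using eqR[OF that] by (metis sgn_greater)
  then show ?thesis
    unfolding pos_in_gap_iff[OF fin sub t pos(1)]
      pos_in_gap_iff[OF finite_imageI[OF fin] sub' t' pos(2)]
    using h by (auto simp: strict_mono_less strict_mono_less_eq)
qed

text \<open>Reflection reduces this to positive values: \<open>rf p\<close>, which sends
  \<open>x\<close> to \<open>- p (- x)\<close>, has the derivative of \<open>p\<close> at the
  reflected point, while left ends of gaps become right ends and negative values become
  positive.\<close>

lemma neg_in_gap_transfer:
  fixes p p' :: "real poly"
  assumes fin: "finite R" and h: "strict_mono h"
    and sub: "{v. poly (pderiv p) v = 0} \<subseteq> R" and sub': "{v. poly (pderiv p') v = 0} \<subseteq> h ` R"
    and eqR: "\<And>z. z \<in> R \<Longrightarrow> sgn (poly p z) = sgn (poly p' (h z))"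
    and t: "t \<notin> R" and pos: "poly (pderiv p) t > 0" "poly (pderiv p') (h t) > 0"
  shows "(\<exists>u. same_gap R t u \<and> poly p u < 0) \<longleftrightarrow> (\<exists>u. same_gap (h ` R) (h t) u \<and> poly p' u < 0)"
proof -
  define rf where "rf q = - pcompose q [:0, -1:]" for q :: "real poly"
  have rf: "poly (rf q) x = - poly q (- x)" for q x by (simp add: rf_def poly_pcompose)
  have drf: "poly (pderiv (rf q)) x = poly (pderiv q) (- x)" for q x
    by (simp add: rf_def pderiv_minus pderiv_pcompose poly_pcompose pderiv_pCons)
  define k where "k x = - h (- x)" for x
  have k: "strict_mono k" using h by (auto simp: k_def strict_mono_def)
  have kR: "k ` uminus ` R = uminus ` h ` R" by (auto simp: k_def image_image)
  have gap: "same_gap (uminus ` S) (- x) u \<longleftrightarrow> same_gap S x (- u)" for S x u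
    by (force simp: same_gap_def)
  have "(\<exists>u. same_gap (uminus ` R) (- t) u \<and> poly (rf p) u > 0) \<longleftrightarrow>
        (\<exists>u. same_gap (k ` uminus ` R) (k (- t)) u \<and> poly (rf p') u > 0)"
  proof (rule pos_in_gap_transfer[OF _ k])
    show "{v. poly (pderiv (rf p)) v = 0} \<subseteq> uminus ` R"
    proof
      fix v assume "v \<in> {v. poly (pderiv (rf p)) v = 0}"
      then have "- v \<in> R" using sub by (auto simp: drf)
      then show "v \<in> uminus ` R" by (rule rev_image_eqI) simp
    qed
    show "{v. poly (pderiv (rf p')) v = 0} \<subseteq> k ` uminus ` R"
      unfolding kR
    proof
      fix v assume "v \<in> {v. poly (pderiv (rf p')) v = 0}"
      then have "- v \<in> h ` R" using sub' by (auto simp: drf)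
      then show "v \<in> uminus ` h ` R" by (rule rev_image_eqI) simp
    qed
    show "finite (uminus ` R)" using fin by simp
    show "sgn (poly (rf p) z) = sgn (poly (rf p') (k z))" if "z \<in> uminus ` R" for z
    proof -
      have "- z \<in> R" using that by auto
      from eqR[OF this] show ?thesis by (simp add: rf k_def sgn_minus)
    qed
    show "- t \<notin> uminus ` R" using t by auto
    show "poly (pderiv (rf p)) (- t) > 0" "poly (pderiv (rf p')) (k (- t)) > 0"
      using pos by (simp_all add: drf k_def)
  qed
  moreover have "(\<exists>u. same_gap (uminus ` S) (- x) u \<and> poly (rf q) u > 0) \<longleftrightarrow> (\<exists>u. same_gap S x u \<and> poly q u < 0)"
    (is "?l \<longleftrightarrow> ?r") for S x q
  proof
    assume ?l
    then obtain u where "same_gap S x (- u)" "poly q (- u) < 0" by (auto simp: gap rf)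
    then show ?r by blast
  next
    assume ?r
    then obtain u where "same_gap S x u" "poly q u < 0" by auto
    then have "same_gap (uminus ` S) (- x) (- u) \<and> poly (rf q) (- u) > 0" by (simp add: gap rf)
    then show ?l by blast
  qed
  moreover have "k (- t) = - h t" by (simp add: k_def)
  ultimately show ?thesis by (simp only: kR)
qed

text \<open>A negative derivative is turned positive by passing to \<open>- p\<close> and
  \<open>- p'\<close>, which exchanges the two claims.\<close>

lemma sign_in_gap_transfer:
  fixes p p' :: "real poly"
  assumes fin: "finite R" and h: "strict_mono h"
    and sub: "{v. poly (pderiv p) v = 0} \<subseteq> R" and sub': "{v. poly (pderiv p') v = 0} \<subseteq> h ` R"
    and eqR: "\<And>z. z \<in> R \<Longrightarrow> sgn (poly p z) = sgn (poly p' (h z))"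
    and t: "t \<notin> R" and eqD: "sgn (poly (pderiv p) t) = sgn (poly (pderiv p') (h t))"
  shows "(\<exists>u. same_gap R t u \<and> poly p u > 0) \<longleftrightarrow> (\<exists>u. same_gap (h ` R) (h t) u \<and> poly p' u > 0)"
    and "(\<exists>u. same_gap R t u \<and> poly p u < 0) \<longleftrightarrow> (\<exists>u. same_gap (h ` R) (h t) u \<and> poly p' u < 0)"
proof -
  have nz: "poly (pderiv p) t \<noteq> 0" using sub t by auto
  have "((\<exists>u. same_gap R t u \<and> poly p u > 0) \<longleftrightarrow> (\<exists>u. same_gap (h ` R) (h t) u \<and> poly p' u > 0)) \<and>
    ((\<exists>u. same_gap R t u \<and> poly p u < 0) \<longleftrightarrow> (\<exists>u. same_gap (h ` R) (h t) u \<and> poly p' u < 0))"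
  proof (cases "poly (pderiv p) t > 0")
    case True
    then have "poly (pderiv p') (h t) > 0" using eqD by (metis sgn_greater)
    with True show ?thesis
      using pos_in_gap_transfer[OF fin h sub sub' eqR t] neg_in_gap_transfer[OF fin h sub sub' eqR t] by blast
  next
    case False
    then have neg: "poly (pderiv p) t < 0" using nz by simp
    then have "poly (pderiv p') (h t) < 0" using eqD by (metis sgn_less)
    with neg have pos: "poly (pderiv (- p)) t > 0" "poly (pderiv (- p')) (h t) > 0"
      by (simp_all add: pderiv_minus)
    have s: "{v. poly (pderiv (- p)) v = 0} \<subseteq> R" "{v. poly (pderiv (- p')) v = 0} \<subseteq> h ` R"
      using sub sub' by (simp_all add: pderiv_minus)
    have e: "\<And>z. z \<in> R \<Longrightarrow> sgn (poly (- p) z) = sgn (poly (- p') (h z))"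
      using eqR by (simp add: sgn_minus)
    show ?thesis
      using pos_in_gap_transfer[OF fin h s e t pos] neg_in_gap_transfer[OF fin h s e t pos] by simp
  qed
  then show "(\<exists>u. same_gap R t u \<and> poly p u > 0) \<longleftrightarrow> (\<exists>u. same_gap (h ` R) (h t) u \<and> poly p' u > 0)"
    and "(\<exists>u. same_gap R t u \<and> poly p u < 0) \<longleftrightarrow> (\<exists>u. same_gap (h ` R) (h t) u \<and> poly p' u < 0)"
    by auto
qed

text \<open>The new roots of \<open>p\<close> are moved to roots of \<open>p'\<close> in the corresponding gaps; any increasing bijection
  that does this and agrees with \<open>h\<close> on \<open>R\<close> matches the signs of \<open>p\<close> and \<open>p'\<close>.\<close>

lemma refine_sign_bijection:
  fixes p p' :: "real poly"
  assumes fin: "finite R" and h: "strict_mono h" "surj h"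
    and sub: "{v. poly (pderiv p) v = 0} \<subseteq> R" and nc: "pderiv p \<noteq> 0"
    and eqD: "\<And>t. sgn (poly (pderiv p) t) = sgn (poly (pderiv p') (h t))"
    and eqR: "\<And>z. z \<in> R \<Longrightarrow> sgn (poly p z) = sgn (poly p' (h z))"
  obtains k where "strict_mono k" "surj k" "\<And>z. z \<in> R \<Longrightarrow> k z = h z"
    "\<And>t. sgn (poly p t) = sgn (poly p' (k t))"
proof -
  have sub': "{v. poly (pderiv p') v = 0} \<subseteq> h ` R"
  proof
    fix v assume v: "v \<in> {v. poly (pderiv p') v = 0}"
    obtain t where t: "v = h t" using surjD[OF h(2), of v] by blast
    have "poly (pderiv p) t = 0" using eqD[of t] v t by (simp add: sgn_0_0)
    then show "v \<in> h ` R" using sub t by auto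
  qed
  have inR: "h t \<in> h ` R \<longleftrightarrow> t \<in> R" for t
    using h by (simp add: inj_image_mem_iff strict_mono_imp_inj_on)
  note finh = finite_imageI[OF fin, of h]
  define P where "P = {r. poly p r = 0} - R"
  have "p \<noteq> 0" using nc by auto
  then have finP: "finite P" unfolding P_def by (simp add: poly_roots_finite)
  \<comment> \<open>Near its simple root \<open>r\<close> the polynomial \<open>p\<close> takes both
    signs; transferred to the gap of \<open>h r\<close>, this forces a root of \<open>p'\<close> by
    the intermediate value theorem.\<close>
  have ex: "\<exists>r'. same_gap (h ` R) (h r) r' \<and> poly p' r' = 0" if "r \<in> P" for r
  proof -
    have r: "r \<notin> R" "poly p r = 0" using that by (auto simp: P_def)
    obtain u v where u: "same_gap (h ` R) (h r) u" "poly p' u > 0"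
      and v: "same_gap (h ` R) (h r) v" "poly p' v < 0"
      using sign_in_gap_transfer[OF fin h(1) sub sub' eqR r(1) eqD]
        poly_signs_near_simple_root[OF fin sub r] by blast
    obtain x where x: "min u v < x" "x < max u v" "poly p' x = 0"
      using poly_root_between[OF u(2) v(2)] by auto
    have "same_gap (h ` R) u x"
      using same_gap_between[OF same_gap_trans[OF same_gap_sym[OF u(1)] v(1)]] x by simp
    then show ?thesis using same_gap_trans[OF u(1)] x(3) by blast
  qed
  define \<phi> where "\<phi> r = (if r \<in> R then h r else SOME r'. same_gap (h ` R) (h r) r' \<and> poly p' r' = 0)" for r
  have \<phi>P: "same_gap (h ` R) (h r) (\<phi> r)" "poly p' (\<phi> r) = 0" if "r \<in> P" for r
    using someI_ex[OF ex[OF that]] that by (auto simp: \<phi>_def P_def)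
  have \<phi>R: "\<phi> r = h r" if "r \<in> R" for r using that by (simp add: \<phi>_def)
  have \<phi>gap: "same_gap (h ` R) (h r) (\<phi> r)" if "r \<in> R \<union> P" for r
    using that \<phi>P \<phi>R by (auto simp: same_gap_refl)
  have "strict_mono_on (R \<union> P) \<phi>"
  proof (rule strict_mono_onI)
    fix r s assume rs: "r \<in> R \<union> P" "s \<in> R \<union> P" "r < s"
    \<comment> \<open>Two new roots never share a gap, by Rolle. The point of \<open>R\<close>
      between \<open>r\<close> and \<open>s\<close> keeps their images apart.\<close>
    have "\<exists>z\<in>R. r \<le> z \<and> z \<le> s"
    proof (cases "r \<in> R \<or> s \<in> R")
      case True
      then show ?thesis using rs(3) by (auto intro: less_imp_le)
    next
      case False
      then have "poly p r = 0" "poly p s = 0" using rs by (auto simp: P_def)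
      with poly_MVT[OF rs(3), of p] obtain x where "r < x" "x < s" "poly (pderiv p) x = 0"
        using rs(3) by auto
      then show ?thesis using sub by (auto intro!: bexI[of _ x])
    qed
    then obtain z where z: "z \<in> R" "r \<le> z" "z \<le> s" by auto
    have "h r \<le> h z" "h z \<le> h s" "h r < h s" using z h rs by (simp_all add: strict_mono_less_eq strict_mono_less)
    moreover have "(h z < h r \<longleftrightarrow> h z < \<phi> r) \<and> (h r < h z \<longleftrightarrow> \<phi> r < h z)"
      "(h z < h s \<longleftrightarrow> h z < \<phi> s) \<and> (h s < h z \<longleftrightarrow> \<phi> s < h z)"
      using \<phi>gap rs z by (auto simp: same_gap_def)
    ultimately show "\<phi> r < \<phi> s" by linarith
  qed
  then obtain k where k: "strict_mono k" "surj k" and k\<phi>: "\<And>a. a \<in> R \<union> P \<Longrightarrow> k a = \<phi> a"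
    using strict_mono_extend_finite[of "R \<union> P" \<phi>] fin finP by auto
  have kR: "k z = h z" if "z \<in> R" for z using that k\<phi> \<phi>R by simp
  have kgap: "same_gap (h ` R) (h t) (k t)" for t
    unfolding same_gap_def using kR h(1) k(1) by (metis (no_types, lifting) imageE strict_mono_less)
  have "sgn (poly p t) = sgn (poly p' (k t))" for t
  proof (cases "t \<in> R")
    case True
    then show ?thesis using kR eqR by simp
  next
    case t: False
    have ht: "h t \<notin> h ` R" using t inR by simp
    have kt: "k t \<notin> h ` R" using same_gap_notin[OF kgap ht] .
    have dk: "sgn (poly (pderiv p') (k t)) = sgn (poly (pderiv p) t)"
      using sgn_poly_same_gap[OF sub' ht kgap] eqD by simp
    note tr = sign_in_gap_transfer[OF fin h(1) sub sub' eqR t eqD]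
    show ?thesis
    proof (cases "\<exists>r. same_gap R t r \<and> poly p r = 0")
      case True
      then obtain r where r: "same_gap R t r" "poly p r = 0" by auto
      then have rP: "r \<in> P" using same_gap_notin t by (auto simp: P_def)
      have "k r = \<phi> r" using k\<phi> rP by simp
      then have k0: "poly p' (k r) = 0" using \<phi>P(2)[OF rP] by simp
      have "same_gap (h ` R) (h t) (k r)"
        using same_gap_trans[OF _ kgap[of r]] r(1) same_gap_image[OF h(1)] by blast
      then have g: "same_gap (h ` R) (k t) (k r)" using same_gap_trans[OF same_gap_sym[OF kgap[of t]]] by blast
      \<comment> \<open>The sign at \<open>t\<close> is read off from the slope and from the side of
        the root on which \<open>t\<close> lies; \<open>k\<close> preserves both.\<close>
      have "- sgn (poly p t) = sgn (r - t) * sgn (poly (pderiv p) t)"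
        using poly_diff_same_gap[OF sub t r(1)] r(2) by (simp add: sgn_minus)
      moreover have "- sgn (poly p' (k t)) = sgn (k r - k t) * sgn (poly (pderiv p) t)"
        using poly_diff_same_gap[OF sub' kt g] k0 dk by (simp add: sgn_minus)
      moreover have "sgn (r - t) = sgn (k r - k t)"
        using k(1) by (auto simp: sgn_real_def strict_mono_less strict_mono_eq)
      ultimately show ?thesis by simp
    next
      case False
      \<comment> \<open>A root of \<open>p'\<close> here would give it both signs in its gap;
        transferred back, \<open>p\<close> would take both signs, hence have a root, in the gap of
        \<open>t\<close>.\<close>
      have nz: "poly p' (k t) \<noteq> 0"
      proof
        assume "poly p' (k t) = 0"
        from poly_signs_near_simple_root[OF finh sub' kt this] tr same_gap_trans[OF kgap[of t]]
        obtain u v where u: "same_gap R t u" "poly p u > 0" and v: "same_gap R t v" "poly p v < 0" by blast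
        obtain x where x: "min u v < x" "x < max u v" "poly p x = 0"
          using poly_root_between[OF u(2) v(2)] by auto
        have "same_gap R u x"
          using same_gap_between[OF same_gap_trans[OF same_gap_sym[OF u(1)] v(1)]] x by simp
        then show False using False same_gap_trans[OF u(1)] x(3) by blast
      qed
      have const: "sgn (poly p t) = sgn (poly p u)" if "same_gap R t u" for u
        using False same_gap_between[OF that] by (intro sgn_poly_eqI) blast
      consider "poly p' (k t) > 0" | "poly p' (k t) < 0" using nz by linarith
      then show ?thesis
      proof cases
        case 1
        then obtain u where "same_gap R t u" "poly p u > 0" using tr(1) kgap by blast
        with const[of u] 1 show ?thesis by simp
      next
        case 2
        then obtain u where "same_gap R t u" "poly p u < 0" using tr(2) kgap by blast
        with const[of u] 2 show ?thesis by simp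
      qed
    qed
  qed
  with k kR show thesis using that by blast
qed

definition sign_bijection :: "(real \<Rightarrow> real) \<Rightarrow> (real poly \<times> real poly) set \<Rightarrow> bool" where
  "sign_bijection h Z \<longleftrightarrow> strict_mono h \<and> surj h \<and>
     (\<forall>(q, q') \<in> Z. \<forall>t. sgn (poly q t) = sgn (poly q' (h t)))"

lemma sign_bijection_subset: "sign_bijection h Z \<Longrightarrow> Z' \<subseteq> Z \<Longrightarrow> sign_bijection h Z'"
  unfolding sign_bijection_def by blast

text \<open>The marked points are the roots of the nonzero members of \<open>Z\<close>: they are
  finite in number, and \<open>roots\<close> controls the sign of \<open>p\<close> at each of
  them.\<close>

lemma sign_bijection_insert:
  fixes p p' :: "real poly"
  assumes fin: "finite Z" and h: "sign_bijection h Z"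
    and D: "(pderiv p, pderiv p') \<in> Z" and nc: "pderiv p \<noteq> 0"
    and roots: "\<And>q q' t. (q, q') \<in> Z \<Longrightarrow> q \<noteq> 0 \<Longrightarrow> poly q t = 0 \<Longrightarrow> sgn (poly p t) = sgn (poly p' (h t))"
  obtains k where "sign_bijection k (insert (p, p') Z)"
proof -
  define R where "R = (\<Union>q\<in>fst ` Z - {0}. {t. poly q t = 0})"
  have sgnZ: "sgn (poly q t) = sgn (poly q' (h t))" if "(q, q') \<in> Z" for q q' t
    using h that by (auto simp: sign_bijection_def)
  have hh: "strict_mono h" "surj h" using h by (auto simp: sign_bijection_def)
  have finR: "finite R" unfolding R_def using fin by (auto intro: poly_roots_finite)
  have subR: "{t. poly q t = 0} \<subseteq> R" if "(q, q') \<in> Z" "q \<noteq> 0" for q q'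
    unfolding R_def using that by force
  have "sgn (poly p z) = sgn (poly p' (h z))" if "z \<in> R" for z
    using that roots unfolding R_def by force
  then obtain k where k: "strict_mono k" "surj k" "\<And>z. z \<in> R \<Longrightarrow> k z = h z"
    "\<And>t. sgn (poly p t) = sgn (poly p' (k t))"
    using refine_sign_bijection[OF finR hh subR[OF D nc] nc sgnZ[OF D]] by blast
  have "sgn (poly q t) = sgn (poly q' (k t))" if q: "(q, q') \<in> Z" for q q' t
  proof -
    \<comment> \<open>\<open>k\<close> and \<open>h\<close> agree on \<open>R\<close>, so the point
      \<open>s\<close> that \<open>h\<close> sends to \<open>k t\<close> lies in the cell of
      \<open>t\<close>, where no old polynomial changes sign.\<close>
    obtain s where s: "k t = h s" using surjD[OF hh(2), of "k t"] by blast
    have "same_gap R t s"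
      unfolding same_gap_def using s k(1,3) hh(1) by (metis strict_mono_less)
    have "sgn (poly q t) = sgn (poly q s)"
    proof (cases "t \<in> R")
      case True
      then have "h t = h s" using k(3) s by simp
      then show ?thesis using hh(1) by (simp add: strict_mono_eq)
    next
      case False
      show ?thesis
      proof (cases "q = 0")
        case nz: False
        show ?thesis by (rule sgn_poly_same_gap[OF subR[OF q nz] False \<open>same_gap R t s\<close>])
      qed simp
    qed
    then show ?thesis using sgnZ[OF q, of s] s by simp
  qed
  then have "sign_bijection k (insert (p, p') Z)"
    unfolding sign_bijection_def using k by auto
  with that show thesis .
qed

section \<open>Quantifier elimination\<close>

text \<open>\<open>d\<close> is a strict bound on the formal degree, uniform in the parameter; the
  actual degree may drop where leading coefficients vanish. For \<open>d = 0\<close> only the zero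
  family remains.\<close>

definition poly_family :: "nat \<Rightarrow> ('a::euclidean_space \<Rightarrow> real poly) \<Rightarrow> bool" where
  "poly_family d P \<longleftrightarrow> (\<forall>i. poly_fun (\<lambda>x. coeff (P x) i)) \<and> (\<forall>x. \<forall>i\<ge>d. coeff (P x) i = 0)"

lemma poly_fun_sum: "(\<And>i. i \<in> I \<Longrightarrow> poly_fun (p i)) \<Longrightarrow> poly_fun (\<lambda>x. \<Sum>i\<in>I. p i x)"
  by (induction I rule: infinite_finite_induct) (auto intro: poly_fun.intros)

lemma poly_fun_power: "poly_fun p \<Longrightarrow> poly_fun (\<lambda>x. p x ^ k)"
  by (induction k) (auto intro: poly_fun.intros)

lemma poly_fun_uminus: "poly_fun p \<Longrightarrow> poly_fun (\<lambda>x. - p x)"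
  using pf_mult[OF pf_const[of "-1"]] by simp

lemma poly_fun_diff: "poly_fun p \<Longrightarrow> poly_fun q \<Longrightarrow> poly_fun (\<lambda>x. p x - q x)"
  using pf_add[OF _ poly_fun_uminus] by simp

lemma poly_fun_if: "(b \<Longrightarrow> poly_fun p) \<Longrightarrow> (\<not> b \<Longrightarrow> poly_fun q) \<Longrightarrow> poly_fun (\<lambda>x. if b then p x else q x)"
  by (cases b) auto

lemma poly_familyD:
  assumes "poly_family d P"
  shows "poly_fun (\<lambda>x. coeff (P x) i)" "i \<ge> d \<Longrightarrow> coeff (P x) i = 0"
  using assms unfolding poly_family_def by blast+

lemma poly_family_mono: "poly_family d P \<Longrightarrow> d \<le> e \<Longrightarrow> poly_family e P"
  by (auto simp: poly_family_def)

lemma poly_family_const: "poly_fun c \<Longrightarrow> poly_family (Suc 0) (\<lambda>x. [:c x:])"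
  unfolding poly_family_def
proof (intro conjI allI impI)
  assume "poly_fun c"
  then show "poly_fun (\<lambda>x. coeff [:c x:] i)" for i by (cases i) (auto intro: pf_const)
qed (auto simp: coeff_pCons split: nat.split)

lemma poly_family_add: "poly_family d P \<Longrightarrow> poly_family d Q \<Longrightarrow> poly_family d (\<lambda>x. P x + Q x)"
  by (auto simp: poly_family_def intro: poly_fun.intros)

lemma poly_family_diff: "poly_family d P \<Longrightarrow> poly_family d Q \<Longrightarrow> poly_family d (\<lambda>x. P x - Q x)"
  by (auto simp: poly_family_def intro: poly_fun_diff)

lemma poly_family_smult: "poly_fun c \<Longrightarrow> poly_family d P \<Longrightarrow> poly_family d (\<lambda>x. smult (c x) (P x))"
  by (auto simp: poly_family_def intro: poly_fun.intros)

lemma poly_family_mult: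
  assumes "poly_family d P" "poly_family e Q"
  shows "poly_family (d + e) (\<lambda>x. P x * Q x)"
  unfolding poly_family_def
proof (intro conjI allI impI)
  show "poly_fun (\<lambda>x. coeff (P x * Q x) i)" for i
    unfolding coeff_mult using assms by (intro poly_fun_sum pf_mult poly_familyD)
  show "coeff (P x * Q x) i = 0" if "d + e \<le> i" for x i
    unfolding coeff_mult
  proof (rule sum.neutral, rule ballI)
    fix j assume "j \<in> {..i}"
    then have "d \<le> j \<or> e \<le> i - j" using that by auto
    then show "coeff (P x) j * coeff (Q x) (i - j) = 0" using assms poly_familyD(2) by fastforce
  qed
qed

lemma poly_family_monom_mult:
  assumes "poly_family d P"
  shows "poly_family (k + d) (\<lambda>x. monom 1 k * P x)"
  unfolding poly_family_def coeff_monom_mult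
proof (intro conjI allI impI)
  show "poly_fun (\<lambda>x. if i < k then 0 else 1 * coeff (P x) (i - k))" for i
    by (intro poly_fun_if pf_const pf_mult poly_familyD(1)[OF assms])
  show "(if i < k then 0 else 1 * coeff (P x) (i - k)) = 0" if "k + d \<le> i" for x i
    using that poly_familyD(2)[OF assms, of "i - k" x] by auto
qed

lemma poly_family_pderiv: "poly_family (Suc d) P \<Longrightarrow> poly_family d (\<lambda>x. pderiv (P x))"
  by (auto simp: poly_family_def coeff_pderiv intro: poly_fun.intros)

definition truncate_poly :: "nat \<Rightarrow> real poly \<Rightarrow> real poly" where
  "truncate_poly d p = (\<Sum>i<d. monom (coeff p i) i)"

lemma coeff_truncate_poly: "coeff (truncate_poly d p) i = (if i < d then coeff p i else 0)"
  by (simp add: truncate_poly_def coeff_sum)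

lemma poly_family_truncate: "poly_family e P \<Longrightarrow> poly_family d (\<lambda>x. truncate_poly d (P x))"
  unfolding poly_family_def coeff_truncate_poly by (auto intro: pf_const poly_fun_if)

lemma truncate_poly_eq: "(\<And>i. i \<ge> d \<Longrightarrow> coeff p i = 0) \<Longrightarrow> truncate_poly d p = p"
  by (rule poly_eqI) (auto simp: coeff_truncate_poly)

text \<open>Pseudo-division by an even power of the leading coefficient, so that signs at the roots of the divisor
  are preserved.\<close>

lemma poly_family_pseudo_remainder:
  assumes P: "poly_family d P" and Q: "poly_family (Suc j) Q"
  shows "\<exists>R. poly_family j R \<and>
    (\<forall>x t. coeff (Q x) j \<noteq> 0 \<longrightarrow> poly (Q x) t = 0 \<longrightarrow> sgn (poly (P x) t) = sgn (poly (R x) t))"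
  using P
proof (induction d arbitrary: P)
  case 0
  then have "poly_family j P" by (rule poly_family_mono) simp
  then show ?case by blast
next
  case (Suc d)
  show ?case
  proof (cases "Suc d \<le> j")
    case True
    then show ?thesis using poly_family_mono[OF Suc.prems True] by blast
  next
    case False
    define q where "q x = coeff (Q x) j" for x
    have q: "poly_fun q" unfolding q_def using Q by (rule poly_familyD)
    \<comment> \<open>Both terms have coefficient \<open>q x ^ 2 * coeff (P x) d\<close> in degree
      \<open>d\<close>, so these cancel; at a root of \<open>Q x\<close> only the first term
      survives.\<close>
    define P' where "P' x = smult (q x ^ 2) (P x) - smult (q x * coeff (P x) d) (monom 1 (d - j) * Q x)" for x
    have jd: "d - j + Suc j = Suc d" using False by simp
    have F: "poly_family (Suc d) P'"
      unfolding P'_def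
      using poly_family_monom_mult[OF Q, of "d - j"] jd Suc.prems q
      by (intro poly_family_diff poly_family_smult poly_fun_power pf_mult poly_familyD) auto
    have "coeff (P' x) d = 0" for x
      using jd by (simp add: P'_def coeff_monom_mult q_def power2_eq_square)
    then have "poly_family d P'"
      using F unfolding poly_family_def by (metis le_eq_less_or_eq Suc_leI)
    then obtain R where R: "poly_family j R"
      "\<And>x t. coeff (Q x) j \<noteq> 0 \<Longrightarrow> poly (Q x) t = 0 \<Longrightarrow> sgn (poly (P' x) t) = sgn (poly (R x) t)"
      using Suc.IH by blast
    have "sgn (poly (P x) t) = sgn (poly (R x) t)" if "coeff (Q x) j \<noteq> 0" "poly (Q x) t = 0" for x t
    proof -
      have "poly (P' x) t = q x ^ 2 * poly (P x) t" using that by (simp add: P'_def)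
      moreover have "q x ^ 2 > 0" using that by (simp add: q_def)
      ultimately have "sgn (poly (P' x) t) = sgn (poly (P x) t)" by (metis mult_1 sgn_mult sgn_pos)
      then show ?thesis using R(2)[OF that] by simp
    qed
    with R(1) show ?thesis by blast
  qed
qed

section \<open>Sign diagrams depending on parameters\<close>

definition same_signs :: "('a \<Rightarrow> real) set \<Rightarrow> 'a \<Rightarrow> 'a \<Rightarrow> bool" where
  "same_signs Q x y \<longleftrightarrow> (\<forall>q\<in>Q. sgn (q x) = sgn (q y))"

text \<open>Instead of a quantifier-free formula, only a finite set of polynomials in the parameter
  is recorded, whose signs fix the sign diagram up to an increasing bijection.\<close>

definition signs_controlled :: "('a::euclidean_space \<Rightarrow> real poly) set \<Rightarrow> bool" where
  "signs_controlled \<P> \<longleftrightarrow> (\<exists>Q. finite Q \<and> (\<forall>q\<in>Q. poly_fun q) \<and>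
     (\<forall>x y. same_signs Q x y \<longrightarrow> (\<exists>h. sign_bijection h ((\<lambda>P. (P x, P y)) ` \<P>))))"

lemma sign_bijection_id: "(\<And>q q'. (q, q') \<in> Z \<Longrightarrow> \<forall>t. sgn (poly q t) = sgn (poly q' t)) \<Longrightarrow> sign_bijection (\<lambda>t. t) Z"
  by (auto simp: sign_bijection_def strict_mono_def)

text \<open>Where the leading coefficient of \<open>P\<close> vanishes, \<open>P\<close> can be truncated;
  elsewhere its signs at the roots of the other polynomials are those of its pseudo-remainders, and these
  together with its derivative determine the sign diagram of \<open>P\<close>.\<close>

lemma signs_controlled_step:
  assumes fin: "finite \<P>" and fam: "\<And>P. P \<in> \<P> \<Longrightarrow> poly_family (Suc d) P" and P: "poly_family (Suc d) P"
    and IH: "\<And>\<D>. finite \<D> \<Longrightarrow> (\<And>R. R \<in> \<D> \<Longrightarrow> poly_family d R) \<Longrightarrow> signs_controlled (\<D> \<union> \<P>)"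
  shows "signs_controlled (insert P \<P>)"
proof -
  define DP where "DP x = pderiv (P x)" for x
  have DP: "poly_family d DP" unfolding DP_def by (rule poly_family_pderiv[OF P])
  define \<G> where "\<G> = insert DP \<P>"
  have G: "finite \<G>" "\<And>G. G \<in> \<G> \<Longrightarrow> poly_family (Suc d) G"
    using fin fam poly_family_mono[OF DP] by (auto simp: \<G>_def)
  \<comment> \<open>The degree of \<open>G x\<close> varies with \<open>x\<close>, so a remainder is
    prepared for each degree \<open>j\<close> that a member may have, after truncation to that
    degree.\<close>
  define is_rem where "is_rem j G R \<longleftrightarrow> poly_family j R \<and>
    (\<forall>x t. coeff (truncate_poly (Suc j) (G x)) j \<noteq> 0 \<longrightarrow> poly (truncate_poly (Suc j) (G x)) t = 0 \<longrightarrow>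
       sgn (poly (P x) t) = sgn (poly (R x) t))" for j G R
  define rem where "rem j G = (SOME R. is_rem j G R)" for j G
  have is_rem: "is_rem j G (rem j G)" if "G \<in> \<G>" for j G
  proof -
    have "\<exists>R. is_rem j G R"
      unfolding is_rem_def
      by (rule poly_family_pseudo_remainder[OF P poly_family_truncate[OF G(2)[OF that]]])
    then show ?thesis unfolding rem_def by (rule someI_ex)
  qed
  have rem: "\<And>j G. G \<in> \<G> \<Longrightarrow> poly_family j (rem j G)"
    "\<And>j G x t. G \<in> \<G> \<Longrightarrow> coeff (truncate_poly (Suc j) (G x)) j \<noteq> 0 \<Longrightarrow>
       poly (truncate_poly (Suc j) (G x)) t = 0 \<Longrightarrow> sgn (poly (P x) t) = sgn (poly (rem j G x) t)"
    using is_rem unfolding is_rem_def by blast+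
  define \<R> where "\<R> = (\<lambda>(j, G). rem j G) ` ({..d} \<times> \<G>)"
  have R: "finite \<R>" "\<And>R. R \<in> \<R> \<Longrightarrow> poly_family d R"
  proof -
    show "finite \<R>" unfolding \<R>_def using G(1) by simp
    fix R assume "R \<in> \<R>"
    then obtain j G0 where "R = rem j G0" "j \<le> d" "G0 \<in> \<G>" by (auto simp: \<R>_def)
    then show "poly_family d R" using poly_family_mono[OF rem(1)] by simp
  qed
  \<comment> \<open>The two appeals to \<open>IH\<close> prepare for the parameters where the
    coefficient of degree \<open>d\<close> of \<open>P\<close> vanishes and for the others, where
    derivative and remainders have smaller formal degree.\<close>
  have "signs_controlled ({\<lambda>x. truncate_poly d (P x)} \<union> \<P>)"
    using poly_family_truncate[OF P, of d] by (intro IH) (auto simp: poly_family_def coeff_truncate_poly)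
  then obtain Q1 where Q1: "finite Q1" "\<forall>q\<in>Q1. poly_fun q"
    "\<And>x y. same_signs Q1 x y \<Longrightarrow>
      \<exists>h. sign_bijection h ((\<lambda>P. (P x, P y)) ` ({\<lambda>x. truncate_poly d (P x)} \<union> \<P>))"
    unfolding signs_controlled_def by auto
  have "signs_controlled ((insert DP \<R>) \<union> \<P>)" using R DP by (intro IH) auto
  then obtain Q2 where Q2: "finite Q2" "\<forall>q\<in>Q2. poly_fun q"
    "\<And>x y. same_signs Q2 x y \<Longrightarrow> \<exists>h. sign_bijection h ((\<lambda>P. (P x, P y)) ` (insert DP \<R> \<union> \<P>))"
    unfolding signs_controlled_def by auto
  \<comment> \<open>Signs of all coefficients, so that \<open>x\<close> and \<open>y\<close> agree
    on the actual degree of every member and a single \<open>j\<close> serves both.\<close>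
  define C where "C = (\<lambda>(i, G) x. coeff (G x) i) ` ({..d} \<times> insert P \<G>)"
  have C: "finite C" "\<forall>q\<in>C. poly_fun q"
    unfolding C_def using G P poly_familyD(1) by auto
  show ?thesis
    unfolding signs_controlled_def
  proof (intro exI[of _ "Q1 \<union> Q2 \<union> C"] conjI allI impI)
    fix x y assume "same_signs (Q1 \<union> Q2 \<union> C) x y"
    then have s1: "same_signs Q1 x y" and s2: "same_signs Q2 x y" and sC: "same_signs C x y"
      by (auto simp: same_signs_def)
    have cf: "sgn (coeff (G x) i) = sgn (coeff (G y) i)" if "G \<in> insert P \<G>" for G i
    proof (cases "i \<le> d")
      case True
      then have "(\<lambda>x. coeff (G x) i) \<in> C" unfolding C_def using that by force
      then show ?thesis using sC by (auto simp: same_signs_def)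
    next
      case False
      then have "coeff (G z) i = 0" for z using that G(2) P poly_familyD(2)[of "Suc d" G] by auto
      then show ?thesis by simp
    qed
    have c0: "coeff (G x) i = 0 \<longleftrightarrow> coeff (G y) i = 0" if "G \<in> insert P \<G>" for G i
      using cf[OF that] by (metis sgn_0_0)
    show "\<exists>h. sign_bijection h ((\<lambda>P. (P x, P y)) ` insert P \<P>)"
    proof (cases "coeff (P x) d = 0")
      case True
      have "coeff (P z) i = 0" if "d \<le> i" "z \<in> {x, y}" for z i
        using that True c0[of P d] poly_familyD(2)[OF P, of i z] by (cases "i = d") auto
      then have "truncate_poly d (P x) = P x" "truncate_poly d (P y) = P y"
        by (auto intro: truncate_poly_eq)
      then show ?thesis using Q1(3)[OF s1] by simp
    next
      case False
      obtain h where h: "sign_bijection h ((\<lambda>P. (P x, P y)) ` (insert DP \<R> \<union> \<P>))"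
        using Q2(3)[OF s2] by auto
      then have hs: "sgn (poly (G x) t) = sgn (poly (G y) (h t))" if "G \<in> \<R> \<union> \<G>" for G t
        using that by (auto simp: sign_bijection_def \<G>_def)
      have hG: "sign_bijection h ((\<lambda>P. (P x, P y)) ` \<G>)"
        by (rule sign_bijection_subset[OF h]) (auto simp: \<G>_def)
      show ?thesis
      \<comment> \<open>With \<open>d = 0\<close> the polynomial is constant in \<open>t\<close> and
        its derivative vanishes, which the refinement excludes; the sign of the constant coefficient
        settles this case.\<close>
      proof (cases "d = 0")
        case True
        have Pc: "P z = [:coeff (P z) 0:]" for z
          using poly_familyD(2)[OF P, of _ z] True by (intro poly_eqI) (auto simp: coeff_pCons split: nat.split)
        have "poly (P z) t = coeff (P z) 0" for z t by (subst Pc) simp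
        then have "sgn (poly (P x) t) = sgn (poly (P y) (h t))" for t using cf[of P 0] by simp
        then have "sign_bijection h (insert (P x, P y) ((\<lambda>P. (P x, P y)) ` \<G>))"
          using hG by (auto simp: sign_bijection_def)
        then show ?thesis by (intro exI[of _ h]) (rule sign_bijection_subset, auto simp: \<G>_def)
      next
        case d: False
        have nc: "pderiv (P x) \<noteq> 0"
        proof
          assume "pderiv (P x) = 0"
          then have "coeff (pderiv (P x)) (d - 1) = 0" by simp
          then show False using d False by (simp add: coeff_pderiv)
        qed
        have D: "(pderiv (P x), pderiv (P y)) \<in> (\<lambda>P. (P x, P y)) ` \<G>"
          by (auto simp: \<G>_def DP_def)
        obtain k where "sign_bijection k (insert (P x, P y) ((\<lambda>P. (P x, P y)) ` \<G>))"
        proof (rule sign_bijection_insert[OF finite_imageI[OF G(1)] hG D nc])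
          fix q q' t assume "(q, q') \<in> (\<lambda>P. (P x, P y)) ` \<G>" and q: "q \<noteq> 0" "poly q t = 0"
          then obtain G0 where G0: "G0 \<in> \<G>" "q = G0 x" "q' = G0 y" by auto
          define j where "j = degree (G0 x)"
          have jx: "coeff (G0 x) j \<noteq> 0" using q G0 by (simp add: j_def)
          have j: "j \<le> d" using jx poly_familyD(2)[OF G(2)[OF G0(1)], of j x] by (meson not_less_eq_eq)
          have jy: "coeff (G0 y) j \<noteq> 0" using jx c0 G0 by auto
          have hi: "coeff (G0 z) i = 0" if "Suc j \<le> i" "z \<in> {x, y}" for z i
            using that c0[of G0 i] G0 by (auto simp: j_def coeff_eq_0)
          have tr: "truncate_poly (Suc j) (G0 x) = G0 x" "truncate_poly (Suc j) (G0 y) = G0 y"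
            using hi by (auto intro: truncate_poly_eq)
          have "rem j G0 \<in> \<R>" unfolding \<R>_def using j G0 by force
          have "poly (G0 y) (h t) = 0" using hs[of G0 t] G0 q by (simp add: sgn_0_0)
          have "sgn (poly (P x) t) = sgn (poly (rem j G0 x) t)"
            using rem(2)[OF G0(1), of j x t] jx q G0 tr by simp
          also have "\<dots> = sgn (poly (rem j G0 y) (h t))" using hs \<open>rem j G0 \<in> \<R>\<close> by auto
          also have "\<dots> = sgn (poly (P y) (h t))"
            using rem(2)[OF G0(1), of j y "h t"] jy \<open>poly (G0 y) (h t) = 0\<close> tr by simp
          finally show "sgn (poly (P x) t) = sgn (poly (P y) (h t))" .
        qed
        then show ?thesis by (intro exI[of _ k]) (rule sign_bijection_subset, auto simp: \<G>_def)
      qed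
    qed
  qed (use Q1 Q2 C in auto)
qed

text \<open>Nested induction, on the degree bound and on the number of members of top formal degree.
  One step trades such a member for arbitrarily many of lower degree, so the inner induction leaves
  the lower part \<open>\<D>\<close> arbitrary.\<close>

lemma signs_controlled_finite:
  assumes "finite \<P>" "\<And>P. P \<in> \<P> \<Longrightarrow> poly_family d P"
  shows "signs_controlled \<P>"
  using assms
proof (induction d arbitrary: \<P>)
  case 0
  have zero: "P x = 0" if "P \<in> \<P>" for P x
    using 0(2)[OF that] by (auto simp: poly_family_def poly_eq_iff)
  have "sign_bijection (\<lambda>t. t) ((\<lambda>P. (P x, P y)) ` \<P>)" for x y
    by (intro sign_bijection_id) (clarsimp, metis zero)
  then show ?case unfolding signs_controlled_def by (intro exI[of _ "{}"]) auto
next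
  case (Suc d)
  have "signs_controlled (\<D> \<union> \<P>')"
    if "finite \<P>'" "\<And>P. P \<in> \<P>' \<Longrightarrow> poly_family (Suc d) P"
      "finite \<D>" "\<And>R. R \<in> \<D> \<Longrightarrow> poly_family d R"
    for \<D> \<P>' :: "('a \<Rightarrow> real poly) set"
    using that
  proof (induction \<P>' arbitrary: \<D> rule: finite_induct)
    case empty
    then show ?case using Suc.IH[of \<D>] by auto
  next
    case (insert P \<P>')
    have "signs_controlled (insert P (\<D> \<union> \<P>'))"
    proof (rule signs_controlled_step[of _ d])
      show "finite (\<D> \<union> \<P>')" using insert by simp
      show "poly_family (Suc d) R" if "R \<in> \<D> \<union> \<P>'" for R
        using that insert.prems poly_family_mono[of d R "Suc d"] by auto
      show "poly_family (Suc d) P" using insert.prems by simp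
      fix \<D>' :: "('a \<Rightarrow> real poly) set"
      assume "finite \<D>'" "\<And>R. R \<in> \<D>' \<Longrightarrow> poly_family d R"
      then have "signs_controlled ((\<D>' \<union> \<D>) \<union> \<P>')"
        using insert.prems by (intro insert.IH) auto
      then show "signs_controlled (\<D>' \<union> (\<D> \<union> \<P>'))" by (simp add: Un_assoc)
    qed
    then show ?case by simp
  qed
  from this[of \<P> "{}"] show ?case using Suc.prems by simp
qed

section \<open>Definable sets and their projections\<close>

lemma poly_fun_Pair_family:
  fixes p :: "'a::euclidean_space \<times> real \<Rightarrow> real"
  assumes "poly_fun p"
  shows "\<exists>d P. poly_family d P \<and> (\<forall>x t. p (x, t) = poly (P x) t)"
  using assms
proof induction
  case (pf_const c)
  have "poly_family (Suc 0) (\<lambda>x::'a. [:c:])" by (rule poly_family_const) (rule poly_fun.pf_const)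
  then show ?case by (intro exI conjI) auto
next
  case (pf_coord b)
  then consider b' where "b = (b', 0)" "b' \<in> Basis" | "b = (0, 1)" by (auto simp: Basis_prod_def)
  then show ?case
  proof cases
    case 1
    have "poly_family (Suc 0) (\<lambda>x::'a. [:x \<bullet> b':])" using 1 by (intro poly_family_const poly_fun.pf_coord)
    then show ?thesis using 1 by (intro exI conjI) auto
  next
    case 2
    have "poly_family 2 (\<lambda>x::'a. [:0, 1:])"
      unfolding poly_family_def using poly_fun.pf_const by (auto simp: coeff_pCons split: nat.split)
    then show ?thesis using 2 by (intro exI conjI) auto
  qed
next
  case (pf_add p q)
  then obtain d P e Q where "poly_family d P" "poly_family e Q"
    "\<forall>x t. p (x, t) = poly (P x) t" "\<forall>x t. q (x, t) = poly (Q x) t" by auto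
  then show ?case
    by (intro exI[of _ "max d e"] exI[of _ "\<lambda>x. P x + Q x"])
      (auto intro!: poly_family_add elim: poly_family_mono)
next
  case (pf_mult p q)
  then obtain d P e Q where "poly_family d P" "poly_family e Q"
    "\<forall>x t. p (x, t) = poly (P x) t" "\<forall>x t. q (x, t) = poly (Q x) t" by auto
  then show ?case
    by (intro exI[of _ "d + e"] exI[of _ "\<lambda>x. P x * Q x"]) (auto intro!: poly_family_mult)
qed

text \<open>The sets that are unions of cells on which finitely many polynomials have constant signs are the
  semialgebraic sets; in this form closure under Boolean operations and polynomial preimages is immediate.\<close>

definition definable :: "'a::euclidean_space set \<Rightarrow> bool" where
  "definable S \<longleftrightarrow> (\<exists>Q. finite Q \<and> (\<forall>q\<in>Q. poly_fun q) \<and>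
     (\<forall>x y. same_signs Q x y \<longrightarrow> x \<in> S \<longrightarrow> y \<in> S))"

text \<open>The sign-matching bijection moves a witness \<open>t\<close> over \<open>x\<close> to
  the witness \<open>h t\<close> over \<open>y\<close>.\<close>

lemma definable_project_real:
  fixes S :: "('a::euclidean_space \<times> real) set"
  assumes "definable S"
  shows "definable {x. \<exists>t. (x, t) \<in> S}"
proof -
  obtain Q where Q: "finite Q" "\<And>q. q \<in> Q \<Longrightarrow> poly_fun q"
    "\<And>x y. same_signs Q x y \<Longrightarrow> x \<in> S \<Longrightarrow> y \<in> S"
    using assms unfolding definable_def by blast
  obtain d P where P: "\<And>q. q \<in> Q \<Longrightarrow> poly_family (d q) (P q)"
    "\<And>q x t. q \<in> Q \<Longrightarrow> q (x, t) = poly (P q x) t"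
    using poly_fun_Pair_family[OF Q(2)] by metis
  define D where "D = Max (d ` Q)"
  have "poly_family D G" if "G \<in> P ` Q" for G
    using that Q(1) by (auto intro!: poly_family_mono[OF P(1)] simp: D_def)
  then have "signs_controlled (P ` Q)" using Q(1) by (intro signs_controlled_finite) auto
  then obtain Q' where Q': "finite Q'" "\<forall>q\<in>Q'. poly_fun q"
    "\<And>x y. same_signs Q' x y \<Longrightarrow> \<exists>h. sign_bijection h ((\<lambda>G. (G x, G y)) ` P ` Q)"
    unfolding signs_controlled_def by auto
  show ?thesis
    unfolding definable_def
  proof (intro exI[of _ Q'] conjI allI impI)
    fix x y assume "same_signs Q' x y" and "x \<in> {x. \<exists>t. (x, t) \<in> S}"
    then obtain t where t: "(x, t) \<in> S" by auto
    obtain h where h: "sign_bijection h ((\<lambda>G. (G x, G y)) ` P ` Q)"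
      using Q'(3)[OF \<open>same_signs Q' x y\<close>] by auto
    then have "same_signs Q (x, t) (y, h t)"
      by (auto simp: same_signs_def sign_bijection_def P(2))
    then show "y \<in> {x. \<exists>t. (x, t) \<in> S}" using Q(3) t by blast
  qed (use Q' in auto)
qed

lemma same_signs_sym: "same_signs Q x y \<Longrightarrow> same_signs Q y x"
  by (simp add: same_signs_def)

lemma same_signs_Un: "same_signs (Q \<union> Q') x y \<longleftrightarrow> same_signs Q x y \<and> same_signs Q' x y"
  by (auto simp: same_signs_def)

lemma definableI:
  "finite Q \<Longrightarrow> (\<And>q. q \<in> Q \<Longrightarrow> poly_fun q) \<Longrightarrow> (\<And>x y. same_signs Q x y \<Longrightarrow> x \<in> S \<Longrightarrow> y \<in> S) \<Longrightarrow> definable S"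
  unfolding definable_def by blast

lemma definableE:
  assumes "definable S"
  obtains Q where "finite Q" "\<And>q. q \<in> Q \<Longrightarrow> poly_fun q" "\<And>x y. same_signs Q x y \<Longrightarrow> x \<in> S \<Longrightarrow> y \<in> S"
  using assms unfolding definable_def by blast

lemma definable_pos:
  assumes "poly_fun p"
  shows "definable {x. p x > 0}"
  using assms by (intro definableI[of "{p}"]) (auto simp: same_signs_def sgn_real_def split: if_splits)

lemma definable_neg:
  assumes "definable {x. P x}"
  shows "definable {x. \<not> P x}"
proof -
  obtain Q where Q: "finite Q" "\<And>q. q \<in> Q \<Longrightarrow> poly_fun q"
    "\<And>x y. same_signs Q x y \<Longrightarrow> x \<in> {x. P x} \<Longrightarrow> y \<in> {x. P x}"
    using assms by (rule definableE) blast
  show ?thesis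
  proof (rule definableI[of Q])
    show "y \<in> {x. \<not> P x}" if "same_signs Q x y" "x \<in> {x. \<not> P x}" for x y
      using Q(3)[OF same_signs_sym[OF that(1)]] that(2) by blast
  qed (use Q in auto)
qed

lemma definable_conj:
  assumes "definable {x. P x}" "definable {x. P' x}"
  shows "definable {x. P x \<and> P' x}"
proof -
  obtain Q where Q: "finite Q" "\<And>q. q \<in> Q \<Longrightarrow> poly_fun q"
    "\<And>x y. same_signs Q x y \<Longrightarrow> x \<in> {x. P x} \<Longrightarrow> y \<in> {x. P x}"
    using assms(1) by (rule definableE) blast
  obtain Q' where Q': "finite Q'" "\<And>q. q \<in> Q' \<Longrightarrow> poly_fun q"
    "\<And>x y. same_signs Q' x y \<Longrightarrow> x \<in> {x. P' x} \<Longrightarrow> y \<in> {x. P' x}"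
    using assms(2) by (rule definableE) blast
  show ?thesis
  proof (rule definableI[of "Q \<union> Q'"])
    show "y \<in> {x. P x \<and> P' x}" if "same_signs (Q \<union> Q') x y" "x \<in> {x. P x \<and> P' x}" for x y
      using Q(3)[of x y] Q'(3)[of x y] that by (simp add: same_signs_Un)
  qed (use Q Q' in auto)
qed

lemma definable_disj: "definable {x. P x} \<Longrightarrow> definable {x. P' x} \<Longrightarrow> definable {x. P x \<or> P' x}"
  using definable_neg[OF definable_conj[OF definable_neg definable_neg], of P P'] by simp

lemma definable_imp: "definable {x. P x} \<Longrightarrow> definable {x. P' x} \<Longrightarrow> definable {x. P x \<longrightarrow> P' x}"
  unfolding imp_conv_disj by (intro definable_disj definable_neg)

lemma definable_const: "definable {x. b}"
  by (cases b; rule definableI[of "{}"]) simp_all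

lemma definable_finite_conj:
  "finite I \<Longrightarrow> (\<And>i. i \<in> I \<Longrightarrow> definable {x. P i x}) \<Longrightarrow> definable {x. \<forall>i\<in>I. P i x}"
  by (induction I rule: finite_induct) (simp_all add: definable_const definable_conj del: Collect_const)

lemma definable_finite_disj:
  "finite I \<Longrightarrow> (\<And>i. i \<in> I \<Longrightarrow> definable {x. P i x}) \<Longrightarrow> definable {x. \<exists>i\<in>I. P i x}"
  by (induction I rule: finite_induct) (simp_all add: definable_const definable_disj del: Collect_const)

section \<open>Polynomial maps and conditions between them\<close>

definition poly_map :: "('a::euclidean_space \<Rightarrow> 'b::euclidean_space) \<Rightarrow> bool" where
  "poly_map f \<longleftrightarrow> (\<forall>b\<in>Basis. poly_fun (\<lambda>x. f x \<bullet> b))"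

lemma poly_map_real: "poly_map f \<longleftrightarrow> poly_fun f"
  by (simp add: poly_map_def)

lemma poly_fun_compose:
  assumes "poly_fun q" "poly_map f"
  shows "poly_fun (\<lambda>x. q (f x))"
  using assms by induction (auto simp: poly_map_def intro: poly_fun.intros)

lemma poly_map_compose: "poly_map g \<Longrightarrow> poly_map f \<Longrightarrow> poly_map (\<lambda>x. g (f x))"
  using poly_fun_compose[of _ f] by (auto simp: poly_map_def)

lemma poly_map_const: "poly_map (\<lambda>x. c)"
  by (simp add: poly_map_def pf_const)

lemma poly_map_id: "poly_map (\<lambda>x. x)"
  by (simp add: poly_map_def pf_coord)

lemma poly_map_add: "poly_map f \<Longrightarrow> poly_map g \<Longrightarrow> poly_map (\<lambda>x. f x + g x)"
  by (simp add: poly_map_def inner_add_left pf_add)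

lemma poly_map_diff: "poly_map f \<Longrightarrow> poly_map g \<Longrightarrow> poly_map (\<lambda>x. f x - g x)"
  by (simp add: poly_map_def inner_diff_left poly_fun_diff)

lemma poly_map_Pair: "poly_map f \<Longrightarrow> poly_map g \<Longrightarrow> poly_map (\<lambda>x. (f x, g x))"
  by (auto simp: poly_map_def Basis_prod_def)

text \<open>In coordinates a bilinear map is a polynomial whose coefficients come from
  \<open>B i j\<close>; inner product, multiplication and scaling are covered at one stroke.\<close>

lemma poly_map_bilinear:
  assumes B: "bounded_bilinear B" and f: "poly_map f" and g: "poly_map g"
  shows "poly_map (\<lambda>x. B (f x) (g x))"
  unfolding poly_map_def
proof
  fix b :: 'c assume "b \<in> Basis"
  interpret bounded_bilinear B by (rule B)
  have "B u v \<bullet> b = (\<Sum>i\<in>Basis. \<Sum>j\<in>Basis. (u \<bullet> i) * (v \<bullet> j) * (B i j \<bullet> b))" for u v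
  proof -
    have "B u v = B (\<Sum>i\<in>Basis. (u \<bullet> i) *\<^sub>R i) (\<Sum>j\<in>Basis. (v \<bullet> j) *\<^sub>R j)"
      by (simp only: euclidean_representation)
    also have "\<dots> = (\<Sum>i\<in>Basis. \<Sum>j\<in>Basis. ((u \<bullet> i) * (v \<bullet> j)) *\<^sub>R B i j)"
      by (simp add: sum_left sum_right scaleR_left scaleR_right scaleR_sum_right mult.commute) (rule sum.swap)
    finally show ?thesis by (simp add: inner_sum_left)
  qed
  then have "(\<lambda>x. B (f x) (g x) \<bullet> b) =
      (\<lambda>x. \<Sum>i\<in>Basis. \<Sum>j\<in>Basis. (f x \<bullet> i) * (g x \<bullet> j) * (B i j \<bullet> b))" by blast
  moreover have "poly_fun (\<lambda>x. f x \<bullet> i)" if "i \<in> Basis" for i using f that by (simp add: poly_map_def)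
  moreover have "poly_fun (\<lambda>x. g x \<bullet> i)" if "i \<in> Basis" for i using g that by (simp add: poly_map_def)
  ultimately show "poly_fun (\<lambda>x. B (f x) (g x) \<bullet> b)"
    by (elim ssubst) (intro poly_fun_sum pf_mult pf_const)
qed

lemma poly_map_linear:
  assumes "bounded_linear L" "poly_map f"
  shows "poly_map (\<lambda>x. L (f x))"
proof -
  have "bounded_bilinear (\<lambda>c x. c *\<^sub>R L x)"
    using bounded_bilinear.comp[OF bounded_bilinear_scaleR bounded_linear_ident assms(1)] by simp
  from poly_map_bilinear[OF this poly_map_const[of "1::real"] assms(2)] show ?thesis by simp
qed

lemmas poly_map_fst = poly_map_linear[OF bounded_linear_fst]
lemmas poly_map_snd = poly_map_linear[OF bounded_linear_snd]
lemmas poly_map_inner = poly_map_bilinear[OF bounded_bilinear_inner]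
lemmas poly_map_mult = poly_map_bilinear[OF bounded_bilinear_mult]
lemmas poly_map_scaleR = poly_map_bilinear[OF bounded_bilinear_scaleR]

lemma poly_map_sum:
  fixes f :: "'i \<Rightarrow> 'a::euclidean_space \<Rightarrow> 'b::euclidean_space"
  shows "(\<And>i. i \<in> I \<Longrightarrow> poly_map (f i)) \<Longrightarrow> poly_map (\<lambda>x. \<Sum>i\<in>I. f i x)"
  unfolding poly_map_def inner_sum_left by (intro ballI poly_fun_sum) blast

lemmas poly_map_intros = poly_map_const poly_map_id poly_map_add poly_map_diff poly_map_Pair
  poly_map_fst poly_map_snd poly_map_inner poly_map_mult poly_map_scaleR poly_map_sum

lemma definable_less:
  fixes p q :: "'a::euclidean_space \<Rightarrow> real"
  assumes "poly_map p" "poly_map q"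
  shows "definable {x. p x < q x}"
  using definable_pos[of "\<lambda>x. q x - p x"] assms by (simp add: poly_map_real poly_fun_diff)

lemma definable_le:
  fixes p q :: "'a::euclidean_space \<Rightarrow> real"
  assumes "poly_map p" "poly_map q"
  shows "definable {x. p x \<le> q x}"
  using definable_neg[OF definable_less[OF assms(2,1)]] by (simp add: not_less)

lemma definable_eq:
  fixes f g :: "'a::euclidean_space \<Rightarrow> 'b::euclidean_space"
  assumes "poly_map f" "poly_map g"
  shows "definable {x. f x = g x}"
proof -
  have "definable {x. \<forall>b\<in>Basis. f x \<bullet> b \<le> g x \<bullet> b \<and> g x \<bullet> b \<le> f x \<bullet> b}"
    using assms by (intro definable_finite_conj definable_conj definable_le poly_map_intros) auto
  also have "{x. \<forall>b\<in>Basis. f x \<bullet> b \<le> g x \<bullet> b \<and> g x \<bullet> b \<le> f x \<bullet> b} = {x. f x = g x}"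
    by (auto simp: euclidean_eq_iff[where 'a='b] intro: antisym)
  finally show ?thesis .
qed

lemma definable_vimage:
  assumes "definable S" "poly_map f"
  shows "definable {x. f x \<in> S}"
proof -
  obtain Q where Q: "finite Q" "\<And>q. q \<in> Q \<Longrightarrow> poly_fun q" "\<And>x y. same_signs Q x y \<Longrightarrow> x \<in> S \<Longrightarrow> y \<in> S"
    using assms(1) by (rule definableE) blast
  show ?thesis
  proof (rule definableI[of "(\<lambda>q x. q (f x)) ` Q"])
    fix x y assume "same_signs ((\<lambda>q x. q (f x)) ` Q) x y" "x \<in> {x. f x \<in> S}"
    moreover from this have "same_signs Q (f x) (f y)" by (simp add: same_signs_def)
    ultimately show "y \<in> {x. f x \<in> S}" using Q(3) by simp
  qed (use Q poly_fun_compose[OF _ assms(2)] in auto)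
qed

text \<open>The coordinates of \<open>y\<close> are eliminated one at a time. In \<open>S B\<close>
  those in \<open>B\<close> are already quantified, and \<open>snd z\<close> supplies the
  rest.\<close>

lemma definable_ex:
  fixes P :: "'a::euclidean_space \<Rightarrow> 'b::euclidean_space \<Rightarrow> bool"
  assumes "definable {z. P (fst z) (snd z)}"
  shows "definable {x. \<exists>y. P x y}"
proof -
  define S where "S B = {z. \<exists>c. P (fst z) (snd z + (\<Sum>b\<in>B. c b *\<^sub>R b))}" for B :: "'b set"
  have "definable (S B)" if "finite B" for B
    using that
  proof (induction B rule: finite_induct)
    case empty
    show ?case using assms by (simp add: S_def)
  next
    case (insert b B)
    have "definable {w. (fst (fst w), snd (fst w) + snd w *\<^sub>R b) \<in> S B}"
      by (intro definable_vimage insert.IH poly_map_intros)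
    then have "definable {z. \<exists>t. (z, t) \<in> {w. (fst (fst w), snd (fst w) + snd w *\<^sub>R b) \<in> S B}}"
      by (rule definable_project_real)
    also have "{z. \<exists>t. (z, t) \<in> {w. (fst (fst w), snd (fst w) + snd w *\<^sub>R b) \<in> S B}} = S (insert b B)"
    proof (intro set_eqI iffI)
      fix z assume "z \<in> {z. \<exists>t. (z, t) \<in> {w. (fst (fst w), snd (fst w) + snd w *\<^sub>R b) \<in> S B}}"
      then obtain t c where tc: "P (fst z) (snd z + t *\<^sub>R b + (\<Sum>b\<in>B. c b *\<^sub>R b))"
        by (auto simp: S_def)
      have "(\<Sum>b'\<in>B. (c(b := t)) b' *\<^sub>R b') = (\<Sum>b\<in>B. c b *\<^sub>R b)"
        using insert.hyps by (intro sum.cong) auto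
      then have "P (fst z) (snd z + (\<Sum>b'\<in>insert b B. (c(b := t)) b' *\<^sub>R b'))"
        using tc insert.hyps by (simp add: add.assoc)
      then show "z \<in> S (insert b B)" unfolding S_def by blast
    next
      fix z assume "z \<in> S (insert b B)"
      then obtain c where "P (fst z) (snd z + (\<Sum>b\<in>insert b B. c b *\<^sub>R b))" by (auto simp: S_def)
      then have "P (fst z) (snd z + c b *\<^sub>R b + (\<Sum>b\<in>B. c b *\<^sub>R b))"
        using insert.hyps by (simp add: add.assoc)
      then show "z \<in> {z. \<exists>t. (z, t) \<in> {w. (fst (fst w), snd (fst w) + snd w *\<^sub>R b) \<in> S B}}"
        unfolding S_def by auto
    qed
    finally show ?case .
  qed
  from definable_vimage[OF this[of Basis], of "\<lambda>x. (x, 0)"]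
  have "definable {x. (x, 0) \<in> S Basis}" by (simp add: poly_map_intros)
  also have "{x. (x, 0) \<in> S Basis} = {x. \<exists>y. P x y}"
  proof (intro set_eqI iffI)
    fix x assume "x \<in> {x. \<exists>y. P x y}"
    then obtain y where "P x y" by auto
    then have "P x (0 + (\<Sum>b\<in>Basis. (y \<bullet> b) *\<^sub>R b))" by (simp add: euclidean_representation)
    then show "x \<in> {x. (x, 0) \<in> S Basis}" unfolding S_def by auto
  qed (auto simp: S_def)
  finally show ?thesis .
qed

lemma definable_all:
  fixes P :: "'a::euclidean_space \<Rightarrow> 'b::euclidean_space \<Rightarrow> bool"
  assumes "definable {z. P (fst z) (snd z)}"
  shows "definable {x. \<forall>y. P x y}"
  using definable_neg[OF definable_ex[OF definable_neg[OF assms]]] by simp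

lemmas definable_intros = definable_neg definable_conj definable_disj definable_imp definable_const
  definable_less definable_le definable_eq definable_ex definable_all

lemma semialgebraic_imp_definable:
  assumes "semialgebraic S"
  shows "definable S"
proof -
  obtain A where A0: "finite A \<and> (\<forall>B\<in>A. finite B \<and> (\<forall>(p,q)\<in>B. poly_fun p \<and> poly_fun q)) \<and>
      S = (\<Union>B\<in>A. \<Inter>(p,q)\<in>B. {u. p u = 0 \<and> q u < 0})"
    using assms unfolding semialgebraic_def by (rule exE)
  then have A: "finite A" "\<And>B. B \<in> A \<Longrightarrow> finite B" and S: "S = (\<Union>B\<in>A. \<Inter>(p,q)\<in>B. {u. p u = 0 \<and> q u < 0})"
    by blast+
  have pf: "poly_fun (fst r)" "poly_fun (snd r)" if "B \<in> A" "r \<in> B" for B r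
    using A0 that by fastforce+
  have "definable {u. \<exists>B\<in>A. \<forall>r\<in>B. fst r u = 0 \<and> snd r u < 0}"
  proof (intro definable_finite_disj definable_finite_conj definable_conj)
    fix B r assume "B \<in> A" "r \<in> B"
    from pf[OF this] show "definable {u. fst r u = 0}" "definable {u. snd r u < 0}"
      by (simp_all add: definable_eq definable_less poly_map_const poly_map_real)
  qed (use A in auto)
  also have "{u. \<exists>B\<in>A. \<forall>r\<in>B. fst r u = 0 \<and> snd r u < 0} = S"
    unfolding S by (auto simp: case_prod_unfold)
  finally show ?thesis .
qed

section \<open>Definable functions of one variable\<close>

lemma poly_fun_real_imp_poly:
  fixes q :: "real \<Rightarrow> real"
  assumes "poly_fun q"
  shows "\<exists>p. \<forall>x. q x = poly p x"
  using assms
proof induction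
  case (pf_const c)
  show ?case by (intro exI[of _ "[:c:]"]) simp
next
  case (pf_coord b)
  then show ?case by (intro exI[of _ "[:0, 1:]"]) simp
next
  case (pf_add p q)
  then show ?case by (metis poly_add)
next
  case (pf_mult p q)
  then show ?case by (metis poly_mult)
qed

lemma poly_fun_eventually_sgn:
  fixes q :: "real \<Rightarrow> real"
  assumes "poly_fun q"
  shows "\<exists>c. eventually (\<lambda>x. sgn (q x) = c) (at_right a)"
proof -
  obtain p where p: "\<And>x. q x = poly p x" using poly_fun_real_imp_poly[OF assms] by auto
  show ?thesis
  proof (cases "p = 0")
    case True
    then show ?thesis using p by auto
  next
    case False
    then obtain e where e: "e > 0" "\<forall>z\<in>{z. poly p z = 0}. z \<noteq> a \<longrightarrow> e \<le> dist a z"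
      using finite_set_avoid[OF poly_roots_finite[OF False], of a] by metis
    have nz: "poly p x \<noteq> 0" if "a < x" "x < a + e" for x
      using e(2) that by (auto simp: dist_real_def)
    have "eventually (\<lambda>x. x \<in> {a<..<a + e}) (at_right a)"
      using e(1) by (intro eventually_at_right_real) simp
    then have "eventually (\<lambda>x. sgn (q x) = sgn (q (a + e / 2))) (at_right a)"
    proof eventually_elim
      case (elim x)
      have "sgn (poly p x) = sgn (poly p (a + e / 2))"
        using elim e(1) by (intro sgn_poly_eqI nz) (auto simp: min_def max_def split: if_splits)
      then show ?case using p by simp
    qed
    then show ?thesis by blast
  qed
qed

text \<open>Finitely many polynomials have constant signs immediately to the right of
  \<open>a\<close>. This local form of o-minimality is what the monotonicity results draw
  on.\<close>

lemma definable_eventually_cases: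
  fixes a :: real
  assumes "definable {x. P x}"
  shows "eventually P (at_right a) \<or> eventually (\<lambda>x. \<not> P x) (at_right a)"
proof -
  obtain Q where Q: "finite Q" "\<And>q. q \<in> Q \<Longrightarrow> poly_fun q"
    "\<And>x y. same_signs Q x y \<Longrightarrow> x \<in> {x. P x} \<Longrightarrow> y \<in> {x. P x}"
    using assms by (rule definableE) blast
  define c where "c q = (SOME c. eventually (\<lambda>x. sgn (q x) = c) (at_right a))" for q :: "real \<Rightarrow> real"
  have c: "eventually (\<lambda>x. sgn (q x) = c q) (at_right a)" if "q \<in> Q" for q
    unfolding c_def by (rule someI_ex) (rule poly_fun_eventually_sgn[OF Q(2)[OF that]])
  have ev: "eventually (\<lambda>x. \<forall>q\<in>Q. sgn (q x) = c q) (at_right a)"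
    by (rule eventually_ball_finite[OF Q(1)]) (intro ballI c)
  show ?thesis
  proof (cases "\<exists>x. (\<forall>q\<in>Q. sgn (q x) = c q) \<and> P x")
    case True
    then obtain x where x: "\<forall>q\<in>Q. sgn (q x) = c q" "P x" by blast
    have "eventually P (at_right a)"
      using ev
    proof eventually_elim
      case (elim z)
      then have "same_signs Q x z" using x(1) by (simp add: same_signs_def)
      from Q(3)[OF this] x(2) show ?case by simp
    qed
    then show ?thesis ..
  next
    case False
    have "eventually (\<lambda>x. \<not> P x) (at_right a)"
      using ev by eventually_elim (use False in blast)
    then show ?thesis ..
  qed
qed

text \<open>A value \<open>y (f x)\<close> is expressed by quantifying over a point of the graph.
  Since the graph is given only over the interval up to \<open>\<eta>\<close>, the bounds on
  \<open>f x\<close> become part of the formula.\<close>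

lemma definable_subst:
  fixes y :: "real \<Rightarrow> real"
  assumes "definable {z. 0 < fst z \<and> fst z < \<eta> \<and> snd z = y (fst z)}"
    and "poly_map f" and "definable {w. Q (fst w) (snd w)}"
  shows "definable {x. 0 < f x \<and> f x < \<eta> \<and> Q x (y (f x))}"
proof -
  have "definable {w. (f (fst w), snd w) \<in> {z. 0 < fst z \<and> fst z < \<eta> \<and> snd z = y (fst z)}}"
    by (intro definable_vimage assms(1) poly_map_Pair poly_map_snd poly_map_id)
      (use poly_fun_compose[of f fst] assms(2) in \<open>simp add: poly_map_real poly_map_fst poly_map_id\<close>)
  from definable_ex[OF definable_conj[OF this assms(3)]]
  have "definable {x. \<exists>r. (f x, r) \<in> {z. 0 < fst z \<and> fst z < \<eta> \<and> snd z = y (fst z)} \<and> Q x r}" by simp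
  also have "{x. \<exists>r. (f x, r) \<in> {z. 0 < fst z \<and> fst z < \<eta> \<and> snd z = y (fst z)} \<and> Q x r} =
    {x. 0 < f x \<and> f x < \<eta> \<and> Q x (y (f x))}" by auto
  finally show ?thesis .
qed

text \<open>A rational number inside the jump and a rational end point of a suitable interval to its right determine
  the point where the jump occurs, and an interval is uncountable.\<close>

lemma no_right_jumps_everywhere:
  fixes y :: "real \<Rightarrow> real"
  assumes "0 < \<delta>"
  shows "\<exists>m. 0 < m \<and> m < \<delta> \<and> \<not> (\<exists>q>y m. eventually (\<lambda>u. q \<le> y u) (at_right m))"
proof (rule ccontr)
  assume "\<not> ?thesis"
  then have jump: "\<exists>q>y m. eventually (\<lambda>u. q \<le> y u) (at_right m)" if "m \<in> {0<..<\<delta>}" for m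
    using that by auto
  have ex: "\<exists>c::rat \<times> rat. y m < of_rat (fst c) \<and> m < of_rat (snd c) \<and>
      (\<forall>u>m. u < of_rat (snd c) \<longrightarrow> of_rat (fst c) < y u)" if m: "m \<in> {0<..<\<delta>}" for m
  proof -
    obtain q where q: "q > y m" "eventually (\<lambda>u. q \<le> y u) (at_right m)" using jump[OF m] by blast
    then obtain b where b: "b > m" "\<forall>u>m. u < b \<longrightarrow> q \<le> y u"
      unfolding eventually_at_right_field by blast
    obtain c where c: "y m < of_rat c" "of_rat c < q" using of_rat_dense[OF q(1)] by blast
    obtain r where r: "m < of_rat r" "of_rat r < b" using of_rat_dense[OF b(1)] by blast
    have "of_rat c < y u" if "u > m" "u < of_rat r" for u
      using b(2) that c(2) r(2) by (smt (verit))
    then show ?thesis using c(1) r(1) by (intro exI[of _ "(c, r)"]) auto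
  qed
  define c where "c m = (SOME c::rat \<times> rat. y m < of_rat (fst c) \<and> m < of_rat (snd c) \<and>
      (\<forall>u>m. u < of_rat (snd c) \<longrightarrow> of_rat (fst c) < y u))" for m
  have c: "y m < of_rat (fst (c m)) \<and> m < of_rat (snd (c m)) \<and>
      (\<forall>u>m. u < of_rat (snd (c m)) \<longrightarrow> of_rat (fst (c m)) < y u)" if "m \<in> {0<..<\<delta>}" for m
    unfolding c_def by (rule someI_ex) (rule ex[OF that])
  have less: "c m \<noteq> c m'" if "m \<in> {0<..<\<delta>}" "m' \<in> {0<..<\<delta>}" "m < m'" for m m'
  proof
    assume "c m = c m'"
    then have "of_rat (fst (c m)) < y m'" using c[OF that(1)] c[OF that(2)] that(3) by simp
    then show False using c[OF that(2)] \<open>c m = c m'\<close> by simp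
  qed
  have "inj_on c {0<..<\<delta>}"
  proof (rule inj_onI)
    fix a b assume "a \<in> {0<..<\<delta>}" "b \<in> {0<..<\<delta>}" "c a = c b"
    then show "a = b" using less[of a b] less[of b a] by (cases a b rule: linorder_cases) auto
  qed
  then have "countable {0<..<\<delta>}" by (rule countableI')
  with uncountable_open_interval[of 0 \<delta>] assms show False by simp
qed

text \<open>If no point near \<open>0\<close> is a strict record of \<open>y\<close>, then \<open>y\<close> jumps up at the infimum of the points up to \<open>s\<close> with
  values at least \<open>y s\<close>: if this infimum were attained, there would be an even earlier such point.\<close>

lemma definable_eventually_increasing:
  fixes y :: "real \<Rightarrow> real"
  assumes G: "definable {z. 0 < fst z \<and> fst z < \<eta> \<and> snd z = y (fst z)}" and "0 < \<eta>"
    and above: "eventually (\<lambda>s. l < y s) (at_right 0)"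
    and lim: "\<And>e. l < e \<Longrightarrow> eventually (\<lambda>s. y s < e) (at_right 0)"
  shows "\<exists>\<delta>>0. \<delta> \<le> \<eta> \<and> (\<forall>s u. 0 < u \<and> u < s \<and> s < \<delta> \<longrightarrow> y u < y s)"
proof -
  \<comment> \<open>\<open>E s\<close> says that \<open>s\<close> is a strict record,
    \<open>D m\<close> that \<open>y\<close> jumps up immediately after \<open>m\<close>; the
    repeated bounds give both the shape required by \<open>definable_subst\<close>.\<close>
  define E where "E s \<longleftrightarrow> 0 < s \<and> s < \<eta> \<and> (\<forall>u. 0 < u \<and> u < s \<longrightarrow> \<not> (0 < u \<and> u < \<eta> \<and> \<not> y u < y s))" for s
  define D where "D m \<longleftrightarrow> 0 < m \<and> m < \<eta> \<and> (\<exists>q e. y m < q \<and> m < e \<and>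
      (\<forall>u. m < u \<and> u < e \<longrightarrow> 0 < u \<and> u < \<eta> \<and> q \<le> y u))" for m
  have "definable {s. E s}"
    unfolding E_def
    by (rule definable_subst[OF G poly_map_id], intro definable_intros poly_map_intros
        definable_subst[OF G, of snd "\<lambda>x r. \<not> r < snd (fst x)"])
  from definable_eventually_cases[OF this, of 0] show ?thesis
  proof
    assume "eventually E (at_right 0)"
    then obtain b where b: "b > 0" "\<forall>s>0. s < b \<longrightarrow> E s" unfolding eventually_at_right_field by blast
    show ?thesis
    proof (intro exI[of _ "min b \<eta>"] conjI allI impI)
      fix s u assume "0 < u \<and> u < s \<and> s < min b \<eta>"
      then show "y u < y s" using b(2)[rule_format, of s] unfolding E_def by auto
    qed (use b \<open>0 < \<eta>\<close> in auto)
  next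
    assume "eventually (\<lambda>s. \<not> E s) (at_right 0)"
    then have "eventually (\<lambda>s. \<not> E s \<and> l < y s) (at_right 0)" using above by (rule eventually_conj)
    then obtain b0 where b0: "b0 > 0" "\<forall>s>0. s < b0 \<longrightarrow> \<not> E s \<and> l < y s"
      unfolding eventually_at_right_field by blast
    define b where "b = min b0 \<eta>"
    have b: "b > 0" "b \<le> \<eta>" "\<And>s. 0 < s \<Longrightarrow> s < b \<Longrightarrow> \<not> E s" "\<And>s. 0 < s \<Longrightarrow> s < b \<Longrightarrow> l < y s"
      using b0 \<open>0 < \<eta>\<close> by (auto simp: b_def)
    have below: "\<exists>m. 0 < m \<and> m < s \<and> D m" if s: "0 < s" "s < b" for s
    proof -
      define A where "A = {u. 0 < u \<and> u \<le> s \<and> y s \<le> y u}"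
      \<comment> \<open>Since \<open>l < y s\<close>, points with values at least \<open>y s\<close>
        keep a distance \<open>a\<close> from \<open>0\<close>, so their infimum is
        positive.\<close>
      obtain a where a: "a > 0" "\<forall>u>0. u < a \<longrightarrow> y u < y s"
        using lim[OF b(4)[OF s]] unfolding eventually_at_right_field by blast
      have lb: "a \<le> u" if "u \<in> A" for u
        using that a(2)[rule_format, of u] by (cases "u < a") (auto simp: A_def)
      have sA: "s \<in> A" using s by (simp add: A_def)
      have bdd: "bdd_below A" using lb by (rule bdd_belowI)
      define m where "m = Inf A"
      have ma: "a \<le> m" unfolding m_def using sA lb by (intro cInf_greatest) auto
      have mle: "m \<le> u" if "u \<in> A" for u unfolding m_def using that bdd by (rule cInf_lower)
      have m0: "0 < m" "m \<le> s" using ma a(1) mle[OF sA] by auto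
      have "m \<notin> A"
      proof
        assume mA: "m \<in> A"
        have "\<not> E m" using m0 s by (intro b(3)) auto
        then obtain u where u: "0 < u" "u < m" "y m \<le> y u" using m0 s b(2) unfolding E_def by force
        then have "u \<in> A" using mA m0 by (auto simp: A_def)
        then show False using mle[of u] u by simp
      qed
      then have ms: "m < s" "y m < y s" using m0 sA by (auto simp: A_def) (metis order_le_less)
      \<comment> \<open>\<open>m\<close> is an infimum that is not attained, so members of
        \<open>A\<close> accumulate at it from the right; the dichotomy turns this into values at
        least \<open>y s\<close> on a whole interval after \<open>m\<close>.\<close>
      have "definable {u. 0 < u \<and> u < \<eta> \<and> y s \<le> y u}"
        by (rule definable_subst[OF G poly_map_id]) (intro definable_intros poly_map_intros)
      from definable_eventually_cases[OF this, of m]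
      have "eventually (\<lambda>u. 0 < u \<and> u < \<eta> \<and> y s \<le> y u) (at_right m)"
      proof
        assume "eventually (\<lambda>u. \<not> (0 < u \<and> u < \<eta> \<and> y s \<le> y u)) (at_right m)"
        then obtain c where c: "c > m" "\<forall>u>m. u < c \<longrightarrow> \<not> (0 < u \<and> u < \<eta> \<and> y s \<le> y u)"
          unfolding eventually_at_right_field by blast
        have "Inf A < c" using c(1) by (simp add: m_def)
        then obtain u where u: "u \<in> A" "u < c" using cInf_lessD[of A c] sA by blast
        have "m < u" using mle[OF u(1)] u(1) \<open>m \<notin> A\<close> by (metis order_le_less)
        moreover have "0 < u" "u < \<eta>" "y s \<le> y u" using u(1) s b(2) by (auto simp: A_def)
        ultimately show ?thesis using c(2) u(2) by blast
      qed
      then obtain c where c: "c > m" "\<forall>u>m. u < c \<longrightarrow> 0 < u \<and> u < \<eta> \<and> y s \<le> y u"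
        unfolding eventually_at_right_field by blast
      have "D m"
        unfolding D_def
      proof (intro conjI exI)
        show "y m < y s" by (rule ms(2))
        show "m < c" by (rule c(1))
      qed (use c m0 ms s b in auto)
      with m0 ms show ?thesis by blast
    qed
    have "definable {m. D m}"
      unfolding D_def
      by (rule definable_subst[OF G poly_map_id], intro definable_intros poly_map_intros
        definable_subst[OF G, of snd "\<lambda>x r. snd (fst (fst x)) \<le> r"])
    from definable_eventually_cases[OF this, of 0]
    \<comment> \<open>Jumps occur arbitrarily close to \<open>0\<close>, hence at every point near
      \<open>0\<close>, which countability forbids.\<close>
    have "eventually D (at_right 0)"
    proof
      assume "eventually (\<lambda>m. \<not> D m) (at_right 0)"
      then obtain c where c: "c > 0" "\<forall>m>0. m < c \<longrightarrow> \<not> D m" unfolding eventually_at_right_field by blast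
      have "0 < min b c / 2" "min b c / 2 < b" "min b c / 2 < c" using b(1) c(1) by auto
      with below[of "min b c / 2"] c(2) show ?thesis by fastforce
    qed
    then obtain c where c: "c > 0" "\<forall>m>0. m < c \<longrightarrow> D m" unfolding eventually_at_right_field by blast
    obtain m where m: "0 < m" "m < c" "\<not> (\<exists>q>y m. eventually (\<lambda>u. q \<le> y u) (at_right m))"
      using no_right_jumps_everywhere[OF c(1), of y] by blast
    then have "D m" using c(2) by blast
    then obtain q e where qe: "y m < q" "m < e" "\<forall>u. m < u \<and> u < e \<longrightarrow> 0 < u \<and> u < \<eta> \<and> q \<le> y u"
      unfolding D_def by blast
    then have "eventually (\<lambda>u. q \<le> y u) (at_right m)"
      unfolding eventually_at_right_field by (intro exI[of _ e]) auto
    with qe(1) m(3) show ?thesis by blast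
  qed
qed

text \<open>By the dichotomy and boundedness the right limit \<open>l\<close> at \<open>0\<close>
  exists, and \<open>y\<close> stays above, below or on it. A function above its limit increases
  away from \<open>0\<close>; below it, the same is applied to \<open>- y\<close>, which accounts
  for the sign \<open>\<epsilon>\<close>.\<close>

lemma definable_eventually_monotone:
  fixes y :: "real \<Rightarrow> real"
  assumes G: "definable {z. 0 < fst z \<and> fst z < \<eta> \<and> snd z = y (fst z)}" and \<eta>: "0 < \<eta>"
    and bd: "\<And>s. 0 < s \<Longrightarrow> s < \<eta> \<Longrightarrow> \<bar>y s\<bar> \<le> M"
  shows "\<exists>\<epsilon>\<in>{-1, 1}. \<exists>\<delta>>0. \<delta> \<le> \<eta> \<and> (\<forall>s u. 0 < u \<and> u \<le> s \<and> s < \<delta> \<longrightarrow> \<epsilon> * y u \<le> \<epsilon> * y s)"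
proof -
  have ev\<eta>: "eventually (\<lambda>s. 0 < s \<and> s < \<eta>) (at_right 0)"
    unfolding eventually_at_right_field using \<eta> by blast
  have gt: "eventually (\<lambda>s. c < y s) (at_right 0) \<or> eventually (\<lambda>s. y s \<le> c) (at_right 0)" for c
  proof -
    have "definable {s. 0 < s \<and> s < \<eta> \<and> c < y s}"
      by (rule definable_subst[OF G poly_map_id]) (intro definable_intros poly_map_intros)
    from definable_eventually_cases[OF this, of 0] show ?thesis
    proof
      assume "eventually (\<lambda>s. 0 < s \<and> s < \<eta> \<and> c < y s) (at_right 0)"
      then have "eventually (\<lambda>s. c < y s) (at_right 0)" by (rule eventually_mono) simp
      then show ?thesis ..
    next
      assume "eventually (\<lambda>s. \<not> (0 < s \<and> s < \<eta> \<and> c < y s)) (at_right 0)"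
      with ev\<eta> have "eventually (\<lambda>s. y s \<le> c) (at_right 0)" by eventually_elim auto
      then show ?thesis ..
    qed
  qed
  have lt: "eventually (\<lambda>s. y s < c) (at_right 0) \<or> eventually (\<lambda>s. c \<le> y s) (at_right 0)" for c
  proof -
    have "definable {s. 0 < s \<and> s < \<eta> \<and> y s < c}"
      by (rule definable_subst[OF G poly_map_id]) (intro definable_intros poly_map_intros)
    from definable_eventually_cases[OF this, of 0] show ?thesis
    proof
      assume "eventually (\<lambda>s. 0 < s \<and> s < \<eta> \<and> y s < c) (at_right 0)"
      then have "eventually (\<lambda>s. y s < c) (at_right 0)" by (rule eventually_mono) simp
      then show ?thesis ..
    next
      assume "eventually (\<lambda>s. \<not> (0 < s \<and> s < \<eta> \<and> y s < c)) (at_right 0)"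
      with ev\<eta> have "eventually (\<lambda>s. c \<le> y s) (at_right 0)" by eventually_elim auto
      then show ?thesis ..
    qed
  qed
  define C where "C = {c. eventually (\<lambda>s. c < y s) (at_right 0)}"
  have "eventually (\<lambda>s. - M - 1 < y s) (at_right 0)"
    using ev\<eta> by eventually_elim (use bd in \<open>smt (verit)\<close>)
  then have Cne: "- M - 1 \<in> C" by (simp add: C_def)
  have Cle: "c \<le> M" if "c \<in> C" for c
  proof -
    have "eventually (\<lambda>s. c < y s) (at_right 0)" using that by (simp add: C_def)
    with ev\<eta> have "eventually (\<lambda>s. c \<le> M) (at_right (0::real))"
      by eventually_elim (use bd in \<open>smt (verit)\<close>)
    then show ?thesis by simp
  qed
  have bdd: "bdd_above C" using Cle by (rule bdd_aboveI)
  define l where "l = Sup C"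
  have lim1: "eventually (\<lambda>s. e < y s) (at_right 0)" if e: "e < l" for e
  proof -
    obtain c where c: "c \<in> C" "e < c" using less_cSupD[of C e] Cne e by (auto simp: l_def)
    then have "eventually (\<lambda>s. c < y s) (at_right 0)" by (simp add: C_def)
    then show ?thesis by (rule eventually_mono) (use c(2) in simp)
  qed
  have lim2: "eventually (\<lambda>s. y s < e) (at_right 0)" if e: "l < e" for e
  proof -
    obtain e' where e': "l < e'" "e' < e" using dense[OF e] by blast
    have "e' \<notin> C" using cSup_upper[OF _ bdd, of e'] e' by (auto simp: l_def)
    then have "eventually (\<lambda>s. y s \<le> e') (at_right 0)" using gt[of e'] by (simp add: C_def)
    then show ?thesis by (rule eventually_mono) (use e' in simp)
  qed
  consider "eventually (\<lambda>s. l < y s) (at_right 0)" | "eventually (\<lambda>s. y s < l) (at_right 0)"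
    | "eventually (\<lambda>s. y s \<le> l) (at_right 0)" "eventually (\<lambda>s. l \<le> y s) (at_right 0)"
    using gt[of l] lt[of l] by blast
  then show ?thesis
  proof cases
    case 1
    obtain \<delta> where "\<delta> > 0" "\<delta> \<le> \<eta>" "\<forall>s u. 0 < u \<and> u < s \<and> s < \<delta> \<longrightarrow> y u < y s"
      using definable_eventually_increasing[OF G \<eta> 1 lim2] by blast
    then show ?thesis
      by (intro bexI[of _ 1] exI[of _ \<delta>]) (auto simp: order_le_less)
  next
    case 2
    have "poly_map (\<lambda>z::real \<times> real. (fst z, 0 - snd z))" by (intro poly_map_intros)
    from definable_vimage[OF G this]
    have "definable {z. 0 < fst z \<and> fst z < \<eta> \<and> - snd z = y (fst z)}" by simp
    also have "{z. 0 < fst z \<and> fst z < \<eta> \<and> - snd z = y (fst z)} =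
      {z. 0 < fst z \<and> fst z < \<eta> \<and> snd z = - y (fst z)}" by auto
    finally have G': "definable {z. 0 < fst z \<and> fst z < \<eta> \<and> snd z = - y (fst z)}" .
    have "eventually (\<lambda>s. - l < - y s) (at_right 0)" using 2 by simp
    moreover have "eventually (\<lambda>s. - y s < e) (at_right 0)" if "- l < e" for e
    proof -
      have "- e < l" using that by simp
      from lim1[OF this] show ?thesis by (rule eventually_mono) simp
    qed
    ultimately obtain \<delta> where "\<delta> > 0" "\<delta> \<le> \<eta>" "\<forall>s u. 0 < u \<and> u < s \<and> s < \<delta> \<longrightarrow> - y u < - y s"
      using definable_eventually_increasing[OF G' \<eta>] by blast
    then show ?thesis
      by (intro bexI[of _ "-1"] exI[of _ \<delta>]) (auto simp: order_le_less)
  next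
    case 3
    then have "eventually (\<lambda>s. y s = l) (at_right 0)" by eventually_elim simp
    then obtain b where b: "b > 0" "\<forall>s>0. s < b \<longrightarrow> y s = l" unfolding eventually_at_right_field by blast
    then show ?thesis
      by (intro bexI[of _ 1] exI[of _ "min b \<eta>"]) (use \<eta> in auto)
  qed
qed

section \<open>Definable selections\<close>

text \<open>The lexicographically smallest point for some order of the coordinates: these are
  minimised in turn, and compactness passes from each set of minimisers to the next.\<close>

lemma definable_selection:
  fixes W :: "real \<Rightarrow> 'b::euclidean_space \<Rightarrow> bool"
  assumes W: "definable {z. W (fst z) (snd z)}" and comp: "\<And>s. compact {x. W s x}"
  obtains W' where "definable {z. W' (fst z) (snd z)}" "\<And>s x. W' s x \<Longrightarrow> W s x"
    "\<And>s x. W s x \<Longrightarrow> \<exists>x. W' s x" "\<And>s x x'. W' s x \<Longrightarrow> W' s x' \<Longrightarrow> x = x'"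
proof -
  have "\<exists>W'. definable {z. W' (fst z) (snd z)} \<and> (\<forall>s. compact {x. W' s x}) \<and> (\<forall>s x. W' s x \<longrightarrow> W s x) \<and>
    (\<forall>s x. W s x \<longrightarrow> (\<exists>x. W' s x)) \<and> (\<forall>s x x'. W' s x \<longrightarrow> W' s x' \<longrightarrow> (\<forall>b\<in>B. x \<bullet> b = x' \<bullet> b))"
    if "finite B" for B :: "'b set"
    using that
  proof (induction B rule: finite_induct)
    case empty
    show ?case using W comp by (intro exI[of _ W]) auto
  next
    case (insert b B)
    then obtain V where V: "definable {z. V (fst z) (snd z)}" "\<And>s. compact {x. V s x}" "\<And>s x. V s x \<Longrightarrow> W s x"
      "\<And>s x. W s x \<Longrightarrow> \<exists>x. V s x" "\<And>s x x'. V s x \<Longrightarrow> V s x' \<Longrightarrow> (\<forall>b\<in>B. x \<bullet> b = x' \<bullet> b)"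
      by (elim exE conjE) blast
    define V' where "V' s x \<longleftrightarrow> V s x \<and> (\<forall>x'. V s x' \<longrightarrow> x \<bullet> b \<le> x' \<bullet> b)" for s x
    have ne: "\<exists>x. V' s x" if "V s x" for s x
    proof -
      have "\<exists>x\<in>{x. V s x}. \<forall>x'\<in>{x. V s x}. x \<bullet> b \<le> x' \<bullet> b"
        using that by (intro continuous_attains_inf V(2)) (auto intro!: continuous_intros)
      then show ?thesis by (auto simp: V'_def)
    qed
    have "compact {x. V' s x}" for s
    proof (cases "\<exists>x. V' s x")
      case True
      then obtain x0 where x0: "V' s x0" by auto
      have "{x. V' s x} = {x. V s x} \<inter> {x. b \<bullet> x \<le> x0 \<bullet> b}"
        using x0 by (auto simp: V'_def inner_commute intro: order_trans)
      also have "compact \<dots>" by (intro compact_Int_closed V(2) closed_halfspace_le)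
      finally show ?thesis .
    qed simp
    moreover have "definable {z. V' (fst z) (snd z)}"
    proof -
      have "poly_map (\<lambda>w. (fst (fst w), snd w))"
        by (intro poly_map_intros)
      from definable_vimage[OF V(1) this]
      have "definable {w. V (fst (fst w)) (snd w)}" by simp
      then show ?thesis
        unfolding V'_def by (intro definable_conj V(1) definable_all definable_imp definable_le poly_map_intros)
    qed
    moreover have "x \<bullet> b = x' \<bullet> b" if "V' s x" "V' s x'" for s x x'
      using that by (auto simp: V'_def intro: antisym)
    moreover have "V' s x \<Longrightarrow> V s x" for s x by (simp add: V'_def)
    ultimately show ?case
      using V(3-5) ne by (intro exI[of _ V'] conjI allI impI ballI) (blast | metis insert_iff)+
  qed
  from this[OF finite_Basis] obtain W' where W': "definable {z. W' (fst z) (snd z)}"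
    "\<And>s x. W' s x \<Longrightarrow> W s x" "\<And>s x. W s x \<Longrightarrow> \<exists>x. W' s x"
    "\<And>s x x'. W' s x \<Longrightarrow> W' s x' \<Longrightarrow> (\<forall>b\<in>Basis. x \<bullet> b = x' \<bullet> b)"
    by (elim exE conjE) blast
  show thesis
  proof (rule that[OF W'(1-3)])
    show "x = x'" if "W' s x" "W' s x'" for s x x'
      by (rule euclidean_eqI) (use W'(4)[OF that] in blast)
  qed
qed

text \<open>Each coordinate of the selected curve is monotone near \<open>0\<close>. Adding the
  coordinates with the signs of their monotonicity gives \<open>\<rho>\<close>, whose increments are
  the l1 distances along the curve and which is bounded because the curve is.\<close>

lemma definable_selection_monotone:
  fixes W :: "real \<Rightarrow> 'b::euclidean_space \<Rightarrow> bool"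
  assumes W: "definable {z. W (fst z) (snd z)}" and comp: "\<And>s. compact {x. W s x}"
    and bd: "\<And>s x. W s x \<Longrightarrow> norm x \<le> M"
    and freq: "\<exists>\<^sub>F s in at_right 0. \<exists>x. W s x"
  obtains \<delta> x \<rho> C where "0 < \<delta>" "\<And>s. 0 < s \<Longrightarrow> s < \<delta> \<Longrightarrow> W s (x s)"
    "\<And>u s. 0 < u \<Longrightarrow> u \<le> s \<Longrightarrow> s < \<delta> \<Longrightarrow> norm (x s - x u) \<le> \<rho> s - \<rho> u"
    "\<And>s. 0 < s \<Longrightarrow> s < \<delta> \<Longrightarrow> \<bar>\<rho> s\<bar> \<le> (C::real)"
proof -
  obtain W' where W': "definable {z. W' (fst z) (snd z)}" "\<And>s x. W' s x \<Longrightarrow> W s x"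
    "\<And>s x. W s x \<Longrightarrow> \<exists>x. W' s x" "\<And>s x x'. W' s x \<Longrightarrow> W' s x' \<Longrightarrow> x = x'"
    by (rule definable_selection[OF W comp]) blast
  \<comment> \<open>The dichotomy upgrades solvability at arbitrarily small \<open>s\<close> to all
    small \<open>s\<close>.\<close>
  have "eventually (\<lambda>s. \<exists>x. W s x) (at_right 0)"
    using definable_eventually_cases[OF definable_ex[OF W], of 0] freq by (auto simp: frequently_def)
  then obtain \<eta> where \<eta>: "0 < \<eta>" "\<forall>s>0. s < \<eta> \<longrightarrow> (\<exists>x. W s x)"
    unfolding eventually_at_right_field by blast
  define x where "x s = (THE x. W' s x)" for s
  have x: "W' s (x s)" if "0 < s" "s < \<eta>" for s
    unfolding x_def
  proof (rule theI')
    show "\<exists>!x. W' s x" using \<eta>(2) that W'(3,4) by blast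
  qed
  have x_eq: "z = x s" if "W' s z" "0 < s" "s < \<eta>" for s z
    using W'(4)[OF that(1) x[OF that(2,3)]] .
  have mon: "\<exists>\<epsilon>\<in>{-1, 1}. \<exists>\<delta>>0. \<delta> \<le> \<eta> \<and> (\<forall>s u. 0 < u \<and> u \<le> s \<and> s < \<delta> \<longrightarrow> \<epsilon> * (x u \<bullet> b) \<le> \<epsilon> * (x s \<bullet> b))"
    if b: "b \<in> Basis" for b
  proof (rule definable_eventually_monotone[OF _ \<eta>(1)])
    have "poly_map (\<lambda>w::(real \<times> real) \<times> 'b. (fst (fst w), snd w))" by (intro poly_map_intros)
    from definable_vimage[OF W'(1) this]
    have "definable {w::(real \<times> real) \<times> 'b. W' (fst (fst w)) (snd w)}" by simp
    then have "definable {z::real \<times> real. 0 < fst z \<and> fst z < \<eta> \<and> (\<exists>y. W' (fst z) y \<and> snd z = y \<bullet> b)}"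
      by (intro definable_conj definable_ex definable_eq definable_less poly_map_intros)
    also have "{z::real \<times> real. 0 < fst z \<and> fst z < \<eta> \<and> (\<exists>y. W' (fst z) y \<and> snd z = y \<bullet> b)} =
      {z. 0 < fst z \<and> fst z < \<eta> \<and> snd z = x (fst z) \<bullet> b}" using x x_eq by blast
    finally show "definable {z. 0 < fst z \<and> fst z < \<eta> \<and> snd z = x (fst z) \<bullet> b}" .
    show "\<bar>x s \<bullet> b\<bar> \<le> M" if "0 < s" "s < \<eta>" for s
      using Basis_le_norm[OF b, of "x s"] bd[OF W'(2)[OF x[OF that]]] by linarith
  qed
  define P where "P b p \<longleftrightarrow> fst p \<in> {-1, 1} \<and> 0 < snd p \<and> snd p \<le> \<eta> \<and>
    (\<forall>s u. 0 < u \<and> u \<le> s \<and> s < snd p \<longrightarrow> fst p * (x u \<bullet> b) \<le> fst p * (x s \<bullet> b))"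
    for b and p :: "real \<times> real"
  define p where "p b = (SOME p. P b p)" for b
  define \<epsilon> where "\<epsilon> b = fst (p b)" for b
  define \<delta>' where "\<delta>' b = snd (p b)" for b
  have p: "P b (p b)" if b: "b \<in> Basis" for b
  proof -
    obtain e d where "e \<in> {-1, 1}" "0 < d" "d \<le> \<eta>"
      "\<forall>s u. 0 < u \<and> u \<le> s \<and> s < d \<longrightarrow> e * (x u \<bullet> b) \<le> e * (x s \<bullet> b)"
      using mon[OF b] by blast
    then have "P b (e, d)" unfolding P_def fst_conv snd_conv by blast
    then show ?thesis unfolding p_def by (rule someI)
  qed
  have \<epsilon>: "\<epsilon> b \<in> {-1, 1}" and \<delta>': "0 < \<delta>' b" "\<delta>' b \<le> \<eta>"
    and mono: "\<And>s u. 0 < u \<Longrightarrow> u \<le> s \<Longrightarrow> s < \<delta>' b \<Longrightarrow> \<epsilon> b * (x u \<bullet> b) \<le> \<epsilon> b * (x s \<bullet> b)"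
    if "b \<in> Basis" for b
    using p[OF that] unfolding P_def \<epsilon>_def \<delta>'_def by blast+
  define \<delta> where "\<delta> = Min (\<delta>' ` Basis)"
  have \<delta>: "0 < \<delta>" "\<And>b. b \<in> Basis \<Longrightarrow> \<delta> \<le> \<delta>' b"
    unfolding \<delta>_def using \<delta>'(1) by (auto intro!: Min_le simp: Min_gr_iff)
  have \<delta>\<eta>: "\<delta> \<le> \<eta>"
  proof -
    obtain b :: 'b where "b \<in> Basis" using nonempty_Basis by blast
    then show ?thesis using \<delta>(2) \<delta>'(2) by (meson order_trans)
  qed
  define \<rho> where "\<rho> s = (\<Sum>b\<in>Basis. \<epsilon> b * (x s \<bullet> b))" for s
  show thesis
  proof (rule that[of \<delta> x \<rho> "\<Sum>b\<in>(Basis::'b set). M"])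
    show "W s (x s)" if "0 < s" "s < \<delta>" for s using x[of s] W'(2) that \<delta>\<eta> by simp
    show "norm (x s - x u) \<le> \<rho> s - \<rho> u" if "0 < u" "u \<le> s" "s < \<delta>" for u s
    proof -
      have "norm (x s - x u) \<le> (\<Sum>b\<in>Basis. \<bar>(x s - x u) \<bullet> b\<bar>)" by (rule norm_le_l1)
      also have "\<dots> \<le> (\<Sum>b\<in>Basis. \<epsilon> b * (x s \<bullet> b) - \<epsilon> b * (x u \<bullet> b))"
      proof (rule sum_mono)
        fix b :: 'b assume b: "b \<in> Basis"
        have "\<epsilon> b * (x u \<bullet> b) \<le> \<epsilon> b * (x s \<bullet> b)" using mono[OF b that(1,2)] \<delta>(2)[OF b] that(3) by simp
        then show "\<bar>(x s - x u) \<bullet> b\<bar> \<le> \<epsilon> b * (x s \<bullet> b) - \<epsilon> b * (x u \<bullet> b)"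
          using \<epsilon>[OF b] by (auto simp: inner_diff_left)
      qed
      finally show ?thesis by (simp add: \<rho>_def sum_subtractf)
    qed
    show "\<bar>\<rho> s\<bar> \<le> (\<Sum>b\<in>(Basis::'b set). M)" if "0 < s" "s < \<delta>" for s
      unfolding \<rho>_def
    proof (rule order_trans[OF sum_abs sum_mono])
      fix b :: 'b assume b: "b \<in> Basis"
      have "W s (x s)" using x[of s] W'(2) that \<delta>\<eta> by simp
      then have "\<bar>x s \<bullet> b\<bar> \<le> M" using Basis_le_norm[OF b, of "x s"] bd by (meson order_trans)
      then show "\<bar>\<epsilon> b * (x s \<bullet> b)\<bar> \<le> M" using \<epsilon>[OF b] by auto
    qed
  qed (rule \<delta>(1))
qed

section \<open>Descent sequences of definable functions have finite length\<close>

text \<open>In the sum the increments of \<open>r\<close> telescope to a bounded amount, and half of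
  the sum of \<open>d\<close> is absorbed on the left.\<close>

lemma summable_of_halving:
  fixes d r :: "nat \<Rightarrow> real"
  assumes d: "\<And>t. 0 \<le> d t" and step: "\<And>t. d (Suc t) \<le> d t / 2 + C * (r t - r (Suc t))"
    and C: "0 \<le> C" and r: "\<And>t. \<bar>r t\<bar> \<le> B"
  shows "summable d"
proof (rule summableI_nonneg_bounded)
  fix n
  have "(\<Sum>i<n. d (Suc i)) \<le> (\<Sum>i<n. d i / 2 + C * (r i - r (Suc i)))" by (intro sum_mono step)
  also have "\<dots> = (\<Sum>i<n. d i) / 2 + C * (r 0 - r n)"
    by (simp add: sum.distrib sum_divide_distrib sum_lessThan_telescope' flip: sum_distrib_left)
  also have "\<dots> \<le> (\<Sum>i<n. d i) / 2 + C * (2 * B)"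
    using r[of 0] r[of n] C by (intro add_left_mono mult_left_mono) auto
  finally have "(\<Sum>i<n. d (Suc i)) \<le> (\<Sum>i<n. d i) / 2 + C * (2 * B)" .
  moreover have "(\<Sum>i<n. d i) \<le> d 0 + (\<Sum>i<n. d (Suc i))"
    using d[of n] by (simp flip: sum.lessThan_Suc_shift)
  ultimately show "(\<Sum>i<n. d i) \<le> 2 * (d 0 + C * (2 * B))" by argo
qed (rule d)

text \<open>With \<open>C = b / a + K / a + 1\<close> one has \<open>b \<le> a * C\<close> and
  \<open>K \<le> a * C^2\<close>, so the mixed and the last term of
  \<open>a * (d / 2 + C * \<Delta>)^2\<close> already dominate the right-hand side of
  \<open>le\<close>.\<close>

lemma descent_step_bound:
  fixes a b K d d' \<Delta> :: real
  assumes "0 < a" "0 \<le> b" "0 \<le> K" "0 \<le> d" "0 \<le> d'" "0 \<le> \<Delta>"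
    and le: "a * d'^2 \<le> b * d * \<Delta> + K * \<Delta>^2"
  shows "d' \<le> d / 2 + (b / a + K / a + 1) * \<Delta>"
proof (rule ccontr)
  define C where "C = b / a + K / a + 1"
  assume "\<not> ?thesis"
  then have gt: "d / 2 + C * \<Delta> < d'" by (simp add: C_def)
  have aC: "b \<le> a * C" "K \<le> a * C" "1 \<le> C"
    using assms by (auto simp: C_def field_simps)
  then have "K * 1 \<le> a * C * C" using assms(1,3) by (intro mult_mono) auto
  then have K: "K \<le> a * C^2" by (simp add: power2_eq_square)
  have "0 \<le> d / 2 + C * \<Delta>" using assms aC by simp
  then have "(d / 2 + C * \<Delta>)^2 < d'^2" using gt by (intro power_strict_mono) auto
  then have "a * (d / 2 + C * \<Delta>)^2 < a * d'^2" using \<open>0 < a\<close> by simp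
  moreover have "a * (d / 2 + C * \<Delta>)^2 = a * (d^2 / 4) + (a * C) * (d * \<Delta>) + (a * C^2) * \<Delta>^2"
    by (simp add: power2_eq_square field_simps)
  moreover have "b * (d * \<Delta>) \<le> (a * C) * (d * \<Delta>)" using aC assms by (intro mult_right_mono) auto
  moreover have "K * \<Delta>^2 \<le> (a * C^2) * \<Delta>^2" using K by (intro mult_right_mono) auto
  moreover have "0 \<le> a * (d^2 / 4)" using \<open>0 < a\<close> by simp
  ultimately show False using le by (simp add: mult.assoc)
qed

text \<open>A proximal subgradient, with the inequality demanded for all \<open>y\<close> and with
  \<open>K\<close> fixed in advance. This makes the relation definable and closed in
  \<open>(x, v)\<close> for definable continuous \<open>F\<close>.\<close>

definition quadratic_subgradient :: "('a::real_inner \<Rightarrow> real) \<Rightarrow> real \<Rightarrow> 'a \<Rightarrow> 'a \<Rightarrow> bool" where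
  "quadratic_subgradient F K x v \<longleftrightarrow>
     (\<forall>y. F x + v \<bullet> (y - x) - K * ((y - x) \<bullet> (y - x)) \<le> F y)"

lemma definable_le_fun:
  fixes F :: "'a::euclidean_space \<Rightarrow> real" and f :: "'b::euclidean_space \<Rightarrow> 'a"
  assumes F: "definable {z. snd z = F (fst z)}" and f: "poly_map f" and p: "poly_map p"
  shows "definable {x. p x \<le> F (f x)}"
proof -
  have "poly_map (\<lambda>w::'b \<times> real. (f (fst w), snd w))"
    using poly_map_compose[OF f poly_map_fst[OF poly_map_id]] by (intro poly_map_Pair poly_map_intros)
  from definable_vimage[OF F this]
  have "definable {w::'b \<times> real. snd w = F (f (fst w))}" by simp
  then have "definable {x. \<exists>c. c = F (f x) \<and> p x \<le> c}"
    using poly_map_compose[OF p poly_map_fst[OF poly_map_id]]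
    by (intro definable_ex definable_conj definable_le poly_map_intros) auto
  then show ?thesis by simp
qed

text \<open>The minimal slope \<open>v r\<close> on the level \<open>r\<close> of \<open>F\<close> is attained along a definable curve \<open>x r\<close>, whose coordinates are
  monotone near level \<open>0\<close>. Comparing two points of the curve bounds a decrease of the value by \<open>v r\<close> times
  the increment of the monotone function \<open>\<rho>\<close>, which takes the place of the concave function in the
  Kurdyka-Lojasiewicz inequality.\<close>

theorem definable_descent_summable:
  fixes F :: "'a::euclidean_space \<Rightarrow> real" and X :: "nat \<Rightarrow> 'a"
  assumes F: "definable {z. snd z = F (fst z)}" and cont: "continuous_on UNIV F"
    and bounded: "\<And>t. norm (X t) \<le> R"
    and abK: "0 < a" "0 \<le> b" "0 \<le> K"
    and dec: "\<And>t. F (X (Suc t)) + a * (norm (X (Suc t) - X t))^2 \<le> F (X t)"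
    and sub: "\<And>t. \<exists>v. norm v \<le> b * norm (X (Suc t) - X t) \<and> quadratic_subgradient F K (X (Suc t)) v"
  shows "summable (\<lambda>t. norm (X (Suc t) - X t))"
proof -
  define d where "d t = norm (X (Suc t) - X t)" for t
  have d0: "0 \<le> d t" for t by (simp add: d_def)
  have "F (X (Suc t)) \<le> F (X t)" for t
    using dec[of t] abK(1) by (smt (verit) mult_nonneg_nonneg zero_le_power2)
  then have decr: "decseq (\<lambda>t. F (X t))" by (rule decseq_SucI)
  have "compact (F ` cball 0 R)"
    by (intro compact_continuous_image continuous_on_subset[OF cont]) auto
  then have "bdd_below (F ` cball 0 R)" by (intro bounded_imp_bdd_below compact_imp_bounded)
  then obtain l where "\<forall>x\<in>cball 0 R. l \<le> F x" unfolding bdd_below_def by auto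
  then have l: "l \<le> F x" if "norm x \<le> R" for x using that by simp
  obtain Fs where Fs: "(\<lambda>t. F (X t)) \<longlonglongrightarrow> Fs" "\<forall>t. Fs \<le> F (X t)"
    by (rule decseq_convergent[OF decr, of l]) (use l bounded in auto)
  show ?thesis
  proof (cases "\<exists>T. F (X T) = Fs")
    case True
    then obtain T where T: "F (X T) = Fs" by auto
    have "d t = 0" if "t \<ge> T" for t
    proof -
      have "F (X t) = Fs" using decseqD[OF decr that] T Fs(2) by (metis antisym)
      then have "a * (d t)^2 \<le> 0" using dec[of t] Fs(2)[rule_format, of "Suc t"] by (simp add: d_def)
      then show ?thesis using abK(1) by (simp add: mult_le_0_iff)
    qed
    then have "summable d" by (intro summable_finite[of "{..<T}"]) auto
    then show ?thesis unfolding d_def[abs_def] .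
  next
    case False
    \<comment> \<open>Shifted by one, because subgradients are given only at the iterates
      \<open>X (Suc t)\<close>.\<close>
    define s where "s t = F (X (Suc t)) - Fs" for t
    have s0: "0 < s t" for t using False Fs(2) by (simp add: s_def order_less_le)
    have s_lim: "s \<longlonglongrightarrow> 0"
      using tendsto_diff[OF LIMSEQ_Suc[OF Fs(1)] tendsto_const[of Fs]] unfolding s_def[abs_def] by simp
    have s_dec: "s (Suc t) \<le> s t" for t using decseqD[OF decr, of "Suc t" "Suc (Suc t)"] by (simp add: s_def)
    define V where "V r z \<longleftrightarrow> F (fst z) = Fs + r \<and> norm (fst z) \<le> R \<and>
       quadratic_subgradient F K (fst z) (snd z)" for r and z :: "'a \<times> 'a"
    \<comment> \<open>The form used for definability and closedness: the norm is squared, and the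
      level \<open>Fs + r\<close> replaces \<open>F (fst z)\<close> inside the quantifier, so that
      each condition compares a polynomial with at most one value of \<open>F\<close>.\<close>
    have V_alt: "V r z \<longleftrightarrow> Fs + r = F (fst z) \<and> fst z \<bullet> fst z \<le> R\<^sup>2 \<and>
       (\<forall>y. Fs + r + snd z \<bullet> (y - fst z) - K * ((y - fst z) \<bullet> (y - fst z)) \<le> F y)" for r z
    proof -
      have "0 \<le> R" using bounded[of 0] norm_ge_zero order_trans by blast
      then have "norm (fst z) \<le> R \<longleftrightarrow> fst z \<bullet> fst z \<le> R\<^sup>2" by (simp add: norm_le_square)
      then show ?thesis
        by (cases "F (fst z) = Fs + r") (auto simp: V_def quadratic_subgradient_def)
    qed
    have V_def': "definable {w. V (fst w) (snd w)}"
    proof -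
      have "poly_map (\<lambda>w::real \<times> ('a \<times> 'a). (fst (snd w), Fs + fst w))" by (intro poly_map_intros)
      from definable_vimage[OF F this]
      have "definable {w::real \<times> ('a \<times> 'a). Fs + fst w = F (fst (snd w))}" by simp
      moreover have "definable {w::real \<times> ('a \<times> 'a). fst (snd w) \<bullet> fst (snd w) \<le> R\<^sup>2}"
        by (intro definable_le poly_map_intros)
      moreover have "definable {w::real \<times> ('a \<times> 'a). \<forall>y. Fs + fst w + snd (snd w) \<bullet> (y - fst (snd w))
          - K * ((y - fst (snd w)) \<bullet> (y - fst (snd w))) \<le> F y}"
        by (rule definable_all, rule definable_le_fun[OF F]) (intro poly_map_intros)+
      ultimately show ?thesis unfolding V_alt by (intro definable_conj)
    qed
    have cont': "continuous_on S (\<lambda>x. F (f x))" if "continuous_on S f" for f and S :: "('a \<times> 'a) set"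
      using continuous_on_compose2[OF cont that] by auto
    have V_closed: "closed {z. V r z}" for r
      unfolding V_alt
      by (intro closed_Collect_conj closed_Collect_all closed_Collect_eq closed_Collect_le
          continuous_intros cont')
    define W where "W r z \<longleftrightarrow> V r z \<and> (\<forall>z'. V r z' \<longrightarrow> snd z \<bullet> snd z \<le> snd z' \<bullet> snd z')" for r z
    have W_def': "definable {w. W (fst w) (snd w)}"
    proof -
      have "poly_map (\<lambda>w::(real \<times> ('a \<times> 'a)) \<times> ('a \<times> 'a). (fst (fst w), snd w))" by (intro poly_map_intros)
      from definable_vimage[OF V_def' this]
      have "definable {w::(real \<times> ('a \<times> 'a)) \<times> ('a \<times> 'a). V (fst (fst w)) (snd w)}" by simp
      then show ?thesis
        unfolding W_def by (intro definable_conj V_def' definable_all definable_imp definable_le poly_map_intros)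
    qed
    \<comment> \<open>\<open>V\<close> alone does not bound the slope; the cut at \<open>c\<close>
      restores compactness.\<close>
    have Vc: "compact {z. V r z \<and> snd z \<bullet> snd z \<le> c}" for r c
    proof -
      have "{z. V r z \<and> snd z \<bullet> snd z \<le> c} = {z. V r z} \<inter> {z. snd z \<bullet> snd z \<le> c}" by auto
      moreover have "closed ({z. V r z} \<inter> {z::'a \<times> 'a. snd z \<bullet> snd z \<le> c})"
        by (intro closed_Int V_closed closed_Collect_le continuous_intros)
      moreover have "{z. V r z \<and> snd z \<bullet> snd z \<le> c} \<subseteq> cball 0 R \<times> cball 0 (sqrt c)"
        by (auto simp: V_def norm_eq_sqrt_inner)
      then have "bounded {z. V r z \<and> snd z \<bullet> snd z \<le> c}"
        by (rule bounded_subset[OF bounded_Times[OF bounded_cball bounded_cball]])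
      ultimately show ?thesis by (simp add: compact_eq_bounded_closed)
    qed
    have W_ex: "\<exists>z. W r z" if V: "V r z1" for r z1
    proof -
      define S where "S = {z. V r z \<and> snd z \<bullet> snd z \<le> snd z1 \<bullet> snd z1}"
      have "\<exists>z\<in>S. \<forall>z'\<in>S. snd z \<bullet> snd z \<le> snd z' \<bullet> snd z'"
      proof (rule continuous_attains_inf)
        show "compact S" unfolding S_def by (rule Vc)
        have "z1 \<in> S" using V by (simp add: S_def)
        then show "S \<noteq> {}" by blast
      qed (intro continuous_intros)
      then obtain z where z: "z \<in> S" "\<And>z'. z' \<in> S \<Longrightarrow> snd z \<bullet> snd z \<le> snd z' \<bullet> snd z'" by auto
      have "snd z \<bullet> snd z \<le> snd z' \<bullet> snd z'" if "V r z'" for z'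
      proof (cases "z' \<in> S")
        case False
        then have "snd z1 \<bullet> snd z1 \<le> snd z' \<bullet> snd z'" using that by (simp add: S_def)
        moreover have "snd z \<bullet> snd z \<le> snd z1 \<bullet> snd z1" using z(1) by (simp add: S_def)
        ultimately show ?thesis by simp
      qed (rule z(2))
      moreover have "V r z" using z(1) by (simp add: S_def)
      ultimately show ?thesis unfolding W_def by blast
    qed
    \<comment> \<open>Minimal slopes may be unbounded as the level tends to \<open>0\<close>,
      whereas the points stay in the ball of radius \<open>R\<close>; hence only the points are
      selected.\<close>
    define U where "U r x \<longleftrightarrow> (\<exists>v. W r (x, v))" for r x
    have U_def': "definable {w. U (fst w) (snd w)}"
    proof -
      have "poly_map (\<lambda>w::(real \<times> 'a) \<times> 'a. (fst (fst w), (snd (fst w), snd w)))" by (intro poly_map_intros)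
      from definable_vimage[OF W_def' this]
      have "definable {w::(real \<times> 'a) \<times> 'a. W (fst (fst w)) (snd (fst w), snd w)}" by simp
      then show ?thesis unfolding U_def by (rule definable_ex)
    qed
    have U_comp: "compact {x. U r x}" for r
    proof (cases "\<exists>z. W r z")
      case True
      then obtain z where z: "W r z" by auto
      have "W r z' \<longleftrightarrow> V r z' \<and> snd z' \<bullet> snd z' \<le> snd z \<bullet> snd z" for z'
        using z unfolding W_def by (blast intro: order_trans)
      then have "{x. U r x} = fst ` {z'. V r z' \<and> snd z' \<bullet> snd z' \<le> snd z \<bullet> snd z}"
        unfolding U_def by (force simp del: split_paired_Ex)
      also have "compact \<dots>" by (intro compact_continuous_image Vc continuous_intros)
      finally show ?thesis .
    qed (auto simp: U_def)
    have U_bd: "norm x \<le> R" if "U r x" for r x using that by (auto simp: U_def W_def V_def)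
    have "\<exists>v. \<forall>t. norm (v t) \<le> b * d t \<and> quadratic_subgradient F K (X (Suc t)) (v t)"
      by (rule choice) (use sub in \<open>simp add: d_def\<close>)
    then obtain v where v: "\<And>t. norm (v t) \<le> b * d t" "\<And>t. quadratic_subgradient F K (X (Suc t)) (v t)"
      by blast
    have Vs: "V (s t) (X (Suc t), v t)" for t
      using v(2)[of t] bounded[of "Suc t"] by (simp add: V_def s_def)
    \<comment> \<open>The iterates occupy the levels \<open>s t\<close>, which are positive and tend
      to \<open>0\<close>.\<close>
    have freq: "\<exists>\<^sub>F r in at_right 0. \<exists>x. U r x"
      unfolding frequently_def
    proof
      assume ev: "eventually (\<lambda>r. \<not> (\<exists>x. U r x)) (at_right 0)"
      have "eventually (\<lambda>t. s t \<in> {0<..} \<and> s t \<noteq> 0) sequentially"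
      proof (intro always_eventually allI)
        show "s t \<in> {0<..} \<and> s t \<noteq> 0" for t using s0[of t] by simp
      qed
      then have "filterlim s (at_right 0) sequentially" using s_lim by (simp add: filterlim_at)
      from eventually_compose_filterlim[OF ev this]
      obtain t where "\<not> (\<exists>x. U (s t) x)" by (auto simp: eventually_sequentially)
      moreover obtain z where "W (s t) z" using W_ex[OF Vs[of t]] by blast
      then have "U (s t) (fst z)" unfolding U_def by (intro exI[of _ "snd z"]) simp
      ultimately show False by blast
    qed
    obtain \<delta> x \<rho> C where \<delta>: "0 < \<delta>" and xU: "\<And>r. 0 < r \<Longrightarrow> r < \<delta> \<Longrightarrow> U r (x r)"
      and \<rho>: "\<And>u r. 0 < u \<Longrightarrow> u \<le> r \<Longrightarrow> r < \<delta> \<Longrightarrow> norm (x r - x u) \<le> \<rho> r - \<rho> u"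
      and C: "\<And>r. 0 < r \<Longrightarrow> r < \<delta> \<Longrightarrow> \<bar>\<rho> r\<bar> \<le> (C::real)"
      by (rule definable_selection_monotone[OF U_def' U_comp _ freq]) (erule U_bd, rule that)
    obtain T where T: "\<And>t. t \<ge> T \<Longrightarrow> s t < \<delta>"
      using order_tendstoD(2)[OF s_lim \<delta>] by (auto simp: eventually_sequentially)
    define c where "c = b / a + K / a + 1"
    have c0: "0 \<le> c" using abK by (simp add: c_def)
    \<comment> \<open>On the level of \<open>X (Suc t)\<close> the minimal slope is at most
      \<open>norm (v t)\<close>, hence at most \<open>b * d t\<close>, while the drop to the next
      level is at least \<open>a * (d (Suc t))^2\<close>. This offset of indices yields a recursion
      from \<open>d t\<close> to \<open>d (Suc t)\<close>.\<close>
    have step: "d (Suc t) \<le> d t / 2 + c * (\<rho> (s t) - \<rho> (s (Suc t)))" if "t \<ge> T" for t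
    proof -
      define p where "p = x (s t)"
      define q where "q = x (s (Suc t))"
      define \<Delta> where "\<Delta> = \<rho> (s t) - \<rho> (s (Suc t))"
      have st: "s t < \<delta>" "s (Suc t) < \<delta>" using T that by auto
      have pq: "norm (p - q) \<le> \<Delta>" unfolding p_def q_def \<Delta>_def by (rule \<rho>[OF s0 s_dec st(1)])
      then have \<Delta>0: "0 \<le> \<Delta>" using norm_ge_zero order_trans by blast
      obtain v' where v': "W (s t) (p, v')" using xU[OF s0 st(1)] by (auto simp: U_def p_def)
      have "snd (p, v') \<bullet> snd (p, v') \<le> snd (X (Suc t), v t) \<bullet> snd (X (Suc t), v t)"
        using v' Vs[of t] unfolding W_def by blast
      then have "norm v' \<le> norm (v t)" by (simp add: norm_le)
      then have v'd: "norm v' \<le> b * d t" using v(1)[of t] by simp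
      obtain w where w: "W (s (Suc t)) (q, w)" using xU[OF s0 st(2)] by (auto simp: U_def q_def)
      have "quadratic_subgradient F K p v'" "F p = Fs + s t" "F q = Fs + s (Suc t)"
        using v' w unfolding W_def V_def by simp_all
      moreover from this(1) have "F p + v' \<bullet> (q - p) - K * ((q - p) \<bullet> (q - p)) \<le> F q"
        unfolding quadratic_subgradient_def by blast
      ultimately have "s t + v' \<bullet> (q - p) - K * (norm (q - p))^2 \<le> s (Suc t)"
        by (simp add: power2_norm_eq_inner)
      moreover have "- (v' \<bullet> (q - p)) \<le> b * d t * \<Delta>"
      proof -
        have "- (v' \<bullet> (q - p)) = v' \<bullet> (p - q)" by (simp add: inner_diff_right)
        also have "\<dots> \<le> norm v' * norm (p - q)" by (rule norm_cauchy_schwarz)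
        also have "\<dots> \<le> (b * d t) * \<Delta>" using v'd pq abK d0 by (intro mult_mono) auto
        finally show ?thesis .
      qed
      moreover have "K * (norm (q - p))^2 \<le> K * \<Delta>^2"
        using pq abK by (intro mult_left_mono power_mono) (auto simp: norm_minus_commute)
      moreover have "a * (d (Suc t))^2 \<le> s t - s (Suc t)"
        using dec[of "Suc t"] by (simp add: s_def d_def)
      ultimately have "a * (d (Suc t))^2 \<le> b * d t * \<Delta> + K * \<Delta>^2" by linarith
      then show ?thesis
        unfolding c_def \<Delta>_def[symmetric] by (intro descent_step_bound abK d0 \<Delta>0)
    qed
    have "summable (\<lambda>t. d (t + T))"
    proof (rule summable_of_halving[where r = "\<lambda>t. \<rho> (s (t + T))" and C = c and B = C])
      show "d (Suc t + T) \<le> d (t + T) / 2 + c * (\<rho> (s (t + T)) - \<rho> (s (Suc t + T)))" for t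
        using step[of "t + T"] by simp
      show "\<bar>\<rho> (s (t + T))\<bar> \<le> C" for t using C[OF s0 T] by simp
    qed (use d0 c0 in auto)
    then have "summable d" by (simp add: summable_iff_shift)
    then show ?thesis unfolding d_def[abs_def] .
  qed
qed

section \<open>Singular value decomposition\<close>

definition orthonormal_upto :: "nat \<Rightarrow> (nat \<Rightarrow> 'a::real_inner) \<Rightarrow> bool" where
  "orthonormal_upto k v \<longleftrightarrow> (\<forall>i<k. \<forall>j<k. v i \<bullet> v j = (if i = j then 1 else 0))"

lemma orthonormal_uptoD:
  assumes "orthonormal_upto k v" "i < k" "j < k"
  shows "v i \<bullet> v j = (if i = j then 1 else 0)"
  using assms unfolding orthonormal_upto_def by blast

lemma orthonormal_upto_Suc:
  assumes "orthonormal_upto k v" "norm u = 1" "\<And>j. j < k \<Longrightarrow> u \<bullet> v j = 0"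
  shows "orthonormal_upto (Suc k) (v(k := u))"
  unfolding orthonormal_upto_def
proof (intro allI impI)
  fix i j assume "i < Suc k" "j < Suc k"
  moreover have "u \<bullet> u = 1" using assms(2) by (simp add: norm_eq_1)
  ultimately show "(v(k := u)) i \<bullet> (v(k := u)) j = (if i = j then 1 else 0)"
    using orthonormal_uptoD[OF assms(1), of i j] assms(3)[of i] assms(3)[of j]
    by (cases "i = k"; cases "j = k") (simp_all add: less_Suc_eq inner_commute)
qed

lemma unit_orthogonal_exists:
  fixes v :: "nat \<Rightarrow> 'a::euclidean_space"
  assumes "k < DIM('a)"
  shows "\<exists>u. norm u = 1 \<and> (\<forall>j<k. u \<bullet> v j = 0)"
proof -
  have "dim (v ` {..<k}) \<le> card (v ` {..<k})" by (rule dim_le_card') simp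
  also have "\<dots> \<le> k" using card_image_le[of "{..<k}" v] by simp
  finally have "dim (v ` {..<k}) < DIM('a)" using assms by simp
  then obtain x where x: "x \<noteq> 0" "\<And>y. y \<in> span (v ` {..<k}) \<Longrightarrow> orthogonal x y"
    by (rule orthogonal_to_subspace_exists) blast
  have "x \<bullet> v j = 0" if "j < k" for j
    using x(2)[OF span_base, of "v j"] that by (simp add: orthogonal_def)
  then show ?thesis using x(1) by (intro exI[of _ "x /\<^sub>R norm x"]) simp
qed

text \<open>Maximality of \<open>v i\<close> on the orthogonal complement of its predecessors makes the images \<open>A (v i)\<close> pairwise
  orthogonal and their norms decreasing.\<close>

lemma greedy_orthonormal:
  fixes A :: "'a::euclidean_space \<Rightarrow> 'b::real_inner"
  assumes A: "bounded_linear A" and "k \<le> DIM('a)"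
  shows "\<exists>v. orthonormal_upto k v \<and>
    (\<forall>i<k. \<forall>u. (\<forall>j<i. u \<bullet> v j = 0) \<longrightarrow> norm (A u) \<le> norm (A (v i)) * norm u)"
  using assms(2)
proof (induction k)
  case 0
  show ?case by (simp add: orthonormal_upto_def)
next
  case (Suc k)
  then obtain v where v: "orthonormal_upto k v"
    "\<forall>i<k. \<forall>u. (\<forall>j<i. u \<bullet> v j = 0) \<longrightarrow> norm (A u) \<le> norm (A (v i)) * norm u" by auto
  define S where "S = sphere 0 1 \<inter> {u. \<forall>j<k. u \<bullet> v j = 0}"
  have "S = sphere 0 1 \<inter> (\<Inter>j<k. {u. v j \<bullet> u = 0})" by (auto simp: S_def inner_commute)
  then have "compact S" by (auto intro!: compact_Int_closed closed_INT closed_hyperplane)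
  moreover have "S \<noteq> {}" using unit_orthogonal_exists[of k v] Suc.prems by (auto simp: S_def)
  moreover have "continuous_on S (\<lambda>u. norm (A u))"
    by (intro continuous_intros bounded_linear.continuous_on[OF A])
  ultimately obtain u0 where u0: "u0 \<in> S" "\<forall>u\<in>S. norm (A u) \<le> norm (A u0)"
    using continuous_attains_sup by blast
  have max: "norm (A u) \<le> norm (A u0) * norm u" if u: "\<forall>j<k. u \<bullet> v j = 0" for u
  proof (cases "u = 0")
    case True
    then show ?thesis by (simp add: linear_0 bounded_linear.linear[OF A])
  next
    case False
    then have "u /\<^sub>R norm u \<in> S" using u by (simp add: S_def)
    then have "norm (A (u /\<^sub>R norm u)) \<le> norm (A u0)" using u0(2) by blast
    then show ?thesis
      using False by (simp add: linear_scale[OF bounded_linear.linear[OF A]] divide_simps mult.commute)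
  qed
  show ?case
  proof (intro exI[of _ "v(k := u0)"] conjI allI impI)
    show "orthonormal_upto (Suc k) (v(k := u0))"
      using u0(1) by (intro orthonormal_upto_Suc v(1)) (auto simp: S_def)
    fix i u assume i: "i < Suc k" and u: "\<forall>j<i. u \<bullet> (v(k := u0)) j = 0"
    show "norm (A u) \<le> norm (A ((v(k := u0)) i)) * norm u"
    proof (cases "i = k")
      case True
      then show ?thesis using max u by simp
    next
      case False
      then have "i < k" using i by simp
      moreover have "\<forall>j<i. u \<bullet> v j = 0" using u \<open>i < k\<close> by auto
      ultimately show ?thesis using v(2) False by simp
    qed
  qed
qed

text \<open>For small \<open>t\<close> of the sign of \<open>p\<close> the linear term would
  outweigh the quadratic one.\<close>

lemma quadratic_nonneg_imp_zero:
  fixes p q :: real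
  assumes "\<And>t. 2 * t * p \<le> t^2 * q"
  shows "p = 0"
proof (rule ccontr)
  assume "p \<noteq> 0"
  define t where "t = p / (\<bar>q\<bar> + 1)"
  have "2 * t * p \<le> t^2 * q" by (rule assms)
  moreover have "t^2 * q \<le> t^2 * (\<bar>q\<bar> + 1)" by (intro mult_left_mono) auto
  moreover have "t^2 * (\<bar>q\<bar> + 1) = t * p" by (simp add: t_def power2_eq_square)
  moreover have "t * p > 0" using \<open>p \<noteq> 0\<close> by (auto simp: t_def zero_less_mult_iff intro!: divide_pos_pos)
  ultimately show False by linarith
qed

text \<open>Right singular vectors come from successive maximisation, left ones from normalising
  their images; where the singular value is zero, or beyond \<open>DIM('a)\<close>, any orthonormal
  continuation will do.\<close>

lemma singular_vectors_exist:
  fixes A :: "'a::euclidean_space \<Rightarrow> 'b::euclidean_space"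
  assumes A: "bounded_linear A" and dims: "DIM('a) \<le> DIM('b)"
  shows "\<exists>v u s. orthonormal_upto DIM('a) v \<and> orthonormal_upto DIM('b) u \<and>
    (\<forall>k<DIM('a). A (v k) = s k *\<^sub>R u k \<and> 0 \<le> s k) \<and> (\<forall>k l. k \<le> l \<longrightarrow> l < DIM('a) \<longrightarrow> s l \<le> (s k :: real))"
proof -
  note lin = bounded_linear.linear[OF A]
  obtain v where v: "orthonormal_upto DIM('a) v"
    and max: "\<And>i u. i < DIM('a) \<Longrightarrow> \<forall>j<i. u \<bullet> v j = 0 \<Longrightarrow> norm (A u) \<le> norm (A (v i)) * norm u"
    using greedy_orthonormal[OF A order_refl] by blast
  define s where "s k = norm (A (v k))" for k
  have nv: "norm (v i) = 1" if "i < DIM('a)" for i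
    using orthonormal_uptoD[OF v that that] by (simp add: norm_eq_1)
  have mono: "s l \<le> s k" if "k \<le> l" "l < DIM('a)" for k l
    using max[of k "v l"] that orthonormal_uptoD[OF v, of l] nv[of l] by (simp add: s_def)
  have orth: "A (v i) \<bullet> A (v j) = 0" if "i < j" "j < DIM('a)" for i j
  proof (rule quadratic_nonneg_imp_zero)
    fix t :: real
    have i: "i < DIM('a)" using that by simp
    \<comment> \<open>First-order optimality: this perturbation of \<open>v i\<close> is still
      orthogonal to all predecessors, so it competes in the maximisation for every
      \<open>t\<close>.\<close>
    define u where "u = v i + t *\<^sub>R v j"
    have "\<forall>l<i. u \<bullet> v l = 0"
      using that orthonormal_uptoD[OF v] by (simp add: u_def inner_add_left)
    then have "norm (A u) \<le> norm (A (v i)) * norm u" by (rule max[OF i])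
    then have "(norm (A u))^2 \<le> (norm (A (v i)) * norm u)^2" by (intro power_mono) auto
    moreover have "(norm u)^2 = 1 + t^2"
      using that i orthonormal_uptoD[OF v] unfolding power2_norm_eq_inner u_def
      by (simp add: inner_add_left inner_add_right power2_eq_square)
    moreover have "A u = A (v i) + t *\<^sub>R A (v j)" by (simp add: u_def linear_add[OF lin] linear_scale[OF lin])
    then have "(norm (A u))^2 = (norm (A (v i)))^2 + 2 * t * (A (v i) \<bullet> A (v j)) + t^2 * (norm (A (v j)))^2"
      unfolding power2_norm_eq_inner
      by (simp add: inner_add_left inner_add_right inner_commute power2_eq_square algebra_simps)
    ultimately have "2 * t * (A (v i) \<bullet> A (v j)) + t^2 * (norm (A (v j)))^2 \<le> t^2 * (norm (A (v i)))^2"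
      by (simp add: power_mult_distrib algebra_simps)
    moreover have "0 \<le> t^2 * (norm (A (v j)))^2" by simp
    ultimately show "2 * t * (A (v i) \<bullet> A (v j)) \<le> t^2 * (norm (A (v i)))^2" by linarith
  qed
  have "\<exists>u. orthonormal_upto k u \<and> (\<forall>i<k. i < DIM('a) \<longrightarrow> A (v i) = s i *\<^sub>R u i)" if "k \<le> DIM('b)" for k
    using that
  proof (induction k)
    case 0
    show ?case by (simp add: orthonormal_upto_def)
  next
    case (Suc k)
    then obtain u where u: "orthonormal_upto k u" "\<forall>i<k. i < DIM('a) \<longrightarrow> A (v i) = s i *\<^sub>R u i" by auto
    obtain u0 where u0: "norm u0 = 1" "\<forall>j<k. u0 \<bullet> u j = 0" "k < DIM('a) \<longrightarrow> A (v k) = s k *\<^sub>R u0"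
    proof (cases "k < DIM('a) \<and> s k \<noteq> 0")
      case True
      then have sk: "0 < s k" "k < DIM('a)" by (auto simp: s_def)
      have "(A (v k) /\<^sub>R s k) \<bullet> u j = 0" if j: "j < k" for j
      proof -
        \<comment> \<open>As the values decrease, a positive \<open>s k\<close> is preceded only by
          positive ones, so that \<open>s j\<close> can be cancelled.\<close>
        have "0 < s j" using mono[of j k] j sk by simp
        have "A (v j) = s j *\<^sub>R u j" using u(2) j sk by simp
        then have "s j * (A (v k) \<bullet> u j) = A (v j) \<bullet> A (v k)" by (simp add: inner_commute)
        also have "\<dots> = 0" using orth j sk by simp
        finally show ?thesis using \<open>0 < s j\<close> by simp
      qed
      then show thesis using sk by (intro that[of "A (v k) /\<^sub>R s k"]) (simp_all add: s_def)
    next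
      case False
      obtain x where x: "norm x = 1" "\<forall>j<k. x \<bullet> u j = 0"
        using unit_orthogonal_exists[of k u] Suc.prems by auto
      show thesis by (rule that[OF x]) (use False in \<open>auto simp: s_def\<close>)
    qed
    show ?case
    proof (intro exI[of _ "u(k := u0)"] conjI allI impI)
      show "orthonormal_upto (Suc k) (u(k := u0))" using u0 by (intro orthonormal_upto_Suc u(1)) auto
      show "A (v i) = s i *\<^sub>R (u(k := u0)) i" if "i < Suc k" "i < DIM('a)" for i
        using that u(2) u0(3) by (cases "i = k") auto
    qed
  qed
  from this[OF order_refl] obtain u where "orthonormal_upto DIM('b) u"
    "\<forall>i<DIM('b). i < DIM('a) \<longrightarrow> A (v i) = s i *\<^sub>R u i" by auto
  then show ?thesis
    using v mono dims by (intro exI[of _ v] exI[of _ u] exI[of _ s]) (auto simp: s_def)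
qed

section \<open>Uniqueness of the singular values\<close>

lemma orthogonal_matrix_conj_det:
  fixes V :: "real^'n^'n"
  assumes "orthogonal_matrix V"
  shows "det (V ** A ** transpose V) = det A"
proof -
  have "det V * det (transpose V) = 1"
    using assms by (metis det_I det_mul orthogonal_matrix_def)
  then show ?thesis by (simp add: det_mul)
qed

text \<open>The left-hand side is the characteristic polynomial of \<open>transpose X ** X\<close>,
  in which the decomposition does not appear; up to order, the factors on the right therefore depend
  on \<open>X\<close> alone.\<close>

lemma singular_values_det:
  fixes X :: "real^'n^'m"
  assumes e: "inj e" and U: "orthogonal_matrix U" and V: "orthogonal_matrix V"
    and X: "X = U ** (\<chi> i j. if i = e j then s j else 0) ** transpose V"
  shows "det (mat l - transpose X ** X) = (\<Prod>j\<in>UNIV. l - (s j)\<^sup>2)"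
proof -
  define S where "S = (\<chi> i j. if i = e j then s j else 0 :: real^'n^'m)"
  define \<Lambda> where "\<Lambda> = (\<chi> i j. if i = j then (s j)\<^sup>2 else 0 :: real^'n^'n)"
  have UU: "transpose U ** U = mat 1" and VV: "V ** transpose V = mat 1"
    using U V by (auto simp: orthogonal_matrix_def)
  have SS: "transpose S ** S = \<Lambda>"
  proof -
    have "(\<Sum>r\<in>UNIV. (if r = e i then s i else 0) * (if r = e j then s j else 0)) = (if i = j then (s j)\<^sup>2 else 0)" for i j
    proof -
      have "(\<Sum>r\<in>UNIV. (if r = e i then s i else 0) * (if r = e j then s j else 0)) =
        (\<Sum>r\<in>UNIV. if r = e i then s i * (if e i = e j then s j else 0) else 0)"
        by (intro sum.cong) auto
      also have "\<dots> = s i * (if e i = e j then s j else 0)" by simp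
      finally show ?thesis using e by (auto simp: inj_def power2_eq_square)
    qed
    then show ?thesis
      by (simp add: S_def \<Lambda>_def vec_eq_iff matrix_matrix_mult_def transpose_def)
  qed
  have "transpose X ** X = V ** transpose S ** (transpose U ** U) ** S ** transpose V"
    unfolding X S_def[symmetric] by (simp add: matrix_transpose_mul matrix_mul_assoc)
  also have "\<dots> = V ** \<Lambda> ** transpose V" by (simp add: UU SS[symmetric] matrix_mul_assoc)
  finally have XX: "transpose X ** X = V ** \<Lambda> ** transpose V" .
  have "mat l = V ** mat l ** transpose V"
  proof -
    have m: "mat l = l *\<^sub>R (mat 1 :: real^'n^'n)" by (simp add: vec_eq_iff mat_def)
    have "V ** mat l ** transpose V = l *\<^sub>R (V ** transpose V)"
      by (simp add: m vec_eq_iff matrix_matrix_mult_def mat_def sum_distrib_left if_distrib if_distribR cong: if_cong)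
        (simp add: mult.commute mult.left_commute)
    then show ?thesis using VV m by simp
  qed
  moreover have "V ** (mat l - \<Lambda>) ** transpose V = V ** mat l ** transpose V - V ** \<Lambda> ** transpose V"
    by (simp add: matrix_matrix_mult_def vec_eq_iff left_diff_distrib right_diff_distrib sum_subtractf)
  ultimately have "mat l - transpose X ** X = V ** (mat l - \<Lambda>) ** transpose V" using XX by simp
  then have "det (mat l - transpose X ** X) = det (mat l - \<Lambda>)"
    by (simp add: orthogonal_matrix_conj_det[OF V])
  also have "\<dots> = (\<Prod>j\<in>UNIV. (mat l - \<Lambda>) $ j $ j)"
    by (rule det_diagonal) (simp add: \<Lambda>_def mat_def)
  also have "\<dots> = (\<Prod>j\<in>UNIV. l - (s j)\<^sup>2)" by (simp add: \<Lambda>_def mat_def)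
  finally show ?thesis .
qed

lemma mset_eq_of_prod_eq:
  fixes a b :: "'n::finite \<Rightarrow> real"
  assumes "\<And>l. (\<Prod>j\<in>UNIV. l - a j) = (\<Prod>j\<in>UNIV. l - b j)"
  shows "image_mset a (mset_set UNIV) = image_mset b (mset_set UNIV)"
proof -
  have pr: "proots (\<Prod>j\<in>UNIV. [:- c j, 1:]) = image_mset c (mset_set UNIV)" for c :: "'n \<Rightarrow> real"
  proof -
    have "proots (\<Prod>j\<in>UNIV. [:- c j, 1:]) = (\<Sum>j\<in>UNIV. {#c j#})"
      by (subst proots_prod) auto
    also have "\<dots> = image_mset c (mset_set UNIV)" by (simp add: sum_unfold_sum_mset)
    finally show ?thesis .
  qed
  have "poly (\<Prod>j\<in>UNIV. [:- a j, 1:]) = poly (\<Prod>j\<in>UNIV. [:- b j, 1:])"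
    using assms by (auto simp: poly_prod)
  then have "(\<Prod>j\<in>UNIV. [:- a j, 1:]) = (\<Prod>j\<in>UNIV. [:- b j, 1:])" by (simp only: poly_eq_poly_eq_iff)
  then show ?thesis using pr by metis
qed

text \<open>Two decompositions have the same multiset of squares by the determinant formula, and
  nonnegativity allows square roots to be taken; this gives the definite description its
  meaning.\<close>

lemma sing_vals_mset_eq:
  fixes X :: "real^'n^'m"
  assumes "inj e" "orthogonal_matrix U" "orthogonal_matrix V" "\<And>j. 0 \<le> s j"
    and "X = U ** (\<chi> i j. if i = e j then s j else 0) ** transpose V"
  shows "sing_vals_mset X = image_mset s (mset_set UNIV)"
  unfolding sing_vals_mset_def
proof (rule the_equality)
  fix M assume "\<exists>s e U V. M = image_mset s (mset_set UNIV) \<and> (\<forall>j. 0 \<le> s j) \<and> inj e \<and>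
    orthogonal_matrix U \<and> orthogonal_matrix V \<and>
    X = U ** (\<chi> i j. if i = e j then s j else 0) ** transpose V"
  then obtain s' e' U' V' where M: "M = image_mset s' (mset_set UNIV)" and s': "\<And>j. 0 \<le> s' j"
    and dec: "inj e'" "orthogonal_matrix U'" "orthogonal_matrix V'"
    "X = U' ** (\<chi> i j. if i = e' j then s' j else 0) ** transpose V'"
    by blast
  have "image_mset (\<lambda>j. (s' j)\<^sup>2) (mset_set UNIV) = image_mset (\<lambda>j. (s j)\<^sup>2) (mset_set UNIV)"
    using singular_values_det[OF dec] singular_values_det[OF assms(1-3,5)]
    by (intro mset_eq_of_prod_eq) metis
  then have "image_mset sqrt (image_mset (\<lambda>j. (s' j)\<^sup>2) (mset_set UNIV)) =
      image_mset sqrt (image_mset (\<lambda>j. (s j)\<^sup>2) (mset_set UNIV))" by simp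
  then show "M = image_mset s (mset_set UNIV)"
    using s' assms(4) by (simp add: M image_mset.compositionality comp_def)
qed (use assms in blast)

text \<open>An entry of \<open>transpose U ** (X ** V)\<close>, expanded into sums so that
  polynomiality and continuity are visible.\<close>

definition svd_entry :: "real^'n^'m \<Rightarrow> real^'m^'m \<Rightarrow> real^'n^'n \<Rightarrow> 'm \<Rightarrow> 'n \<Rightarrow> real" where
  "svd_entry X U V i j = (\<Sum>r\<in>UNIV. U $ r $ i * (\<Sum>c\<in>UNIV. X $ r $ c * V $ c $ j))"

lemma svd_entry_eq: "svd_entry X U V i j = (transpose U ** (X ** V)) $ i $ j"
  by (simp add: svd_entry_def matrix_matrix_mult_def transpose_def)

lemma svd_entry_column: "svd_entry X U V i j = column i U \<bullet> (X *v column j V)"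
  by (simp add: svd_entry_def inner_vec_def matrix_vector_mult_def column_def)

text \<open>The columns \<open>b 0, b 1, \<dots>\<close> are matched with the rows \<open>c 0, c 1, \<dots>\<close>, and the singular values appear in
  decreasing order along this enumeration.\<close>

definition is_svd :: "(nat \<Rightarrow> 'n) \<Rightarrow> (nat \<Rightarrow> 'm) \<Rightarrow> real^'n^'m \<Rightarrow> real^'m^'m \<Rightarrow> real^'n^'n \<Rightarrow> bool" where
  "is_svd b c X U V \<longleftrightarrow>
     (\<forall>i j. (\<Sum>r\<in>UNIV. U $ r $ i * U $ r $ j) = (if i = j then 1 else 0)) \<and>
     (\<forall>i j. (\<Sum>r\<in>UNIV. V $ r $ i * V $ r $ j) = (if i = j then 1 else 0)) \<and>
     (\<forall>k<CARD('n). \<forall>l<CARD('m). l \<noteq> k \<longrightarrow> svd_entry X U V (c l) (b k) = 0) \<and>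
     (\<forall>k<CARD('n). 0 \<le> svd_entry X U V (c k) (b k)) \<and>
     (\<forall>k<CARD('n). \<forall>l<CARD('n). k \<le> l \<longrightarrow> svd_entry X U V (c l) (b l) \<le> svd_entry X U V (c k) (b k))"

lemma orthogonal_matrix_iff_sums:
  fixes U :: "real^'m^'m"
  shows "orthogonal_matrix U \<longleftrightarrow>
    (\<forall>i j. (\<Sum>r\<in>UNIV. U $ r $ i * U $ r $ j) = (if i = j then 1 else 0))"
  by (simp add: orthogonal_matrix vec_eq_iff matrix_matrix_mult_def transpose_def mat_def)

lemma is_svd_exists:
  fixes X :: "real^'n^'m"
  assumes mn: "CARD('n) \<le> CARD('m)" and b: "bij_betw b {..<CARD('n)} (UNIV :: 'n set)"
    and c: "bij_betw c {..<CARD('m)} (UNIV :: 'm set)"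
  shows "\<exists>U V. is_svd b c X U V"
proof -
  obtain v u s where v: "orthonormal_upto CARD('n) v" and u: "orthonormal_upto CARD('m) u"
    and A: "\<And>k. k < CARD('n) \<Longrightarrow> X *v v k = s k *\<^sub>R u k \<and> 0 \<le> s k"
    and s: "\<And>k l. k \<le> l \<Longrightarrow> l < CARD('n) \<Longrightarrow> s l \<le> (s k :: real)"
    using singular_vectors_exist[OF matrix_vector_mul_bounded_linear[of X]] mn by auto
  define ib where "ib = inv_into {..<CARD('n)} b"
  define ic where "ic = inv_into {..<CARD('m)} c"
  have ib: "ib (b k) = k" if "k < CARD('n)" for k
    unfolding ib_def using b that by (simp add: bij_betw_def inv_into_f_f)
  have ic: "ic (c k) = k" if "k < CARD('m)" for k
    unfolding ic_def using c that by (simp add: bij_betw_def inv_into_f_f)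
  have ibr: "ib j < CARD('n)" "b (ib j) = j" for j
    unfolding ib_def using b inv_into_into[of j b "{..<CARD('n)}"] f_inv_into_f[of j b "{..<CARD('n)}"]
    by (auto simp: bij_betw_def)
  have icr: "ic j < CARD('m)" "c (ic j) = j" for j
    unfolding ic_def using c inv_into_into[of j c "{..<CARD('m)}"] f_inv_into_f[of j c "{..<CARD('m)}"]
    by (auto simp: bij_betw_def)
  define U :: "real^'m^'m" where "U = (\<chi> i j. u (ic j) $ i)"
  define V :: "real^'n^'n" where "V = (\<chi> i j. v (ib j) $ i)"
  have cU: "column j U = u (ic j)" for j by (simp add: U_def column_def vec_eq_iff)
  have cV: "column j V = v (ib j)" for j by (simp add: V_def column_def vec_eq_iff)
  have ent: "svd_entry X U V (c l) (b k) = (if l = k then s k else 0)" if "l < CARD('m)" "k < CARD('n)" for l k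
  proof -
    have k: "k < CARD('m)" using that(2) mn by simp
    have "svd_entry X U V (c l) (b k) = u l \<bullet> (s k *\<^sub>R u k)"
      by (simp add: svd_entry_column cU cV ib ic that A)
    then show ?thesis using orthonormal_uptoD[OF u that(1) k] by simp
  qed
  have "(\<Sum>r\<in>UNIV. U $ r $ i * U $ r $ j) = (if i = j then 1 else 0)" for i j
  proof -
    have "(\<Sum>r\<in>UNIV. U $ r $ i * U $ r $ j) = u (ic i) \<bullet> u (ic j)" by (simp add: U_def inner_vec_def)
    then show ?thesis using orthonormal_uptoD[OF u icr(1) icr(1), of i j] icr(2) by metis
  qed
  moreover have "(\<Sum>r\<in>UNIV. V $ r $ i * V $ r $ j) = (if i = j then 1 else 0)" for i j
  proof -
    have "(\<Sum>r\<in>UNIV. V $ r $ i * V $ r $ j) = v (ib i) \<bullet> v (ib j)" by (simp add: V_def inner_vec_def)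
    then show ?thesis using orthonormal_uptoD[OF v ibr(1) ibr(1), of i j] ibr(2) by metis
  qed
  ultimately have "is_svd b c X U V"
    unfolding is_svd_def using ent A s mn by simp
  then show ?thesis by blast
qed

text \<open>The embedding required by \<open>sing_vals_mset\<close> sends column \<open>b k\<close>
  to row \<open>c k\<close>. Along this enumeration the entries already decrease, so sorting merely
  reverses them and \<open>sigma\<close> reverses back.\<close>

lemma sigma_svd:
  fixes X :: "real^'n^'m"
  assumes mn: "CARD('n) \<le> CARD('m)" and b: "bij_betw b {..<CARD('n)} (UNIV :: 'n set)"
    and c: "bij_betw c {..<CARD('m)} (UNIV :: 'm set)" and svd: "is_svd b c X U V" and k: "k < CARD('n)"
  shows "sigma X k = svd_entry X U V (c k) (b k)"
proof -
  define ib where "ib = inv_into {..<CARD('n)} b"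
  have ib: "ib (b k) = k" if "k < CARD('n)" for k
    unfolding ib_def using b that by (simp add: bij_betw_def inv_into_f_f)
  have ibr: "ib j < CARD('n)" "b (ib j) = j" for j
    unfolding ib_def using b inv_into_into[of j b "{..<CARD('n)}"] f_inv_into_f[of j b "{..<CARD('n)}"]
    by (auto simp: bij_betw_def)
  have cinj: "c k = c l \<longleftrightarrow> k = l" if "k < CARD('m)" "l < CARD('m)" for k l
    using c that by (auto simp: bij_betw_def inj_on_def)
  define e where "e j = c (ib j)" for j
  define s where "s j = svd_entry X U V (e j) j" for j
  have e: "inj e"
  proof (rule injI)
    fix i j assume "e i = e j"
    moreover have "ib i < CARD('m)" "ib j < CARD('m)"
      using ibr(1)[of i] ibr(1)[of j] mn by simp_all
    ultimately have "ib i = ib j" using cinj by (simp add: e_def)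
    then show "i = j" using ibr(2) by metis
  qed
  have U: "orthogonal_matrix U" and V: "orthogonal_matrix V"
    using svd by (auto simp: is_svd_def orthogonal_matrix_iff_sums)
  have s0: "0 \<le> s j" for j
    using svd ibr(1)[of j] ibr(2)[of j] unfolding is_svd_def s_def e_def by metis
  have ent: "svd_entry X U V i j = (if i = e j then s j else 0)" for i j
  proof (cases "i = e j")
    case False
    obtain l where l: "l < CARD('m)" "i = c l" using c by (auto simp: bij_betw_def)
    have "l \<noteq> ib j" using False l by (auto simp: e_def)
    then have "svd_entry X U V (c l) (b (ib j)) = 0" using svd l ibr(1)[of j] unfolding is_svd_def by blast
    then show ?thesis using False l ibr(2) by simp
  qed (simp add: s_def)
  have "transpose U ** (X ** V) = (\<chi> i j. if i = e j then s j else 0)"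
    by (simp add: vec_eq_iff ent flip: svd_entry_eq)
  then have "U ** (\<chi> i j. if i = e j then s j else 0) ** transpose V = U ** (transpose U ** (X ** V)) ** transpose V"
    by simp
  also have "\<dots> = (U ** transpose U) ** X ** (V ** transpose V)" by (simp add: matrix_mul_assoc)
  also have "\<dots> = X" using U V by (simp add: orthogonal_matrix_def)
  finally have X: "X = U ** (\<chi> i j. if i = e j then s j else 0) ** transpose V" by simp
  define xs where "xs = map (\<lambda>k. s (b k)) [0..<CARD('n)]"
  have sb: "s (b k) = svd_entry X U V (c k) (b k)" if "k < CARD('n)" for k
    using that by (simp add: s_def e_def ib)
  have "sing_vals_mset X = image_mset s (mset_set (b ` {..<CARD('n)}))"
    using b sing_vals_mset_eq[OF e U V s0 X] by (simp add: bij_betw_def)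
  also have "mset_set (b ` {..<CARD('n)}) = image_mset b (mset_set {..<CARD('n)})"
    using b by (simp add: bij_betw_def image_mset_mset_set)
  also have "image_mset s \<dots> = mset xs"
    by (simp add: xs_def image_mset.compositionality comp_def lessThan_atLeast0 flip: mset_upt)
  finally have "sorted_list_of_multiset (sing_vals_mset X) = sort xs" by simp
  also have "\<dots> = rev xs"
  proof (rule properties_for_sort)
    have "sorted_wrt (\<ge>) xs"
      unfolding xs_def sorted_wrt_map
    proof (rule sorted_wrt_mono_rel[of _ "(<)"])
      fix k l assume "k \<in> set [0..<CARD('n)]" "l \<in> set [0..<CARD('n)]" "k < l"
      then show "s (b l) \<le> s (b k)" using svd sb unfolding is_svd_def by simp
    qed simp
    then show "sorted (rev xs)" by (simp add: sorted_wrt_rev)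
  qed simp
  finally have "sigma X k = xs ! k" by (simp add: sigma_def)
  then show ?thesis using k sb by (simp add: xs_def)
qed

lemma wnn_svd:
  fixes X :: "real^'n^'m"
  assumes mn: "CARD('n) \<le> CARD('m)" and b: "bij_betw b {..<CARD('n)} (UNIV :: 'n set)"
    and c: "bij_betw c {..<CARD('m)} (UNIV :: 'm set)" and svd: "is_svd b c X U V"
  shows "wnn w X = (\<Sum>k<CARD('n). w k * svd_entry X U V (c k) (b k))"
  unfolding wnn_def
proof (rule sum.cong)
  fix k assume "k \<in> {..<CARD('n)}"
  then have k: "k < CARD('n)" by simp
  then have "0 \<le> svd_entry X U V (c k) (b k)" using svd by (simp add: is_svd_def)
  then show "w k * \<bar>sigma X k\<bar> = w k * svd_entry X U V (c k) (b k)"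
    using sigma_svd[OF mn b c svd k] by simp
qed simp

section \<open>Definability and continuity of the weighted nuclear norm\<close>

lemma orthogonal_matrix_norm_le:
  fixes U :: "real^'m^'m"
  assumes "orthogonal_matrix U"
  shows "norm U \<le> CARD('m)"
proof -
  have "norm (U $ i) = 1" for i
    using assms by (simp add: orthogonal_matrix_orthonormal_rows row_def)
  then have "(\<Sum>i\<in>UNIV. norm (U $ i)) = CARD('m)" by simp
  moreover have "norm U \<le> (\<Sum>i\<in>UNIV. norm (U $ i))"
    unfolding norm_vec_def[of U] by (intro L2_set_le_sum) simp
  ultimately show ?thesis by simp
qed

lemma enumeration_exists: "\<exists>b. bij_betw b {..<CARD('n)} (UNIV :: 'n::finite set)"
  using ex_bij_betw_nat_finite[of "UNIV :: 'n set"] by (simp add: lessThan_atLeast0)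

lemma poly_map_vec_nth: "poly_map f \<Longrightarrow> poly_map (\<lambda>x. f x $ i)"
  by (rule poly_map_linear[OF bounded_linear_vec_nth])

lemma poly_map_svd_entry:
  assumes "poly_map X" "poly_map U" "poly_map V"
  shows "poly_map (\<lambda>z. svd_entry (X z) (U z) (V z) i j)"
  unfolding svd_entry_def by (intro poly_map_sum poly_map_mult poly_map_vec_nth assms)

lemma continuous_on_svd_entry:
  assumes "continuous_on S X" "continuous_on S U" "continuous_on S V"
  shows "continuous_on S (\<lambda>z. svd_entry (X z) (U z) (V z) i j)"
  unfolding svd_entry_def by (intro continuous_intros assms)

lemma definable_is_svd:
  fixes b :: "nat \<Rightarrow> 'n::finite" and c :: "nat \<Rightarrow> 'm::finite"
  assumes "poly_map X" "poly_map U" "poly_map V"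
  shows "definable {z. is_svd b c (X z) (U z) (V z)}"
proof -
  have orth: "definable {z. \<forall>i\<in>UNIV. \<forall>j\<in>UNIV. (\<Sum>r\<in>UNIV. M z $ r $ i * M z $ r $ j) = (if i = j then 1 else 0)}"
    if "poly_map M" for M :: "'a \<Rightarrow> real^'k^'k"
    by (intro definable_finite_conj definable_eq poly_map_sum poly_map_mult poly_map_vec_nth poly_map_const that) auto
  have "definable {z. \<forall>k\<in>{..<CARD('n)}. \<forall>l\<in>{..<CARD('m)}. l \<noteq> k \<longrightarrow> svd_entry (X z) (U z) (V z) (c l) (b k) = 0}"
    by (intro definable_finite_conj definable_imp definable_const definable_eq poly_map_svd_entry poly_map_const assms) auto
  moreover have "definable {z. \<forall>k\<in>{..<CARD('n)}. 0 \<le> svd_entry (X z) (U z) (V z) (c k) (b k)}"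
    by (intro definable_finite_conj definable_le poly_map_svd_entry poly_map_const assms) auto
  moreover have "definable {z. \<forall>k\<in>{..<CARD('n)}. \<forall>l\<in>{..<CARD('n)}. k \<le> l \<longrightarrow>
      svd_entry (X z) (U z) (V z) (c l) (b l) \<le> svd_entry (X z) (U z) (V z) (c k) (b k)}"
    by (intro definable_finite_conj definable_imp definable_const definable_le poly_map_svd_entry assms) auto
  ultimately have "definable {z.
      (\<forall>i\<in>UNIV. \<forall>j\<in>UNIV. (\<Sum>r\<in>UNIV. U z $ r $ i * U z $ r $ j) = (if i = j then 1 else 0)) \<and>
      (\<forall>i\<in>UNIV. \<forall>j\<in>UNIV. (\<Sum>r\<in>UNIV. V z $ r $ i * V z $ r $ j) = (if i = j then 1 else 0)) \<and>
      (\<forall>k\<in>{..<CARD('n)}. \<forall>l\<in>{..<CARD('m)}. l \<noteq> k \<longrightarrow> svd_entry (X z) (U z) (V z) (c l) (b k) = 0) \<and>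
      (\<forall>k\<in>{..<CARD('n)}. 0 \<le> svd_entry (X z) (U z) (V z) (c k) (b k)) \<and>
      (\<forall>k\<in>{..<CARD('n)}. \<forall>l\<in>{..<CARD('n)}. k \<le> l \<longrightarrow>
        svd_entry (X z) (U z) (V z) (c l) (b l) \<le> svd_entry (X z) (U z) (V z) (c k) (b k))}"
    by (intro definable_conj orth assms)
  then show ?thesis by (simp add: is_svd_def Ball_def)
qed

text \<open>Quantifying over the decomposition describes the graph, since every decomposition yields
  the same value.\<close>

lemma definable_wnn:
  assumes mn: "CARD('n::finite) \<le> CARD('m::finite)"
  shows "definable {z::(real^'n^'m) \<times> real. snd z = wnn w (fst z)}"
proof -
  obtain b where b: "bij_betw b {..<CARD('n)} (UNIV :: 'n set)" using enumeration_exists by blast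
  obtain c where c: "bij_betw c {..<CARD('m)} (UNIV :: 'm set)" using enumeration_exists by blast
  have "definable {z::(real^'n^'m) \<times> real. \<exists>U::real^'m^'m. \<exists>V::real^'n^'n. is_svd b c (fst z) U V \<and>
    snd z = (\<Sum>k<CARD('n). w k * svd_entry (fst z) U V (c k) (b k))}"
    by (intro definable_ex definable_conj definable_is_svd definable_eq poly_map_sum poly_map_mult
        poly_map_svd_entry poly_map_intros)
  also have "{z::(real^'n^'m) \<times> real. \<exists>U::real^'m^'m. \<exists>V::real^'n^'n. is_svd b c (fst z) U V \<and>
    snd z = (\<Sum>k<CARD('n). w k * svd_entry (fst z) U V (c k) (b k))} = {z. snd z = wnn w (fst z)}"
    using wnn_svd[OF mn b c] is_svd_exists[OF mn b c] by (auto simp: set_eq_iff) metis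
  finally show ?thesis .
qed

text \<open>Decompositions of matrices in a ball form a compact set, and the graph over the ball is
  a continuous image of it. A closed graph in a compact target gives continuity.\<close>

lemma continuous_on_wnn:
  assumes mn: "CARD('n::finite) \<le> CARD('m::finite)"
  shows "continuous_on UNIV (wnn w :: real^'n^'m \<Rightarrow> real)"
proof -
  obtain b where b: "bij_betw b {..<CARD('n)} (UNIV :: 'n set)" using enumeration_exists by blast
  obtain c where c: "bij_betw c {..<CARD('m)} (UNIV :: 'm set)" using enumeration_exists by blast
  have "continuous_on (ball 0 r) (wnn w :: real^'n^'m \<Rightarrow> real)" for r
  proof -
    define K where "K = {z :: (real^'n^'m) \<times> (real^'m^'m) \<times> (real^'n^'n).
      norm (fst z) \<le> r \<and> is_svd b c (fst z) (fst (snd z)) (snd (snd z))}"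
    define val where "val z = (\<Sum>k<CARD('n). w k * svd_entry (fst z) (fst (snd z)) (snd (snd z)) (c k) (b k))"
      for z :: "(real^'n^'m) \<times> (real^'m^'m) \<times> (real^'n^'n)"
    have "closed K"
      unfolding K_def is_svd_def
      by (intro closed_Collect_conj closed_Collect_all closed_Collect_imp closed_Collect_eq closed_Collect_le
          continuous_intros continuous_on_svd_entry open_Collect_const)
    moreover have "K \<subseteq> cball 0 r \<times> cball 0 CARD('m) \<times> cball 0 CARD('n)"
      using orthogonal_matrix_norm_le[where 'm='m] orthogonal_matrix_norm_le[where 'm='n] unfolding K_def is_svd_def orthogonal_matrix_iff_sums[symmetric]
      by (auto simp: mem_Times_iff)
    then have "bounded K" by (rule bounded_subset[rotated]) (intro bounded_Times bounded_cball)
    ultimately have K: "compact K" by (simp add: compact_eq_bounded_closed)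
    have cval: "continuous_on K val"
      unfolding val_def by (intro continuous_intros continuous_on_svd_entry)
    have wv: "wnn w (fst z) = val z" if "z \<in> K" for z
      using that wnn_svd[OF mn b c] by (simp add: K_def val_def)
    have onto: "\<exists>z\<in>K. fst z = Y" if "Y \<in> cball 0 r" for Y
    proof -
      obtain U V where "is_svd b c Y U V" using is_svd_exists[OF mn b c] by blast
      then show ?thesis using that by (intro bexI[of _ "(Y, U, V)"]) (auto simp: K_def)
    qed
    have "continuous_on (cball 0 r) (wnn w :: real^'n^'m \<Rightarrow> real)"
    proof (rule continuous_from_closed_graph[of "val ` K"])
      show "compact (val ` K)" using cval K by (rule compact_continuous_image)
      have "wnn w Y \<in> val ` K" if Y: "Y \<in> cball 0 r" for Y :: "real^'n^'m"
      proof -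
        obtain z where "z \<in> K" "fst z = Y" using onto[OF Y] by blast
        then show ?thesis using wv[of z] by force
      qed
      then show "wnn w \<in> (cball 0 r :: (real^'n^'m) set) \<rightarrow> val ` K" by simp
      have "(\<lambda>Y::real^'n^'m. (Y, wnn w Y)) ` cball 0 r = (\<lambda>z. (fst z, val z)) ` K"
      proof (intro set_eqI iffI)
        fix p assume "p \<in> (\<lambda>Y::real^'n^'m. (Y, wnn w Y)) ` cball 0 r"
        then obtain Y where Y: "Y \<in> cball 0 r" "p = (Y, wnn w Y)" by blast
        then obtain z where "z \<in> K" "fst z = Y" using onto by blast
        then show "p \<in> (\<lambda>z. (fst z, val z)) ` K" using Y wv[of z] by force
      next
        fix p assume "p \<in> (\<lambda>z. (fst z, val z)) ` K"
        then obtain z where z: "z \<in> K" "p = (fst z, val z)" by blast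
        then have "fst z \<in> cball 0 r" by (simp add: K_def)
        then show "p \<in> (\<lambda>Y::real^'n^'m. (Y, wnn w Y)) ` cball 0 r" using z wv[of z] by force
      qed
      moreover have "compact ((\<lambda>z. (fst z, val z)) ` K)"
        by (intro compact_continuous_image continuous_on_Pair cval K continuous_intros)
      ultimately show "closed ((\<lambda>Y::real^'n^'m. (Y, wnn w Y)) ` cball 0 r)" by (simp add: compact_imp_closed)
    qed
    then show ?thesis by (rule continuous_on_subset) auto
  qed
  then have "isCont (wnn w) Y" for Y :: "real^'n^'m"
    using continuous_on_eq_continuous_at[of "ball 0 (norm Y + 1)"] by (metis open_ball dist_0_norm less_add_one mem_ball)
  then show ?thesis by (simp add: continuous_on_eq_continuous_at)
qed

section \<open>Convergence of proximal gradient descent\<close>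

text \<open>The descent lemma: \<open>h\<close> subtracts the linear and quadratic terms from
  \<open>f\<close> along the segment, and the Lipschitz bound makes its derivative
  nonpositive.\<close>

lemma lipschitz_gradient_upper:
  fixes f :: "'a::real_inner \<Rightarrow> real"
  assumes grad: "\<And>y. (f has_derivative (\<lambda>h. gradf y \<bullet> h)) (at y)"
    and lip: "\<And>y z. norm (gradf y - gradf z) \<le> L * norm (y - z)"
  shows "f (x + d) \<le> f x + gradf x \<bullet> d + L / 2 * (norm d)\<^sup>2"
proof -
  define h where "h t = f (x + t *\<^sub>R d) - t * (gradf x \<bullet> d) - L / 2 * (norm d)\<^sup>2 * t\<^sup>2" for t
  have deriv: "(h has_real_derivative (gradf (x + t *\<^sub>R d) - gradf x) \<bullet> d - L * (norm d)\<^sup>2 * t) (at t)" for t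
  proof -
    have "((\<lambda>t. f (x + t *\<^sub>R d)) has_derivative (\<lambda>s. gradf (x + t *\<^sub>R d) \<bullet> (s *\<^sub>R d))) (at t)"
      by (rule has_derivative_compose[OF _ grad]) (auto intro!: derivative_eq_intros)
    then have "((\<lambda>t. f (x + t *\<^sub>R d)) has_real_derivative gradf (x + t *\<^sub>R d) \<bullet> d) (at t)"
      by (simp add: has_field_derivative_def mult_commute_abs)
    then show ?thesis
      unfolding h_def by (auto intro!: derivative_eq_intros simp: inner_diff_left)
  qed
  have "h 1 \<le> h 0"
  proof (rule DERIV_nonpos_imp_nonincreasing[of 0 1 h])
    fix t :: real assume t: "0 \<le> t" "t \<le> 1"
    have "(gradf (x + t *\<^sub>R d) - gradf x) \<bullet> d \<le> norm (gradf (x + t *\<^sub>R d) - gradf x) * norm d"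
      by (rule norm_cauchy_schwarz)
    also have "\<dots> \<le> (L * norm (t *\<^sub>R d)) * norm d"
      using lip[of "x + t *\<^sub>R d" x] by (intro mult_right_mono) auto
    also have "\<dots> = L * (norm d)\<^sup>2 * t" using t by (simp add: power2_eq_square)
    finally show "\<exists>y. (h has_real_derivative y) (at t) \<and> y \<le> 0" using deriv[of t] by (intro exI) auto
  qed simp
  then show ?thesis by (simp add: h_def)
qed

lemma lipschitz_gradient_lower:
  fixes f :: "'a::real_inner \<Rightarrow> real"
  assumes grad: "\<And>y. (f has_derivative (\<lambda>h. gradf y \<bullet> h)) (at y)"
    and lip: "\<And>y z. norm (gradf y - gradf z) \<le> L * norm (y - z)"
  shows "f x + gradf x \<bullet> d - L / 2 * (norm d)\<^sup>2 \<le> f (x + d)"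
proof -
  have "((\<lambda>y. - f y) has_derivative (\<lambda>h. - gradf y \<bullet> h)) (at y)" for y
    using has_derivative_minus[OF grad[of y]] by simp
  moreover have "norm (- gradf y - - gradf z) \<le> L * norm (y - z)" for y z
    using lip[of y z] by (simp add: norm_minus_commute)
  ultimately have "- f (x + d) \<le> - f x + - gradf x \<bullet> d + L / 2 * (norm d)\<^sup>2"
    by (rule lipschitz_gradient_upper)
  then show ?thesis by simp
qed

text \<open>Minimality is tested at \<open>y\<close> and the squares are expanded around
  \<open>x\<close>. As \<open>g\<close> is not assumed convex, the quadratic term stays, with
  coefficient \<open>1 / (2 * \<mu>)\<close>.\<close>

lemma prox_subgradient:
  fixes g :: "'a::real_inner \<Rightarrow> real"
  assumes "0 < \<mu>" "x \<in> prox g \<mu> m"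
  shows "g x + (1 / \<mu>) * ((m - x) \<bullet> (y - x)) - 1 / (2 * \<mu>) * (norm (y - x))\<^sup>2 \<le> g y"
proof -
  have "(1/2) * (norm (x - m))\<^sup>2 + \<mu> * g x \<le> (1/2) * (norm (y - m))\<^sup>2 + \<mu> * g y"
    using assms(2) by (simp add: prox_def)
  moreover have "(norm (y - m))\<^sup>2 = (norm (y - x))\<^sup>2 - 2 * ((m - x) \<bullet> (y - x)) + (norm (x - m))\<^sup>2"
    unfolding power2_norm_eq_inner
    by (simp add: inner_diff_left inner_diff_right inner_commute algebra_simps)
  ultimately have "\<mu> * g x + ((m - x) \<bullet> (y - x)) - (1/2) * (norm (y - x))\<^sup>2 \<le> \<mu> * g y" by argo
  then have "(\<mu> * g x + ((m - x) \<bullet> (y - x)) - (1/2) * (norm (y - x))\<^sup>2) / \<mu> \<le> (\<mu> * g y) / \<mu>"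
    using assms(1) by (intro divide_right_mono) auto
  then show ?thesis using assms(1) by (simp add: diff_divide_distrib add_divide_distrib)
qed

text \<open>Divided by \<open>norm z\<close>, the quadratic error tends to zero.\<close>

lemma quadratic_subgradient_imp_regular:
  fixes F :: "'a::euclidean_space \<Rightarrow> real"
  assumes "quadratic_subgradient F K x v"
  shows "v \<in> reg_subdiff F x"
proof -
  have ev: "eventually (\<lambda>z. ereal (- (K * norm z)) \<le> ereal ((F (x + z) - F x - v \<bullet> z) / norm z)) (at 0)"
  unfolding eventually_at_filter
  proof (intro always_eventually allI impI)
    fix z :: 'a assume "z \<noteq> 0"
    have "F x + v \<bullet> z - K * (z \<bullet> z) \<le> F (x + z)"
      using assms unfolding quadratic_subgradient_def by (metis add_diff_cancel_left')
    then have "- (K * norm z) * norm z \<le> F (x + z) - F x - v \<bullet> z"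
      by (simp add: dot_square_norm power2_eq_square)
    then show "ereal (- (K * norm z)) \<le> ereal ((F (x + z) - F x - v \<bullet> z) / norm z)"
      using \<open>z \<noteq> 0\<close> by (simp add: pos_le_divide_eq)
  qed
  have "((\<lambda>z::'a. - (K * norm z)) \<longlongrightarrow> - (K * norm (0::'a))) (at 0)" by (intro tendsto_intros)
  then have "((\<lambda>z::'a. ereal (- (K * norm z))) \<longlongrightarrow> 0) (at 0)" by (simp add: zero_ereal_def)
  then have "Liminf (at 0) (\<lambda>z::'a. ereal (- (K * norm z))) = 0"
    by (rule lim_imp_Liminf[rotated]) simp
  then show ?thesis unfolding reg_subdiff_def using Liminf_mono[OF ev] by simp
qed

theorem theorem1:
  fixes f :: "real^'n^'m \<Rightarrow> real"
    and gradf :: "real^'n^'m \<Rightarrow> real^'n^'m"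
    and w :: "nat \<Rightarrow> real"
    and L \<mu> :: real
    and X :: "nat \<Rightarrow> real^'n^'m"
  assumes mn: "CARD('n) \<le> CARD('m)"
    and bdd_below: "\<exists>c. \<forall>Y. c \<le> f Y"
    and semialg: "semialgebraic_fun f"
    and coercive: "filterlim f at_top at_infinity"
    and grad: "\<And>Y. (f has_derivative (\<lambda>H. gradf Y \<bullet> H)) (at Y)"
    and L_pos: "0 < L"
    and lipschitz: "\<And>Y Z. norm (gradf Y - gradf Z) \<le> L * norm (Y - Z)"
    and w_pos: "0 < w 0"
    and w_mono: "\<And>i j. i \<le> j \<Longrightarrow> j < CARD('n) \<Longrightarrow> w i \<le> w j"
    and mu: "0 < \<mu>" "\<mu> < 1 / L"
    and X0: "X 0 = 0"
    and step: "\<And>t. X (Suc t) \<in> prox (wnn w) \<mu> (X t - \<mu> *\<^sub>R gradf (X t))"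
    and bounded: "bounded (range X)"
  shows "summable (\<lambda>t. norm (X (Suc t) - X t)) \<and>
         (\<exists>Xs. X \<longlonglongrightarrow> Xs \<and> 0 \<in> lim_subdiff (\<lambda>Y. f Y + wnn w Y) Xs)"
proof -
  define F where "F = (\<lambda>Y. f Y + wnn w Y)"
  \<comment> \<open>\<open>a\<close> is what the prox term \<open>1 / (2 * \<mu>)\<close> leaves
    after the Taylor error \<open>L / 2\<close> of \<open>f\<close>, positive because
    \<open>\<mu> < 1 / L\<close>; in \<open>K\<close> the two add up as errors; \<open>B\<close>
    collects the displacement divided by \<open>\<mu>\<close> and the change of gradient.\<close>
  define a where "a = 1 / (2 * \<mu>) - L / 2"
  define K where "K = 1 / (2 * \<mu>) + L / 2"
  define B where "B = 1 / \<mu> + L"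
  have "L * \<mu> < 1" using mu(2) L_pos by (simp add: pos_less_divide_eq mult.commute)
  then have a: "0 < a" using mu(1) by (simp add: a_def field_simps)
  have K: "0 \<le> K" and B: "0 \<le> B" using mu(1) L_pos by (simp_all add: K_def B_def)
  have F_def': "definable {z. snd z = F (fst z)}"
  proof -
    have "{(x, f x) |x. True} = {z. snd z = f (fst z)}" by force
    then have "definable {z. snd z = f (fst z)}"
      using semialgebraic_imp_definable semialg unfolding semialgebraic_fun_def by metis
    moreover have "poly_map (\<lambda>w::((real^'n^'m) \<times> real) \<times> real. (fst (fst w), snd w))"
      by (intro poly_map_intros)
    ultimately have "definable {w::((real^'n^'m) \<times> real) \<times> real. (fst (fst w), snd w) \<in> {z. snd z = f (fst z)}}"
      by (rule definable_vimage)
    then have 1: "definable {w::((real^'n^'m) \<times> real) \<times> real. snd w = f (fst (fst w))}" by simp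
    have "poly_map (\<lambda>w::((real^'n^'m) \<times> real) \<times> real. (fst (fst w), snd (fst w) - snd w))"
      by (intro poly_map_intros)
    from definable_vimage[OF definable_wnn[OF mn, of w] this]
    have 2: "definable {v::((real^'n^'m) \<times> real) \<times> real. snd (fst v) - snd v = wnn w (fst (fst v))}" by simp
    \<comment> \<open>The value is split into a value \<open>p\<close> of \<open>f\<close> and a
      remainder, so that each graph is used separately.\<close>
    have "definable {z. \<exists>p. p = f (fst z) \<and> snd z - p = wnn w (fst z)}"
      by (intro definable_ex definable_conj 1 2)
    also have "{z. \<exists>p. p = f (fst z) \<and> snd z - p = wnn w (fst z)} = {z. snd z = F (fst z)}"
      by (auto simp: F_def algebra_simps)
    finally show ?thesis .
  qed
  have "continuous_on UNIV f"
    using grad by (auto simp: continuous_on_eq_continuous_at intro: has_derivative_continuous)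
  then have F_cont: "continuous_on UNIV F"
    unfolding F_def using continuous_on_wnn[OF mn] by (intro continuous_intros)
  obtain R where R: "\<And>t. norm (X t) \<le> R" using bounded by (auto simp: bounded_iff)
  \<comment> \<open>The residual of the prox step, divided by \<open>\<mu>\<close>, is a quadratic
    subgradient of \<open>wnn w\<close> at \<open>X (Suc t)\<close>; adding the gradient of
    \<open>f\<close> at the same point gives one of \<open>F\<close>.\<close>
  define v where "v t = (1 / \<mu>) *\<^sub>R (X t - X (Suc t)) - gradf (X t) + gradf (X (Suc t))" for t
  have g_sub: "wnn w (X (Suc t)) + (1 / \<mu>) * ((X t - X (Suc t)) \<bullet> (Y - X (Suc t))) - gradf (X t) \<bullet> (Y - X (Suc t))
      - 1 / (2 * \<mu>) * (norm (Y - X (Suc t)))\<^sup>2 \<le> wnn w Y" for t Y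
  proof -
    have "(1 / \<mu>) * ((X t - \<mu> *\<^sub>R gradf (X t) - X (Suc t)) \<bullet> (Y - X (Suc t))) =
      (1 / \<mu>) * ((X t - X (Suc t)) \<bullet> (Y - X (Suc t))) - gradf (X t) \<bullet> (Y - X (Suc t))"
      using mu(1) by (simp add: inner_diff_left right_diff_distrib diff_divide_distrib)
    with prox_subgradient[OF mu(1) step, of t Y] show ?thesis by simp
  qed
  have v_sub: "quadratic_subgradient F K (X (Suc t)) (v t)" for t
    unfolding quadratic_subgradient_def
  proof
    fix Y
    define D where "D = Y - X (Suc t)"
    have "f (X (Suc t)) + gradf (X (Suc t)) \<bullet> D - L / 2 * (norm D)\<^sup>2 \<le> f (X (Suc t) + D)"
      by (rule lipschitz_gradient_lower[OF grad lipschitz])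
    moreover have "X (Suc t) + D = Y" by (simp add: D_def)
    moreover have "v t \<bullet> D = (1 / \<mu>) * ((X t - X (Suc t)) \<bullet> D) - gradf (X t) \<bullet> D + gradf (X (Suc t)) \<bullet> D"
      by (simp add: v_def inner_diff_left inner_add_left)
    moreover have "K * (D \<bullet> D) = 1 / (2 * \<mu>) * (norm D)\<^sup>2 + L / 2 * (norm D)\<^sup>2"
      by (simp add: K_def dot_square_norm distrib_right)
    ultimately show "F (X (Suc t)) + v t \<bullet> (Y - X (Suc t)) - K * ((Y - X (Suc t)) \<bullet> (Y - X (Suc t))) \<le> F Y"
      using g_sub[of t Y] unfolding D_def[symmetric] F_def by simp
  qed
  have v_le: "norm (v t) \<le> B * norm (X (Suc t) - X t)" for t
  proof -
    have "v t = (1 / \<mu>) *\<^sub>R (X t - X (Suc t)) + (gradf (X (Suc t)) - gradf (X t))"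
      by (simp add: v_def)
    then have "norm (v t) \<le> norm ((1 / \<mu>) *\<^sub>R (X t - X (Suc t))) + norm (gradf (X (Suc t)) - gradf (X t))"
      by (simp only: norm_triangle_ineq)
    also have "\<dots> \<le> (1 / \<mu>) * norm (X (Suc t) - X t) + L * norm (X (Suc t) - X t)"
      using lipschitz mu(1) by (intro add_mono) (auto simp: norm_minus_commute)
    finally show ?thesis by (simp add: B_def distrib_right)
  qed
  have dec: "F (X (Suc t)) + a * (norm (X (Suc t) - X t))\<^sup>2 \<le> F (X t)" for t
  proof -
    define D where "D = X (Suc t) - X t"
    have D: "X t + D = X (Suc t)" "X t - X (Suc t) = - D" by (simp_all add: D_def)
    have "f (X t + D) \<le> f (X t) + gradf (X t) \<bullet> D + L / 2 * (norm D)\<^sup>2"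
      by (rule lipschitz_gradient_upper[OF grad lipschitz])
    \<comment> \<open>Testing against the old iterate: \<open>D \<bullet> D / \<mu>\<close> minus
      half of itself is what remains for the decrease.\<close>
    moreover have "wnn w (X (Suc t)) + D \<bullet> D / \<mu> + gradf (X t) \<bullet> D - (norm D)\<^sup>2 / (2 * \<mu>) \<le> wnn w (X t)"
      using g_sub[of t "X t"] D(2) by simp
    moreover have "D \<bullet> D / \<mu> = 2 * ((norm D)\<^sup>2 / (2 * \<mu>))" by (simp add: dot_square_norm)
    moreover have "a * (norm D)\<^sup>2 = (norm D)\<^sup>2 / (2 * \<mu>) - L / 2 * (norm D)\<^sup>2"
      by (simp add: a_def left_diff_distrib)
    ultimately show ?thesis unfolding D_def[symmetric] F_def D(1) by linarith
  qed
  have "\<exists>u. norm u \<le> B * norm (X (Suc t) - X t) \<and> quadratic_subgradient F K (X (Suc t)) u" for t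
    using v_le v_sub by blast
  then have sum: "summable (\<lambda>t. norm (X (Suc t) - X t))"
    by (rule definable_descent_summable[where F = F and X = X, OF F_def' F_cont R a B K dec])
  then have "summable (\<lambda>t. X (Suc t) - X t)" by (rule summable_norm_cancel)
  \<comment> \<open>By \<open>X0\<close> the telescoped partial sums are the iterates
    themselves.\<close>
  then have "(\<lambda>n. \<Sum>t<n. X (Suc t) - X t) \<longlonglongrightarrow> (\<Sum>t. X (Suc t) - X t)" by (rule summable_LIMSEQ)
  then obtain Xs where Xs: "X \<longlonglongrightarrow> Xs"
    unfolding sum_lessThan_telescope X0 diff_0_right by blast
  have "0 \<in> lim_subdiff F Xs"
    unfolding lim_subdiff_def
  proof (intro CollectI exI conjI allI)
    show "(\<lambda>k. X (Suc k)) \<longlonglongrightarrow> Xs" using Xs by (rule LIMSEQ_Suc)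
    moreover have "isCont F Xs" using F_cont by (simp add: continuous_on_eq_continuous_at)
    ultimately show "(\<lambda>k. F (X (Suc k))) \<longlonglongrightarrow> F Xs" by (rule isCont_tendsto_compose[rotated])
    show "v k \<in> reg_subdiff F (X (Suc k))" for k by (rule quadratic_subgradient_imp_regular[OF v_sub])
    have "(\<lambda>t. B * norm (X (Suc t) - X t)) \<longlonglongrightarrow> B * 0"
      by (intro tendsto_intros summable_LIMSEQ_zero sum)
    then have "(\<lambda>t. B * norm (X (Suc t) - X t)) \<longlonglongrightarrow> 0" by simp
    then show "v \<longlonglongrightarrow> 0"
      by (rule Lim_null_comparison[rotated]) (intro always_eventually allI v_le)
  qed
  with sum Xs show ?thesis unfolding F_def by blast
qed

end
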